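(* Let $P>0$, let $u_0$ be a $P$-periodic bounded (measurable) function on $\mathbb{R}$, let $m=\frac1P\int_0^Pu_0(x)\,dx$, let $M>0$ with $|u_0|\le M$, and let $K=[-M,M]$. Let $f\in C^1(\mathbb{R},\mathbb{R})$ and let $u$ be the unique entropy solution on $]0,+\infty[_t\times\mathbb{R}_x$ of $$\partial_tu+\partial_xf(u)=0,\qquad u(0,x)=u_0(x).$$ If the degeneracy $p$ of $f$ on $K$ is finite, then there exists a constant $C$ such that, for all $t>0$ and almost all $x\in\mathbb{R}$, $$|u(t,x)-m|\le\frac{C}{t^{s}},\qquad s=\frac1p.$$
   Context: The degeneracy of $f$ on an interval $K$ is the lowest real number $p$, if it exists, such that $0<\inf_{u,v\in K,\,u\ne v}\frac{|a(u)-a(v)|}{|u-v|^p}$, where $a=f'$; if no such real $p$ exists, $p=+\infty$. Finiteness of $p$ forces $a$ to be strictly monotone on $K$ (so $f$ is strictly convex or strictly concave there). Entropy solution means the usual (Kruzhkov) entropy solution of the scalar conservation law. *)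

theory Defs
  imports "HOL-Analysis.Analysis"
begin

text \<open>
  The degeneracy is a minimum, not an infimum: if the set of admissible real exponents is empty or
  has no least element, the degeneracy is infinite.  The inner infimum is taken in the extended
  reals, so that no convention for unbounded or empty sets of quotients is needed.
\<close>

definition nondegenerate_exponent :: "(real \<Rightarrow> real) \<Rightarrow> real set \<Rightarrow> real \<Rightarrow> bool" where
  "nondegenerate_exponent f K p \<longleftrightarrow>
     0 < (INF (u, v) \<in> {(u, v). u \<in> K \<and> v \<in> K \<and> u \<noteq> v}.
            ereal (\<bar>deriv f u - deriv f v\<bar> / \<bar>u - v\<bar> powr p))"

definition is_least_exponent :: "(real \<Rightarrow> real) \<Rightarrow> real set \<Rightarrow> real \<Rightarrow> bool" where
  "is_least_exponent f K p \<longleftrightarrow>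
     nondegenerate_exponent f K p \<and> (\<forall>q. nondegenerate_exponent f K q \<longrightarrow> p \<le> q)"

definition degeneracy :: "(real \<Rightarrow> real) \<Rightarrow> real set \<Rightarrow> ereal" where
  "degeneracy f K =
     (if \<exists>p. is_least_exponent f K p then ereal (THE p. is_least_exponent f K p) else \<infinity>)"

text \<open>
  Points of the open half-plane are pairs (t, x), time first.  A test function is a function of
  class C1 with compact support in the open half-plane; its partial derivatives in t and x are
  carried along as \<open>\<phi>t\<close> and \<open>\<phi>x\<close>.
\<close>

definition half_plane :: "(real \<times> real) set" where
  "half_plane = {0<..} \<times> UNIV"

definition test_function ::
    "(real \<times> real \<Rightarrow> real) \<Rightarrow> (real \<times> real \<Rightarrow> real) \<Rightarrow> (real \<times> real \<Rightarrow> real) \<Rightarrow> bool" where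
  "test_function \<phi> \<phi>t \<phi>x \<longleftrightarrow>
     (\<forall>z. (\<phi> has_derivative (\<lambda>h. \<phi>t z * fst h + \<phi>x z * snd h)) (at z)) \<and>
     continuous_on UNIV \<phi>t \<and> continuous_on UNIV \<phi>x \<and>
     (\<exists>S. compact S \<and> S \<subseteq> half_plane \<and> (\<forall>z. z \<notin> S \<longrightarrow> \<phi> z = 0))"

definition kruzhkov_inequalities :: "(real \<Rightarrow> real) \<Rightarrow> (real \<Rightarrow> real \<Rightarrow> real) \<Rightarrow> bool" where
  "kruzhkov_inequalities f u \<longleftrightarrow>
     (\<forall>k \<phi> \<phi>t \<phi>x. test_function \<phi> \<phi>t \<phi>x \<and> (\<forall>z. 0 \<le> \<phi> z) \<longrightarrow>
        0 \<le> (LINT z:half_plane|lebesgue.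
               \<bar>u (fst z) (snd z) - k\<bar> * \<phi>t z
               + sgn (u (fst z) (snd z) - k) * (f (u (fst z) (snd z)) - f k) * \<phi>x z))"

text \<open>
  Kruzhkov entropy solutions of the Cauchy problem, in the class of bounded measurable functions
  that are continuous in time with values in locally integrable functions of x.  A function that is
  only defined almost everywhere in (t, x) has no well-defined values at a given time; continuity
  in time selects the representative for which \<open>u t\<close> is meaningful, up to null sets in x, for every
  \<open>t > 0\<close>.  The values \<open>u t x\<close> for \<open>t \<le> 0\<close> are irrelevant.
\<close>

definition continuous_in_L1loc :: "(real \<Rightarrow> real \<Rightarrow> real) \<Rightarrow> bool" where
  "continuous_in_L1loc u \<longleftrightarrow>
     (\<forall>t>0. \<forall>r>0. set_integrable lebesgue {-r..r} (u t)) \<and>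
     (\<forall>t>0. \<forall>r>0. ((\<lambda>\<tau>. LINT x:{-r..r}|lebesgue. \<bar>u \<tau> x - u t x\<bar>) \<longlongrightarrow> 0) (at t))"

definition entropy_solution ::
    "(real \<Rightarrow> real) \<Rightarrow> (real \<Rightarrow> real) \<Rightarrow> (real \<Rightarrow> real \<Rightarrow> real) \<Rightarrow> bool" where
  "entropy_solution f u0 u \<longleftrightarrow>
     (\<lambda>z. u (fst z) (snd z)) \<in> borel_measurable (lebesgue_on half_plane) \<and>
     (\<exists>B. AE z in lebesgue_on half_plane. \<bar>u (fst z) (snd z)\<bar> \<le> B) \<and>
     continuous_in_L1loc u \<and>
     kruzhkov_inequalities f u \<and>
     (\<forall>r>0. ((\<lambda>t. LINT x:{-r..r}|lebesgue. \<bar>u t x - u0 x\<bar>) \<longlongrightarrow> 0) (at_right 0))"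

end

theory Submission
  imports Defs
begin

text \<open>
  The solution is integrated to a potential \<open>U\<close> with \<open>U_x = u\<close> and \<open>U_t = - f(u)\<close>.  For a constant
  \<open>k\<close> put \<open>D = U - k x + f(k) t\<close>.  Since \<open>\<bar>u - k\<bar> D_t + sgn (u - k) (f(u) - f(k)) D_x = 0\<close>, the entropy
  inequality for \<open>\<bar>u - k\<bar>\<close> may be multiplied by any \<open>\<phi>(D) \<ge> 0\<close>; with finite speed of propagation, \<open>D\<close>
  therefore attains no values in a backward cone that lie outside the range of \<open>D\<close> on the base of
  the cone.  Thus entropy solutions obey the comparison principle of the Hamilton--Jacobi
  equation \<open>U_t + f(U_x) = 0\<close> with affine functions, and by small time steps also with rarefaction
  fans and focusing compression waves.  No doubling of variables is needed.  For convex \<open>f\<close> this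
  is the Lax--Hopf formula \<open>U(t,x) = min_y (U(0,y) + t L((x - y) / t))\<close>.  If \<open>y\<close> is a
  minimiser, then \<open>a(u(t,x)) = (x - y) / t\<close>, and comparing \<open>y\<close> with \<open>y + P\<close> and \<open>y - P\<close>, where
  \<open>U(0, y + P) = U(0, y) + m P\<close>, yields \<open>\<bar>a(u(t,x)) - a(m)\<bar> \<le> P / t\<close>.  The degeneracy turns this
  into the claimed decay; concave \<open>f\<close> reduces to convex \<open>f\<close> by the reflection \<open>u \<mapsto> - u\<close>.
\<close>

section \<open>Lax--Hopf formula and slopes of periodic solutions\<close>

text \<open>The obstacle is that \<open>f\<close> is only C1. Then \<open>b\<close>, the inverse of
  \<open>f'\<close>, is merely continuous, fans and compression waves are no better than C1, and no
  second-order error estimate is at hand. Affine functions, however, are exact solutions, and over a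
  time step \<open>h\<close> a wave departs from its tangent affine function by an oscillation of
  \<open>b\<close> times O(h); uniform continuity of \<open>b\<close> lets about 1/h such errors sum
  to something arbitrarily small. A second obstacle is the bound on \<open>u\<close>: the solution
  class grants some bound \<open>B\<close>, possibly larger than \<open>M\<close>, while
  \<open>f'\<close> is known to be monotone only on \<open>{-M..M}\<close>. So the slopes
  \<open>k\<close> that are compared, and the Legendre transform, stay within \<open>M\<close>;
  \<open>B\<close> affects only the speed of the cones and auxiliary constants, and the maximum
  principle |u| <= M comes out at the end, together with the slope bound. The rate is explicit:
  |a(u) - a(m)| <= P / t and c |u - m|^p <= |a(u) - a(m)| give the constant (P / c)^(1/p).\<close>

definition affine_comparison :: "real \<Rightarrow> (real \<Rightarrow> real) \<Rightarrow> real \<Rightarrow> (real \<Rightarrow> real \<Rightarrow> real) \<Rightarrow> bool" where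
  "affine_comparison \<Lambda> f M U \<longleftrightarrow>
     (\<forall>k s t x lo hi. \<bar>k\<bar> \<le> M \<longrightarrow> 0 \<le> s \<longrightarrow> s \<le> t \<longrightarrow>
        (\<forall>y. \<bar>y - x\<bar> \<le> \<Lambda> * (t - s) \<longrightarrow> U s y - k * y + f k * s \<in> {lo..hi}) \<longrightarrow>
        U t x - k * x + f k * t \<in> {lo..hi})"

text \<open>Bounding from both sides by one interval makes the property symmetric: negation
  exchanges the two ends, and the slope \<open>- k\<close> takes the place of
  \<open>k\<close>.\<close>

lemma affine_comparison_uminus:
  assumes "affine_comparison \<Lambda> f M U"
  shows "affine_comparison \<Lambda> (\<lambda>k. - f (- k)) M (\<lambda>t x. - U t x)"
  unfolding affine_comparison_def
proof (intro allI impI)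
  fix k s t x lo hi :: real
  assume k: "\<bar>k\<bar> \<le> M" and st: "0 \<le> s" "s \<le> t"
    and *: "\<forall>y. \<bar>y - x\<bar> \<le> \<Lambda> * (t - s) \<longrightarrow> - U s y - k * y + - f (- k) * s \<in> {lo..hi}"
  have "U t x - (- k) * x + f (- k) * t \<in> {- hi.. - lo}"
  proof -
    have "\<bar>- k\<bar> \<le> M" using k by simp
    moreover have "\<forall>y. \<bar>y - x\<bar> \<le> \<Lambda> * (t - s) \<longrightarrow> U s y - (- k) * y + f (- k) * s \<in> {- hi.. - lo}"
    proof (intro allI impI)
      fix y assume "\<bar>y - x\<bar> \<le> \<Lambda> * (t - s)"
      then have "- U s y - k * y + - f (- k) * s \<in> {lo..hi}" using * by blast
      then show "U s y - (- k) * y + f (- k) * s \<in> {- hi.. - lo}" by auto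
    qed
    ultimately show ?thesis using assms st unfolding affine_comparison_def by blast
  qed
  then show "- U t x - k * x + - f (- k) * t \<in> {lo..hi}" by auto
qed

section \<open>Legendre transform over a compact interval of slopes\<close>

locale convex_flux =
  fixes f a :: "real \<Rightarrow> real" and M :: real
  assumes M_pos: "M > 0"
    and deriv_f: "\<And>k. k \<in> {-M..M} \<Longrightarrow> (f has_real_derivative a k) (at k)"
    and cont_a: "continuous_on {-M..M} a"
    and mono_a: "strict_mono_on {-M..M} a"
begin

text \<open>Beyond the range of \<open>a\<close> the function \<open>k * q - f k\<close> of
  \<open>k\<close> in \<open>{-M..M}\<close> is maximal at an endpoint. Clipping \<open>q\<close> to
  that range makes the inverse of \<open>a\<close> return exactly this endpoint, so that
  \<open>b q\<close> is the maximiser for every real \<open>q\<close>.\<close>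

definition clip :: "real \<Rightarrow> real" where
  "clip q = max (a (-M)) (min (a M) q)"

definition b :: "real \<Rightarrow> real" where
  "b q = the_inv_into {-M..M} a (clip q)"

text \<open>The Legendre transform of \<open>f\<close> restricted to \<open>{-M..M}\<close>, written
  through its maximiser. As only slopes up to \<open>M\<close> compete, it is finite and
  \<open>M\<close>-Lipschitz on the whole line.\<close>

definition L :: "real \<Rightarrow> real" where
  "L q = b q * q - f (b q)"

lemma a_le_iff: "u \<in> {-M..M} \<Longrightarrow> v \<in> {-M..M} \<Longrightarrow> a u \<le> a v \<longleftrightarrow> u \<le> v"
  using mono_a strict_mono_on_less_eq by blast

lemma a_endpoints: "a (-M) \<le> a M"
  using M_pos by (simp add: a_le_iff)

lemma inj_a: "inj_on a {-M..M}"
  using mono_a strict_mono_on_imp_inj_on by blast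

lemma image_a: "a ` {-M..M} = {a (-M)..a M}"
proof
  show "a ` {-M..M} \<subseteq> {a (-M)..a M}"
    using M_pos by (auto simp: a_le_iff)
  show "{a (-M)..a M} \<subseteq> a ` {-M..M}"
  proof
    fix y assume "y \<in> {a (-M)..a M}"
    then obtain x where "-M \<le> x" "x \<le> M" "a x = y"
      using IVT'[of a "-M" y M] cont_a M_pos by auto
    then show "y \<in> a ` {-M..M}" by auto
  qed
qed

lemma clip_range: "clip q \<in> {a (-M)..a M}"
  using a_endpoints by (auto simp: clip_def)

lemma b_range: "b q \<in> {-M..M}"
  unfolding b_def using clip_range[of q] image_a by (intro the_inv_into_into[OF inj_a]) auto

lemma abs_b: "\<bar>b q\<bar> \<le> M"
  using b_range[of q] by auto

lemma a_b: "a (b q) = clip q"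
  unfolding b_def using clip_range[of q] image_a by (intro f_the_inv_into_f[OF inj_a]) auto

text \<open>A strictly monotone \<open>a\<close> may be arbitrarily flat, so \<open>b\<close> has no
  Lipschitz bound. The modulus of continuity comes from compactness of the range of \<open>a\<close>
  and from \<open>clip\<close> being 1-Lipschitz; the time stepping in
  \<open>wave_comparison\<close> lives on it.\<close>

lemma b_uniformly_continuous: "uniformly_continuous_on UNIV b"
proof -
  have "continuous_on {a (-M)..a M} (the_inv_into {-M..M} a)"
    using continuous_on_inv_into[OF cont_a _ inj_a] image_a by simp
  then have u: "uniformly_continuous_on {a (-M)..a M} (the_inv_into {-M..M} a)"
    using compact_uniformly_continuous by blast
  have clip: "uniformly_continuous_on UNIV clip"
    unfolding uniformly_continuous_on_def
  proof (intro allI impI)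
    fix e :: real assume "e > 0"
    then show "\<exists>d>0. \<forall>x\<in>UNIV. \<forall>x'\<in>UNIV. dist x' x < d \<longrightarrow> dist (clip x') (clip x) < e"
      by (intro exI[of _ e]) (auto simp: clip_def dist_real_def)
  qed
  have "uniformly_continuous_on (range clip) (the_inv_into {-M..M} a)"
    using u clip_range unfolding uniformly_continuous_on_def by blast
  then have "uniformly_continuous_on UNIV (\<lambda>q. the_inv_into {-M..M} a (clip q))"
    by (rule uniformly_continuous_on_compose[OF clip])
  then show ?thesis by (simp add: b_def[abs_def])
qed

lemma f_convex:
  assumes "k \<in> {-M..M}" "l \<in> {-M..M}"
  shows "f l + a l * (k - l) \<le> f k"
proof -
  consider "k = l" | "l < k" | "k < l" by linarith
  then show ?thesis
  proof cases
    case 2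
    obtain z where "l < z" "z < k" "f k - f l = (k - l) * a z"
      using MVT2[of l k f a] 2 assms deriv_f by auto
    moreover have "a l \<le> a z" using calculation assms by (simp add: a_le_iff)
    ultimately show ?thesis using 2
      by (metis add.commute add_le_cancel_left diff_add_cancel diff_ge_0_iff_ge less_imp_le mult.commute mult_right_mono)
  next
    case 3
    obtain z where z: "k < z" "z < l" "f l - f k = (l - k) * a z"
      using MVT2[of k l f a] 3 assms deriv_f by auto
    moreover have "a z \<le> a l" using z assms by (simp add: a_le_iff)
    ultimately have "(l - k) * a z \<le> (l - k) * a l" using 3 by (simp add: mult_left_mono)
    then show ?thesis using z(3) by (simp add: algebra_simps)
  qed simp
qed

text \<open>The tangent inequality at \<open>b q\<close> gives the claim up to
  \<open>(a (b q) - q) * (k - b q)\<close>. This product is nonnegative: it is 0 if \<open>q\<close>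
  is in the range of \<open>a\<close>, and otherwise \<open>b q\<close> is the endpoint on the side
  of \<open>q\<close>, where both factors have the same sign.\<close>

lemma L_max:
  assumes k: "k \<in> {-M..M}"
  shows "k * q - f k \<le> L q"
proof -
  have 1: "f (b q) + a (b q) * (k - b q) \<le> f k"
    by (rule f_convex[OF k b_range])
  have 2: "(a (b q) - q) * (k - b q) \<ge> 0"
  proof -
    consider "q < a (-M)" | "q > a M" | "a (-M) \<le> q" "q \<le> a M" by linarith
    then show ?thesis
    proof cases
      case 1
      then have "clip q = a (-M)" using a_endpoints by (auto simp: clip_def)
      then have "b q = -M" using M_pos inj_a unfolding b_def by (simp add: the_inv_into_f_f)
      then show ?thesis using 1 k by simp
    next
      case 2
      then have "clip q = a M" using a_endpoints by (auto simp: clip_def)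
      then have "b q = M" using M_pos inj_a unfolding b_def by (simp add: the_inv_into_f_f)
      then show ?thesis using 2 k by (simp add: mult_nonpos_nonpos)
    next
      case 3
      then have "clip q = q" by (auto simp: clip_def)
      then show ?thesis by (simp add: a_b)
    qed
  qed
  show ?thesis using 1 2 by (simp add: L_def algebra_simps)
qed

text \<open>The affine function of slope \<open>b q\<close> that attains the maximum at
  \<open>q\<close> still competes at \<open>q'\<close>.\<close>

lemma L_subgradient: "L q + b q * (q' - q) \<le> L q'"
  using L_max[OF b_range, of q q'] by (simp add: L_def algebra_simps)

lemma L_lipschitz: "\<bar>L q' - L q\<bar> \<le> M * \<bar>q' - q\<bar>"
proof -
  have "\<bar>b q * (q' - q)\<bar> \<le> M * \<bar>q' - q\<bar>" "\<bar>b q' * (q - q')\<bar> \<le> M * \<bar>q' - q\<bar>"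
    using abs_b[of q] abs_b[of q'] by (auto simp: abs_mult abs_minus_commute mult_right_mono)
  then show ?thesis using L_subgradient[of q q'] L_subgradient[of q' q] by linarith
qed

lemma continuous_L: "continuous_on UNIV L"
proof -
  have "dist (L x) (L y) \<le> M * dist x y" for x y
    using L_lipschitz[of x y] by (simp add: dist_real_def)
  then have "M-lipschitz_on UNIV L" using M_pos by (intro lipschitz_onI) auto
  then show ?thesis by (rule lipschitz_on_continuous_on)
qed

text \<open>Since \<open>b q\<close> maximises \<open>k * q - f k\<close>, the function \<open>(s - c) * L ((y - z) / (s - c))\<close> is a
  classical solution of \<open>R_s + f (R_y) = 0\<close>: a rarefaction fan issuing from \<open>(c, z)\<close> if
  \<open>s > c\<close>, and a compression wave focusing at \<open>(c, z)\<close> if \<open>s < c\<close>.\<close>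

definition wave :: "real \<Rightarrow> real \<Rightarrow> real \<Rightarrow> real \<Rightarrow> real" where
  "wave c z s y = (s - c) * L ((y - z) / (s - c))"

text \<open>The tangent plane at the later point \<open>(s', y')\<close> has slope
  \<open>b q'\<close>, which is not the optimal slope at the earlier point; the error is
  \<open>s - c\<close> times what is lost there by using it. Optimality at both \<open>q\<close> and
  \<open>q'\<close> bounds this loss by a product of two increments, which is small of higher order
  than the step.\<close>

lemma wave_tangent:
  fixes c z s y s' y' :: real
  assumes "s \<noteq> c" "s' \<noteq> c"
  defines "q \<equiv> (y - z) / (s - c)" and "q' \<equiv> (y' - z) / (s' - c)"
  shows "\<bar>wave c z s' y' - wave c z s y - b q' * (y' - y) + f (b q') * (s' - s)\<bar>
           \<le> \<bar>s - c\<bar> * (\<bar>b q' - b q\<bar> * \<bar>q' - q\<bar>)"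
proof -
  have yz: "y - z = (s - c) * q" and yz': "y' - z = (s' - c) * q'"
    using assms(1,2) by (simp_all add: q_def q'_def)
  have w: "wave c z s y = b q * (y - z) - (s - c) * f (b q)"
    unfolding wave_def q_def[symmetric] L_def by (simp add: yz algebra_simps)
  have w': "wave c z s' y' = b q' * (y' - z) - (s' - c) * f (b q')"
    unfolding wave_def q'_def[symmetric] L_def by (simp add: yz' algebra_simps)
  \<comment> \<open>\<open>g\<close> is \<open>L q\<close> minus the value that the competitor
    \<open>b q'\<close> reaches at \<open>q\<close>.\<close>
  define g where "g = (f (b q') - f (b q)) - (b q' - b q) * q"
  have "g \<ge> 0" using L_max[OF b_range, of q' q] by (simp add: g_def L_def algebra_simps)
  moreover have "g \<le> (b q' - b q) * (q' - q)"
    using L_max[OF b_range, of q q'] by (simp add: g_def L_def algebra_simps)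
  ultimately have "\<bar>g\<bar> \<le> \<bar>b q' - b q\<bar> * \<bar>q' - q\<bar>"
    using abs_mult[of "b q' - b q" "q' - q"] by linarith
  moreover have "wave c z s' y' - wave c z s y - b q' * (y' - y) + f (b q') * (s' - s) = - ((s - c) * g)"
  proof -
    have "wave c z s' y' - wave c z s y - b q' * (y' - y) + f (b q') * (s' - s)
        = (b q' - b q) * (y - z) - (s - c) * (f (b q') - f (b q))"
      unfolding w w' by (simp add: algebra_simps)
    then show ?thesis unfolding yz g_def by (simp add: algebra_simps)
  qed
  ultimately show ?thesis by (simp add: abs_mult mult_left_mono)
qed

text \<open>Over one step the wave is replaced by its tangent affine function at the upper point
  \<open>(s', x)\<close>, to which \<open>affine_comparison\<close> applies; the tangency error on
  the base of the cone widens the interval by \<open>e * (s' - s)\<close>.\<close>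

lemma wave_step:
  fixes U :: "real \<Rightarrow> real \<Rightarrow> real"
  assumes U: "affine_comparison \<Lambda> f M U" and \<Lambda>: "0 \<le> \<Lambda>"
    and st: "0 \<le> s" "s < s'" and sc: "s \<noteq> c" "s' \<noteq> c"
    and e: "\<And>y. \<bar>y - x\<bar> \<le> \<Lambda> * (s' - s) \<Longrightarrow>
      \<bar>s - c\<bar> * (\<bar>b ((x - z) / (s' - c)) - b ((y - z) / (s - c))\<bar> * \<bar>(x - z) / (s' - c) - (y - z) / (s - c)\<bar>)
        \<le> e * (s' - s)"
    and V: "\<And>y. \<bar>y - x\<bar> \<le> \<Lambda> * (s' - s) \<Longrightarrow> U s y - wave c z s y \<in> {lo..hi}"
  shows "U s' x - wave c z s' x \<in> {lo - e * (s' - s)..hi + e * (s' - s)}"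
proof -
  define k where "k = b ((x - z) / (s' - c))"
  define h where "h = wave c z s' x - k * x + f k * s'"
  have "U s' x - k * x + f k * s' \<in> {lo + h - e * (s' - s)..hi + h + e * (s' - s)}"
  proof -
    have "U s y - k * y + f k * s \<in> {lo + h - e * (s' - s)..hi + h + e * (s' - s)}"
      if y: "\<bar>y - x\<bar> \<le> \<Lambda> * (s' - s)" for y
    proof -
      have "\<bar>wave c z s' x - wave c z s y - k * (x - y) + f k * (s' - s)\<bar> \<le> e * (s' - s)"
        using order_trans[OF wave_tangent[OF sc] e[OF y]] by (simp add: k_def)
      moreover have "k * (x - y) = k * x - k * y" "f k * (s' - s) = f k * s' - f k * s"
        by (simp_all add: right_diff_distrib)
      ultimately show ?thesis using V[OF y] unfolding h_def atLeastAtMost_iff by linarith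
    qed
    moreover have "\<bar>k\<bar> \<le> M" by (simp add: k_def abs_b)
    ultimately show ?thesis using U st unfolding affine_comparison_def
      by (meson less_imp_le)
  qed
  then show ?thesis by (simp add: h_def)
qed

text \<open>Steps of length \<open>h\<close> are chained through a shrinking cone. Each costs
  \<open>e * h\<close>, so the total loss is \<open>e * (s1 - s0)\<close>, and \<open>e\<close> is
  arbitrary. Keeping the distance \<open>\<sigma>\<close> from the singular time \<open>c\<close>
  controls the similarity variable \<open>(y - z) / (s - c)\<close>.\<close>

lemma wave_comparison:
  fixes U :: "real \<Rightarrow> real \<Rightarrow> real"
  assumes U: "affine_comparison \<Lambda> f M U" and \<Lambda>: "0 \<le> \<Lambda>"
    and s: "0 \<le> s0" "s0 < s1" and \<sigma>: "0 < \<sigma>" and sc: "\<And>s. s \<in> {s0..s1} \<Longrightarrow> \<sigma> \<le> \<bar>s - c\<bar>"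
    and V: "\<And>y. \<bar>y - x\<bar> \<le> \<Lambda> * (s1 - s0) \<Longrightarrow> U s0 y - wave c z s0 y \<in> {lo..hi}"
  shows "U s1 x - wave c z s1 x \<in> {lo..hi}"
proof -
  \<comment> \<open>\<open>D * h\<close> bounds \<open>|s - c| * |q' - q|\<close> over one step:
    \<open>\<Lambda>\<close> accounts for the move in space, the quotient by \<open>\<sigma>\<close>
    for the change of the denominator \<open>s - c\<close>.\<close>
  define D where "D = \<Lambda> + (\<bar>x - z\<bar> + \<Lambda> * (s1 - s0)) / \<sigma>"
  have D: "0 \<le> D" using \<Lambda> s \<sigma> by (simp add: D_def)
  have approx: "U s1 x - wave c z s1 x \<in> {lo - e * (s1 - s0)..hi + e * (s1 - s0)}" if e: "e > 0" for e
  proof -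
    \<comment> \<open>The modulus of \<open>b\<close> is taken at \<open>e / (D + 1)\<close> because
      it gets multiplied by \<open>D * h\<close> and the product has to stay below
      \<open>e * h\<close>.\<close>
    obtain d where d: "d > 0" "\<And>q q'. \<bar>q' - q\<bar> < d \<Longrightarrow> \<bar>b q' - b q\<bar> < e / (D + 1)"
    proof -
      have "e / (D + 1) > 0" using e D by simp
      then show ?thesis using b_uniformly_continuous that
        unfolding uniformly_continuous_on_def dist_real_def by (metis UNIV_I)
    qed
    obtain n :: nat where n: "n > 0" "D * (s1 - s0) / \<sigma> / d < real n"
      by (metis reals_Archimedean2 gr_zeroI of_nat_0_less_iff of_nat_0 order_le_less_trans
          divide_nonneg_nonneg mult_nonneg_nonneg D s(2) \<sigma> d(1) less_imp_le diff_ge_0_iff_ge)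
    define h where "h = (s1 - s0) / real n"
    have h: "h > 0" using n s by (simp add: h_def)
    have hd: "D * h / \<sigma> < d"
    proof -
      have "D * (s1 - s0) / \<sigma> < real n * d" using n(2) pos_divide_less_eq[OF d(1)] by blast
      then have "D * (s1 - s0) / \<sigma> / real n < d" using n(1) pos_divide_less_eq[of "real n"] by (metis mult.commute of_nat_0_less_iff)
      then show ?thesis by (simp add: h_def mult.commute)
    qed
    have hn: "real n * h = s1 - s0" using n by (simp add: h_def)
    have main: "j \<le> n \<Longrightarrow> \<bar>y - x\<bar> \<le> \<Lambda> * (s1 - (s0 + real j * h)) \<Longrightarrow>
      U (s0 + real j * h) y - wave c z (s0 + real j * h) y
        \<in> {lo - e * (real j * h)..hi + e * (real j * h)}" for j y
    proof (induction j arbitrary: y)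
      case 0
      then show ?case using V by simp
    next
      case (Suc j)
      define s where "s = s0 + real j * h"
      define s' where "s' = s0 + real (Suc j) * h"
      have s's: "s' - s = h" by (simp add: s_def s'_def algebra_simps)
      have "real (Suc j) * h \<le> real n * h" using Suc.prems(1) h by (intro mult_right_mono) auto
      then have s'1: "s' \<le> s1" using hn by (simp add: s'_def)
      have s0s: "s0 \<le> s" using h by (simp add: s_def)
      have ss': "s < s'" using s's h by simp
      have sc1: "\<sigma> \<le> \<bar>s - c\<bar>" "\<sigma> \<le> \<bar>s' - c\<bar>" using sc s0s s'1 ss' by auto
      have nc: "s \<noteq> c" "s' \<noteq> c" using sc1 \<sigma> by auto
      have y: "\<bar>y - x\<bar> \<le> \<Lambda> * (s1 - s')" using Suc.prems(2) by (simp add: s'_def)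
      have "U s' y - wave c z s' y \<in> {(lo - e * (real j * h)) - e * (s' - s)..(hi + e * (real j * h)) + e * (s' - s)}"
      proof (rule wave_step[OF U \<Lambda> _ ss' nc])
        show "0 \<le> s" using s(1) s0s by simp
        fix w assume w: "\<bar>w - y\<bar> \<le> \<Lambda> * (s' - s)"
        have "\<bar>w - x\<bar> \<le> \<Lambda> * (s' - s) + \<Lambda> * (s1 - s')" using w y by linarith
        also have "\<dots> = \<Lambda> * (s1 - s)" by (simp add: algebra_simps)
        finally show "U s w - wave c z s w \<in> {lo - e * (real j * h)..hi + e * (real j * h)}"
          using Suc.IH[of w] Suc.prems(1) by (simp add: s_def)
        define q where "q = (w - z) / (s - c)"
        define q' where "q' = (y - z) / (s' - c)"
        have "(s - c) * (q' - q) = (y - w) - (y - z) * (s' - s) / (s' - c)"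
        proof -
          have "(s - c) * q = w - z" "(s' - c) * q' = y - z"
            using nc by (simp_all add: q_def q'_def)
          then have "(s - c) * (q' - q) = (y - w) - (s' - s) * q'" by (simp add: algebra_simps)
          then show ?thesis by (simp add: q'_def mult.commute)
        qed
        then have "\<bar>s - c\<bar> * \<bar>q' - q\<bar> \<le> \<bar>y - w\<bar> + \<bar>(y - z) * (s' - s) / (s' - c)\<bar>"
          by (metis abs_mult abs_triangle_ineq4)
        also have "\<bar>(y - z) * (s' - s) / (s' - c)\<bar> \<le> (\<bar>x - z\<bar> + \<Lambda> * (s1 - s0)) / \<sigma> * h"
        proof -
          have "\<Lambda> * (s1 - s') \<le> \<Lambda> * (s1 - s0)" using \<Lambda> s0s ss' by (intro mult_left_mono) auto
          then have "\<bar>y - z\<bar> \<le> \<bar>x - z\<bar> + \<Lambda> * (s1 - s0)" using y by linarith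
          then have "\<bar>y - z\<bar> * h / \<bar>s' - c\<bar> \<le> (\<bar>x - z\<bar> + \<Lambda> * (s1 - s0)) * h / \<sigma>"
            using sc1(2) \<sigma> h by (intro frac_le mult_right_mono) auto
          then show ?thesis using h s's by (simp add: abs_mult)
        qed
        also have "\<bar>y - w\<bar> \<le> \<Lambda> * h" using w s's by (simp add: abs_minus_commute)
        finally have q1: "\<bar>s - c\<bar> * \<bar>q' - q\<bar> \<le> D * h" by (simp add: D_def algebra_simps)
        have "\<sigma> * \<bar>q' - q\<bar> \<le> D * h"
          by (rule order_trans[OF mult_right_mono q1]) (use sc1 in auto)
        then have "\<bar>q' - q\<bar> \<le> D * h / \<sigma>" using \<sigma> by (simp add: field_simps)
        then have "\<bar>b q' - b q\<bar> < e / (D + 1)" using d(2) hd by force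
        then have "\<bar>b q' - b q\<bar> * (\<bar>s - c\<bar> * \<bar>q' - q\<bar>) \<le> e / (D + 1) * (D * h)"
          using e D by (intro mult_mono[OF less_imp_le q1]) simp_all
        also have "\<dots> \<le> e * h"
        proof -
          have "D / (D + 1) \<le> 1" using D by simp
          then have "e * h * (D / (D + 1)) \<le> e * h * 1" using e h by (intro mult_left_mono) auto
          then show ?thesis by (simp add: field_simps)
        qed
        finally show "\<bar>s - c\<bar> * (\<bar>b ((y - z) / (s' - c)) - b ((w - z) / (s - c))\<bar>
            * \<bar>(y - z) / (s' - c) - (w - z) / (s - c)\<bar>) \<le> e * (s' - s)"
          by (simp add: q_def[symmetric] q'_def[symmetric] s's mult.left_commute)
      qed
      then show ?case unfolding s'_def[symmetric] by (simp add: s's algebra_simps)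
    qed
    show ?thesis using main[of n x] hn by simp
  qed
  have "lo \<le> U s1 x - wave c z s1 x + e" "U s1 x - wave c z s1 x \<le> hi + e" if "e > 0" for e
    using approx[of "e / (s1 - s0)"] that s by auto
  then show ?thesis by (meson atLeastAtMost_iff field_le_epsilon)
qed

section \<open>The two halves of the Lax-Hopf formula\<close>

text \<open>Comparison with the fan issuing from \<open>(0, y)\<close>, started at a time
  \<open>\<sigma> > 0\<close> because the fan is singular at time 0. At time \<open>\<sigma>\<close>
  the potential is at most \<open>U 0 y + M * |w - y| + F * \<sigma>\<close>, while the fan is at
  least \<open>M * |w - y|\<close> minus a multiple of \<open>\<sigma>\<close>, since the slopes
  \<open>M\<close> and \<open>- M\<close> compete in \<open>L\<close>. The excess is
  \<open>C * \<sigma>\<close> and disappears in the limit.\<close>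

lemma Lax_Hopf_upper:
  fixes U :: "real \<Rightarrow> real \<Rightarrow> real"
  assumes U: "affine_comparison \<Lambda> f M U" and \<Lambda>: "0 \<le> \<Lambda>"
    and lipx: "\<And>x y. \<bar>U 0 x - U 0 y\<bar> \<le> M * \<bar>x - y\<bar>"
    and lipt: "\<And>s t x. 0 \<le> s \<Longrightarrow> 0 \<le> t \<Longrightarrow> \<bar>U t x - U s x\<bar> \<le> F * \<bar>t - s\<bar>"
    and T: "T > 0"
  shows "U T x \<le> U 0 y + T * L ((x - y) / T)"
proof -
  define C where "C = F + max (f M) (f (-M))"
  have bound: "U T x - wave 0 y T x \<le> U 0 y + C * \<sigma>" if \<sigma>: "0 < \<sigma>" "\<sigma> < T" for \<sigma>
  proof -
    define r where "r = \<Lambda> * (T - \<sigma>) + \<bar>x - y\<bar>"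
    \<comment> \<open>The upper end carries the argument; the lower end is a crude finite bound that
      completes the two-sided interval.\<close>
    have "U T x - wave 0 y T x \<in> {U 0 y - 2 * M * r - F * \<sigma> - \<sigma> * L 0..U 0 y + C * \<sigma>}"
    proof (rule wave_comparison[OF U \<Lambda> _ \<sigma>(2) \<sigma>(1)])
      show "0 \<le> \<sigma>" using \<sigma> by simp
      show "\<sigma> \<le> \<bar>s - 0\<bar>" if "s \<in> {\<sigma>..T}" for s using that \<sigma> by auto
      fix w assume "\<bar>w - x\<bar> \<le> \<Lambda> * (T - \<sigma>)"
      then have r: "M * \<bar>w - y\<bar> \<le> M * r" using M_pos by (intro mult_left_mono) (auto simp: r_def)
      have u: "\<bar>U \<sigma> w - U 0 w\<bar> \<le> F * \<sigma>" "\<bar>U 0 w - U 0 y\<bar> \<le> M * \<bar>w - y\<bar>"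
        using lipt[of 0 \<sigma> w] lipx \<sigma> by auto
      have "\<sigma> * \<bar>L ((w - y) / \<sigma>) - L 0\<bar> \<le> \<sigma> * (M * \<bar>(w - y) / \<sigma> - 0\<bar>)"
        by (rule mult_left_mono[OF L_lipschitz]) (use \<sigma> in simp)
      also have "\<dots> = M * \<bar>w - y\<bar>" using \<sigma> by simp
      finally have "\<bar>\<sigma> * L ((w - y) / \<sigma>) - \<sigma> * L 0\<bar> \<le> M * \<bar>w - y\<bar>"
        using \<sigma> by (simp add: abs_mult flip: right_diff_distrib)
      then have up: "\<sigma> * L ((w - y) / \<sigma>) \<le> \<sigma> * L 0 + M * \<bar>w - y\<bar>" by linarith
      have max: "k * (w - y) - \<sigma> * f k \<le> \<sigma> * L ((w - y) / \<sigma>)" if "k \<in> {-M..M}" for k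
      proof -
        have "\<sigma> * (k * ((w - y) / \<sigma>) - f k) \<le> \<sigma> * L ((w - y) / \<sigma>)"
          using L_max[OF that, of "(w - y) / \<sigma>"] \<sigma> by (intro mult_left_mono) simp_all
        moreover have "\<sigma> * (k * ((w - y) / \<sigma>) - f k) = k * (w - y) - \<sigma> * f k"
          using \<sigma> by (simp add: right_diff_distrib[of \<sigma>])
        ultimately show ?thesis by simp
      qed
      have "\<sigma> * f M \<le> \<sigma> * max (f M) (f (-M))" "\<sigma> * f (-M) \<le> \<sigma> * max (f M) (f (-M))"
        using \<sigma> by (simp_all add: mult_left_mono)
      then have "M * \<bar>w - y\<bar> - \<sigma> * max (f M) (f (-M)) \<le> \<sigma> * L ((w - y) / \<sigma>)"
        using max[of M] max[of "-M"] M_pos by (auto simp: abs_if right_diff_distrib[of M])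
      then show "U \<sigma> w - wave 0 y \<sigma> w \<in> {U 0 y - 2 * M * r - F * \<sigma> - \<sigma> * L 0..U 0 y + C * \<sigma>}"
        using u up r unfolding wave_def C_def abs_le_iff atLeastAtMost_iff
        by (simp add: algebra_simps)
    qed
    then show ?thesis by simp
  qed
  have "((\<lambda>\<sigma>. U 0 y + C * \<sigma>) \<longlongrightarrow> U 0 y + C * 0) (at_right 0)"
    by (intro tendsto_intros)
  moreover have "\<forall>\<^sub>F \<sigma> in at_right 0. U T x - wave 0 y T x \<le> U 0 y + C * \<sigma>"
    using bound eventually_at_right_real[OF T] by (auto elim: eventually_mono)
  ultimately have "U T x - wave 0 y T x \<le> U 0 y"
    using tendsto_lowerbound by fastforce
  then show ?thesis by (simp add: wave_def)
qed

text \<open>Comparison with the compression wave focusing at \<open>(T, x)\<close>. At time 0 it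
  equals \<open>- T * L ((x - w) / T)\<close>, so that \<open>U 0 w\<close> minus the wave is the
  Lax-Hopf functional \<open>G w\<close>, bounded below by its minimum over the compact base of the
  cone. The comparison stops at time \<open>T - \<sigma>\<close>, before the focus, and
  \<open>\<sigma>\<close> tends to 0.\<close>

lemma Lax_Hopf_lower:
  fixes U :: "real \<Rightarrow> real \<Rightarrow> real"
  assumes U: "affine_comparison \<Lambda> f M U" and \<Lambda>: "0 \<le> \<Lambda>"
    and lipx: "\<And>x y. \<bar>U 0 x - U 0 y\<bar> \<le> M * \<bar>x - y\<bar>"
    and lipt: "\<And>s t x. 0 \<le> s \<Longrightarrow> 0 \<le> t \<Longrightarrow> \<bar>U t x - U s x\<bar> \<le> F * \<bar>t - s\<bar>"
    and T: "T > 0"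
  obtains y where "U 0 y + T * L ((x - y) / T) \<le> U T x"
proof -
  define G where "G y = U 0 y + T * L ((x - y) / T)" for y
  have "M-lipschitz_on UNIV (U 0)"
    using lipx M_pos by (intro lipschitz_onI) (auto simp: dist_real_def)
  then have "continuous_on UNIV (U 0)" by (rule lipschitz_on_continuous_on)
  moreover have "continuous_on UNIV (\<lambda>y. L ((x - y) / T))"
    using T by (intro continuous_on_compose2[OF continuous_L]) (auto intro!: continuous_intros)
  ultimately have cont: "continuous_on UNIV G"
    unfolding G_def by (intro continuous_intros)
  define I where "I = {x - \<Lambda> * T..x + \<Lambda> * T}"
  have I: "compact I" "I \<noteq> {}" using \<Lambda> T by (auto simp: I_def)
  have contI: "continuous_on I G" using cont continuous_on_subset by blast
  obtain y where y: "y \<in> I" "\<And>w. w \<in> I \<Longrightarrow> G y \<le> G w"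
    using continuous_attains_inf[OF I contI] by blast
  obtain y' where y': "\<And>w. w \<in> I \<Longrightarrow> G w \<le> G y'"
    using continuous_attains_sup[OF I contI] by blast
  have bound: "G y - (\<bar>L 0\<bar> + F) * \<sigma> \<le> U T x" if \<sigma>: "0 < \<sigma>" "\<sigma> < T" for \<sigma>
  proof -
    have "U (T - \<sigma>) x - wave T x (T - \<sigma>) x \<in> {G y..G y'}"
    proof (rule wave_comparison[OF U \<Lambda> _ _ \<sigma>(1), of 0])
      show "\<sigma> \<le> \<bar>s - T\<bar>" if "s \<in> {0..T - \<sigma>}" for s using that by auto
      fix w assume "\<bar>w - x\<bar> \<le> \<Lambda> * (T - \<sigma> - 0)"
      moreover have "\<Lambda> * (T - \<sigma>) \<le> \<Lambda> * T" using \<Lambda> \<sigma> by (intro mult_left_mono) auto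
      ultimately have "w \<in> I" by (auto simp: I_def abs_le_iff)
      moreover have "(w - x) / (0 - T) = (x - w) / T" using T by (simp add: field_simps)
      ultimately show "U 0 w - wave T x 0 w \<in> {G y..G y'}"
        using y(2) y' by (simp add: wave_def G_def)
    qed (use \<sigma> in auto)
    then have "G y \<le> U (T - \<sigma>) x + \<sigma> * L 0" by (simp add: wave_def)
    moreover have "\<bar>U T x - U (T - \<sigma>) x\<bar> \<le> F * \<sigma>" using lipt[of "T - \<sigma>" T x] \<sigma> by simp
    moreover have "\<sigma> * L 0 \<le> \<sigma> * \<bar>L 0\<bar>" using \<sigma> by (intro mult_left_mono) auto
    ultimately show ?thesis by (simp add: algebra_simps)
  qed
  have "((\<lambda>\<sigma>. G y - (\<bar>L 0\<bar> + F) * \<sigma>) \<longlongrightarrow> G y - (\<bar>L 0\<bar> + F) * 0) (at_right 0)"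
    by (intro tendsto_intros)
  moreover have "\<forall>\<^sub>F \<sigma> in at_right 0. G y - (\<bar>L 0\<bar> + F) * \<sigma> \<le> U T x"
    using bound eventually_at_right_real[OF T] by (auto elim: eventually_mono)
  ultimately have "G y \<le> U T x"
    using tendsto_upperbound by fastforce
  then show ?thesis using that by (simp add: G_def)
qed

section \<open>Periodic translates of the foot of a characteristic\<close>

text \<open>From \<open>b r <= m\<close> one cannot infer \<open>r <= a m\<close> when
  \<open>m = M\<close>, because \<open>b\<close> is constant beyond \<open>a M\<close>. The shifted
  inequality survives, since in that case both arguments are clipped to \<open>a M\<close>.\<close>

lemma b_shift_le:
  assumes "b r \<le> m" "m \<in> {-M..M}" "0 \<le> e"
  shows "b (r + e) \<le> b (a m + e)"
proof -
  have "clip r \<le> a m" using a_le_iff[OF b_range assms(2)] assms(1) a_b by metis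
  moreover have "a (-M) \<le> a m" "a m \<le> a M" using assms(2) by (auto simp: a_le_iff)
  ultimately have "clip (r + e) \<le> clip (a m + e)"
    using assms(3) by (auto simp: clip_def max_def min_def split: if_splits)
  then show ?thesis using a_le_iff[OF b_range b_range] by (simp add: a_b)
qed

lemma b_shift_ge:
  assumes "m \<le> b r" "m \<in> {-M..M}" "0 \<le> e"
  shows "b (a m - e) \<le> b (r - e)"
proof -
  have "a m \<le> clip r" using a_le_iff[OF assms(2) b_range] assms(1) a_b by metis
  moreover have "a (-M) \<le> a m" "a m \<le> a M" using assms(2) by (auto simp: a_le_iff)
  ultimately have "clip (a m - e) \<le> clip (r - e)"
    using assms(3) by (auto simp: clip_def max_def min_def split: if_splits)
  then show ?thesis using a_le_iff[OF b_range b_range] by (simp add: a_b)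
qed

text \<open>Replacing the foot \<open>y\<close> of the minimising characteristic by its periodic translates
  \<open>y + P\<close> and \<open>y - P\<close> pins its slope to within \<open>P / T\<close> of \<open>a m\<close>.\<close>

lemma increment_bounds:
  fixes U :: "real \<Rightarrow> real \<Rightarrow> real"
  assumes U: "affine_comparison \<Lambda> f M U" and \<Lambda>: "0 \<le> \<Lambda>"
    and lipx: "\<And>x y. \<bar>U 0 x - U 0 y\<bar> \<le> M * \<bar>x - y\<bar>"
    and lipt: "\<And>s t x. 0 \<le> s \<Longrightarrow> 0 \<le> t \<Longrightarrow> \<bar>U t x - U s x\<bar> \<le> F * \<bar>t - s\<bar>"
    and per: "\<And>x. U 0 (x + P) = U 0 x + m * P" and P: "P > 0" and m: "m \<in> {-M..M}"
    and T: "T > 0" and h: "h > 0"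
  shows "U T (x + h) - U T x \<in> {h * b (a m - (P + h) / T)..h * b (a m + (P + h) / T)}"
proof -
  note upper = Lax_Hopf_upper[OF U \<Lambda> lipx lipt T]
  note lower = Lax_Hopf_lower[OF U \<Lambda> lipx lipt T]
  have 1: "U T (x + h) - U T x \<le> h * b (a m + (P + h) / T)"
  proof -
    \<comment> \<open>\<open>y\<close> is the foot of a minimising characteristic that ends at
      \<open>(T, x)\<close>. The competitor \<open>y + P\<close> has an initial value larger by
      \<open>m * P\<close>, which forces \<open>b (q - P / T) <= m\<close>.\<close>
    obtain y where y: "U 0 y + T * L ((x - y) / T) \<le> U T x" using lower by blast
    define q where "q = (x - y) / T"
    have "U T x \<le> U 0 (y + P) + T * L ((x - (y + P)) / T)" by (rule upper)
    also have "(x - (y + P)) / T = q - P / T" by (simp add: q_def diff_divide_distrib add_divide_distrib)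
    finally have "T * L q \<le> m * P + T * L (q - P / T)" using y by (simp add: per q_def)
    moreover have "T * (L (q - P / T) + b (q - P / T) * (P / T)) \<le> T * L q"
      using L_subgradient[of "q - P / T" q] T by (intro mult_left_mono) auto
    ultimately have "b (q - P / T) * P \<le> m * P" using T by (simp add: algebra_simps)
    then have "b (q - P / T) \<le> m" using P by simp
    then have b: "b (q - P / T + (P + h) / T) \<le> b (a m + (P + h) / T)"
      using P h T m by (intro b_shift_le) auto
    \<comment> \<open>The same foot now competes for the end point \<open>x + h\<close>. This shifts
      the argument of \<open>L\<close> by \<open>h / T\<close>, whence \<open>(P + h) / T\<close> in
      the bound.\<close>
    have "U T (x + h) \<le> U 0 y + T * L ((x + h - y) / T)" by (rule upper)
    also have "(x + h - y) / T = q + h / T" by (simp add: q_def diff_divide_distrib add_divide_distrib)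
    finally have "U T (x + h) - U T x \<le> T * L (q + h / T) - T * L q" using y by (simp add: q_def)
    also have "\<dots> \<le> h * b (q + h / T)"
    proof -
      have "T * (L (q + h / T) + b (q + h / T) * (q - (q + h / T))) \<le> T * L q"
        using L_subgradient[of "q + h / T" q] T by (intro mult_left_mono) auto
      then show ?thesis using T by (simp add: algebra_simps)
    qed
    also have "\<dots> \<le> h * b (a m + (P + h) / T)"
      using b h by (simp add: add_divide_distrib)
    finally show ?thesis .
  qed
  have 2: "h * b (a m - (P + h) / T) \<le> U T (x + h) - U T x"
  proof -
    \<comment> \<open>Mirror image: the foot belongs to the right end \<open>x + h\<close>, and the
      competitor is \<open>y - P\<close>.\<close>
    obtain y where y: "U 0 y + T * L ((x + h - y) / T) \<le> U T (x + h)" using lower by blast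
    define q where "q = (x + h - y) / T"
    have "U T (x + h) \<le> U 0 (y - P) + T * L ((x + h - (y - P)) / T)" by (rule upper)
    also have "(x + h - (y - P)) / T = q + P / T" by (simp add: q_def diff_divide_distrib add_divide_distrib)
    finally have "T * L q \<le> - m * P + T * L (q + P / T)" using y per[of "y - P"] by (simp add: q_def)
    moreover have "T * (L (q + P / T) + b (q + P / T) * (q - (q + P / T))) \<le> T * L q"
      using L_subgradient[of "q + P / T" q] T by (intro mult_left_mono) auto
    ultimately have "m * P \<le> b (q + P / T) * P" using T by (simp add: algebra_simps)
    then have "m \<le> b (q + P / T)" using P by simp
    then have b: "b (a m - (P + h) / T) \<le> b (q + P / T - (P + h) / T)"
      using P h T m by (intro b_shift_ge) auto
    have "U T x \<le> U 0 y + T * L ((x - y) / T)" by (rule upper)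
    also have "(x - y) / T = q - h / T" by (simp add: q_def diff_divide_distrib add_divide_distrib)
    finally have *: "T * L q - T * L (q - h / T) \<le> U T (x + h) - U T x" using y by (simp add: q_def)
    have "h * b (a m - (P + h) / T) \<le> h * b (q - h / T)"
      using b h by (simp add: add_divide_distrib)
    also have "\<dots> \<le> T * L q - T * L (q - h / T)"
    proof -
      have "T * (L (q - h / T) + b (q - h / T) * (q - (q - h / T))) \<le> T * L q"
        using L_subgradient[of "q - h / T" q] T by (intro mult_left_mono) auto
      then show ?thesis using T by (simp add: algebra_simps)
    qed
    finally show ?thesis using * by linarith
  qed
  show ?thesis using 1 2 by simp
qed

text \<open>As \<open>h\<close> decreases to 0, the difference quotient is trapped between
  \<open>b (a m - P / T)\<close> and \<open>b (a m + P / T)\<close>. Applying \<open>a\<close>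
  undoes \<open>b\<close> up to \<open>clip\<close>, and clipping only moves these values closer to
  \<open>a m\<close>, which is in the range of \<open>a\<close>.\<close>

lemma periodic_slope_bound:
  fixes U :: "real \<Rightarrow> real \<Rightarrow> real"
  assumes U: "affine_comparison \<Lambda> f M U" and \<Lambda>: "0 \<le> \<Lambda>"
    and lipx: "\<And>x y. \<bar>U 0 x - U 0 y\<bar> \<le> M * \<bar>x - y\<bar>"
    and lipt: "\<And>s t x. 0 \<le> s \<Longrightarrow> 0 \<le> t \<Longrightarrow> \<bar>U t x - U s x\<bar> \<le> F * \<bar>t - s\<bar>"
    and per: "\<And>x. U 0 (x + P) = U 0 x + m * P" and P: "P > 0" and m: "m \<in> {-M..M}"
    and T: "T > 0"
    and v: "((\<lambda>h. (U T (x + h) - U T x) / h) \<longlongrightarrow> v) (at_right 0)"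
  shows "v \<in> {-M..M}" and "\<bar>a v - a m\<bar> \<le> P / T"
proof -
  note incr = increment_bounds[OF U \<Lambda> lipx lipt per P m T]
  have "continuous_on UNIV b"
    using b_uniformly_continuous uniformly_continuous_imp_continuous by blast
  then have b: "isCont b q" for q by (simp add: continuous_on_eq_continuous_at)
  have "((\<lambda>h. b (a m + (P + h) / T)) \<longlongrightarrow> b (a m + (P + 0) / T)) (at_right 0)"
    by (intro isCont_tendsto_compose[OF b] tendsto_intros) (use T in auto)
  moreover have "\<forall>\<^sub>F h in at_right 0. (U T (x + h) - U T x) / h \<le> b (a m + (P + h) / T)"
    using incr eventually_at_right_less[of 0]
    by (auto elim!: eventually_mono simp: pos_divide_le_eq mult.commute)
  ultimately have up: "v \<le> b (a m + P / T)"
    using tendsto_le[OF _ _ v] by fastforce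
  have "((\<lambda>h. b (a m - (P + h) / T)) \<longlongrightarrow> b (a m - (P + 0) / T)) (at_right 0)"
    by (intro isCont_tendsto_compose[OF b] tendsto_intros) (use T in auto)
  moreover have "\<forall>\<^sub>F h in at_right 0. b (a m - (P + h) / T) \<le> (U T (x + h) - U T x) / h"
    using incr eventually_at_right_less[of 0]
    by (auto elim!: eventually_mono simp: pos_le_divide_eq mult.commute)
  ultimately have lo: "b (a m - P / T) \<le> v"
    using tendsto_le[OF _ v] by fastforce
  show vM: "v \<in> {-M..M}" using lo up b_range[of "a m + P / T"] b_range[of "a m - P / T"] by auto
  have am: "a (-M) \<le> a m" "a m \<le> a M" using m by (auto simp: a_le_iff)
  have PT: "P / T > 0" using P T by simp
  have "a v \<le> clip (a m + P / T)" using a_le_iff[OF vM b_range] up by (simp add: a_b[symmetric])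
  also have "\<dots> \<le> a m + P / T" using am PT by (auto simp: clip_def)
  finally have 1: "a v \<le> a m + P / T" .
  have "a m - P / T \<le> clip (a m - P / T)" using am PT by (auto simp: clip_def)
  also have "\<dots> \<le> a v" using a_le_iff[OF b_range vM] lo by (simp add: a_b[symmetric])
  finally show "\<bar>a v - a m\<bar> \<le> P / T" using 1 by linarith
qed

end

section \<open>Steklov averages and auxiliary functions\<close>

text \<open>The square makes the positive part C1, which is the regularity that
  \<open>test_function\<close> asks for.\<close>

definition sq_pos :: "real \<Rightarrow> real" where
  "sq_pos x = (max 0 x)\<^sup>2"

lemma sq_pos_nonneg [simp]: "0 \<le> sq_pos x"
  by (simp add: sq_pos_def)

lemma sq_pos_eq_0 [simp]: "sq_pos x = 0 \<longleftrightarrow> x \<le> 0"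
  by (auto simp: sq_pos_def max_def)

lemma continuous_on_sq_pos [continuous_intros]:
  "continuous_on S g \<Longrightarrow> continuous_on S (\<lambda>x. sq_pos (g x))"
  unfolding sq_pos_def by (intro continuous_intros)

lemma DERIV_sq_pos: "(sq_pos has_real_derivative 2 * max 0 x) (at x)"
proof -
  consider "x < 0" | "x > 0" | "x = 0" by linarith
  then show ?thesis
  proof cases
    case 1
    have "(sq_pos has_real_derivative 0) (at x)"
      by (rule has_field_derivative_transform_within_open[of "\<lambda>_. 0" _ _ "{..<0}"])
        (use 1 in \<open>auto simp: sq_pos_def\<close>)
    then show ?thesis using 1 by simp
  next
    case 2
    have "((\<lambda>x. x\<^sup>2) has_real_derivative 2 * x) (at x)"
      by (auto intro!: derivative_eq_intros)
    then have "(sq_pos has_real_derivative 2 * x) (at x)"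
      by (rule has_field_derivative_transform_within_open[of _ _ _ "{0<..}"])
        (use 2 in \<open>auto simp: sq_pos_def\<close>)
    then show ?thesis using 2 by simp
  next
    case 3
    have "((\<lambda>h. sq_pos h / h) \<longlongrightarrow> 0) (at 0)"
    proof (rule Lim_null_comparison)
      show "\<forall>\<^sub>F h in at 0. norm (sq_pos h / h) \<le> \<bar>h\<bar>"
        by (rule always_eventually) (auto simp: sq_pos_def max_def power2_eq_square)
      show "((\<lambda>h::real. \<bar>h\<bar>) \<longlongrightarrow> 0) (at 0)"
        by (intro tendsto_eq_intros | simp)+
    qed
    then show ?thesis using 3 by (simp add: DERIV_def sq_pos_def[of 0])
  qed
qed

lemmas DERIV_sq_pos' [derivative_intros] = DERIV_sq_pos [THEN DERIV_chain2]

lemma has_derivative_of_partials: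
  fixes g g1 g2 :: "real \<times> real \<Rightarrow> real"
  assumes "\<And>t x. ((\<lambda>t. g (t, x)) has_real_derivative g1 (t, x)) (at t)"
    and "\<And>t x. ((\<lambda>x. g (t, x)) has_real_derivative g2 (t, x)) (at x)"
    and "continuous_on UNIV g2"
  shows "(g has_derivative (\<lambda>h. g1 z * fst h + g2 z * snd h)) (at z)"
proof -
  obtain t x where z: "z = (t, x)" by (cases z)
  have "((\<lambda>(t, x). g (t, x)) has_derivative
      (\<lambda>(dt, dx). g1 (t, x) * dt + blinfun_scaleR_left (g2 (t, x)) dx)) (at (t, x) within UNIV \<times> UNIV)"
  proof (rule has_derivative_partialsI)
    show "((\<lambda>t. g (t, x)) has_derivative (*) (g1 (t, x))) (at t within UNIV)"
      using assms(1) by (simp add: has_field_derivative_def)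
    show "((\<lambda>x. g (t, x)) has_derivative blinfun_apply (blinfun_scaleR_left (g2 (t, x)))) (at x within UNIV)"
      for t x
    proof -
      have "blinfun_apply (blinfun_scaleR_left (g2 (t, x))) = (*) (g2 (t, x))"
        by (auto simp: fun_eq_iff)
      then show ?thesis using assms(2)[of t x] by (simp add: has_field_derivative_def)
    qed
    have "continuous (at (t, x)) g2"
      using assms(3) by (simp add: continuous_on_eq_continuous_at)
    then show "continuous (at (t, x) within UNIV \<times> UNIV) (\<lambda>(t, x). blinfun_scaleR_left (g2 (t, x)))"
      by (auto simp: split_beta' intro!: continuous_intros)
  qed auto
  then show ?thesis by (simp add: z split_beta' mult.commute)
qed

lemma DERIV_moving_integral:
  fixes h :: "real \<Rightarrow> real"
  assumes h: "continuous_on UNIV h" and e: "0 \<le> e"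
  shows "((\<lambda>t. integral {0..e} (\<lambda>\<tau>. h (t + \<tau>))) has_real_derivative h (t + e) - h t) (at t)"
proof -
  define H where "H s = integral {t - 1..s} h" for s
  have H: "(H has_real_derivative h s) (at s)" if "t - 1 < s" "s < t + e + 2" for s
  proof -
    have "(H has_real_derivative h s) (at s within {t - 1..t + e + 2})"
      unfolding H_def using h continuous_on_subset that
      by (intro integral_has_real_derivative) auto
    moreover have "at s within {t - 1..t + e + 2} = at s"
      using that by (intro at_within_Icc_at) auto
    ultimately show ?thesis by simp
  qed
  have eq: "H (s + e) - H s = integral {0..e} (\<lambda>\<tau>. h (s + \<tau>))" if "t - 1 < s" for s
  proof -
    have int: "h integrable_on {t - 1..s + e}"
      using h continuous_on_subset by (intro integrable_continuous_real) blast
    have "H s + integral {s..s + e} h = H (s + e)"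
      unfolding H_def using that e by (intro Henstock_Kurzweil_Integration.integral_combine int) auto
    moreover have "integral {s..s + e} h = integral {0..e} (\<lambda>\<tau>. h (s + \<tau>))"
      using integral_shift_Icc_real[of 0 e h s] h
      by (simp add: comp_def add.commute)
    ultimately show ?thesis by simp
  qed
  have "((\<lambda>s. H (s + e) - H s) has_real_derivative h (t + e) * 1 - h t) (at t)"
    using e by (intro DERIV_diff DERIV_chain2[where g = "\<lambda>s. s + e"] H)
      (auto intro!: derivative_eq_intros)
  then have "((\<lambda>s. H (s + e) - H s) has_real_derivative h (t + e) - h t) (at t)" by simp
  then show ?thesis
    by (rule has_field_derivative_transform_within_open[of _ _ _ "{t - 1<..}"]) (auto simp: eq)
qed

section \<open>Steklov averages of a Lipschitz function\<close>

text \<open>The average of \<open>g\<close> over the square of side \<open>e\<close> with lower left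
  corner \<open>z\<close>. It is C1 for Lipschitz \<open>g\<close>, and its partial derivatives are
  differences of averages over opposite sides. For a potential these are averages of the derivatives
  over the square; the square lies forward in time, so it stays in the half-plane.\<close>

definition steklov :: "real \<Rightarrow> (real \<Rightarrow> real \<Rightarrow> real) \<Rightarrow> real \<times> real \<Rightarrow> real" where
  "steklov e g z = integral {0..e} (\<lambda>\<tau>. integral {0..e} (\<lambda>y. g (fst z + \<tau>) (snd z + y))) / e\<^sup>2"

definition steklov_t :: "real \<Rightarrow> (real \<Rightarrow> real \<Rightarrow> real) \<Rightarrow> real \<times> real \<Rightarrow> real" where
  "steklov_t e g z = integral {0..e} (\<lambda>y. g (fst z + e) (snd z + y) - g (fst z) (snd z + y)) / e\<^sup>2"

definition steklov_x :: "real \<Rightarrow> (real \<Rightarrow> real \<Rightarrow> real) \<Rightarrow> real \<times> real \<Rightarrow> real" where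
  "steklov_x e g z = integral {0..e} (\<lambda>\<tau>. g (fst z + \<tau>) (snd z + e) - g (fst z + \<tau>) (snd z)) / e\<^sup>2"

lemma integral_average_bound:
  fixes h :: "real \<Rightarrow> real"
  assumes "continuous_on {0..e} h" "e > 0" "\<And>y. y \<in> {0..e} \<Longrightarrow> \<bar>h y - c\<bar> \<le> C"
  shows "\<bar>integral {0..e} h - c * e\<bar> \<le> C * e"
proof -
  have "integral {0..e} h - c * e = integral {0..e} (\<lambda>y. h y - c)"
    using assms by (simp add: integral_diff integrable_continuous_real mult.commute)
  also have "norm \<dots> \<le> C * (e - 0)"
    using assms by (intro integral_bound) (auto intro!: continuous_intros)
  finally show ?thesis by simp
qed

context
  fixes g :: "real \<Rightarrow> real \<Rightarrow> real" and e F B :: real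
  assumes lip: "\<And>t x s y. \<bar>g t x - g s y\<bar> \<le> F * \<bar>t - s\<bar> + B * \<bar>x - y\<bar>" and e: "e > 0"
begin

private lemma cont: "continuous_on UNIV (\<lambda>z. g (fst z) (snd z))"
proof -
  have "F \<ge> 0" "B \<ge> 0" using lip[of 0 0 1 0] lip[of 0 0 0 1] by auto
  have "(F + B)-lipschitz_on UNIV (\<lambda>z. g (fst z) (snd z))"
  proof (rule lipschitz_onI)
    fix z z' :: "real \<times> real"
    have "F * \<bar>fst z - fst z'\<bar> \<le> F * dist z z'" "B * \<bar>snd z - snd z'\<bar> \<le> B * dist z z'"
      using \<open>F \<ge> 0\<close> \<open>B \<ge> 0\<close> dist_fst_le[of z z'] dist_snd_le[of z z']
      by (auto simp: dist_real_def intro!: mult_left_mono)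
    then show "dist (g (fst z) (snd z)) (g (fst z') (snd z')) \<le> (F + B) * dist z z'"
      using lip[of "fst z" "snd z" "fst z'" "snd z'"] by (simp add: dist_real_def distrib_right)
  qed (use \<open>F \<ge> 0\<close> \<open>B \<ge> 0\<close> in auto)
  then show ?thesis by (rule lipschitz_on_continuous_on)
qed

lemma continuous_lipschitz_compose:
  "continuous_on S h \<Longrightarrow> continuous_on S h' \<Longrightarrow> continuous_on S (\<lambda>z. g (h z) (h' z))"
  using continuous_on_compose2[OF cont, of S "\<lambda>z. (h z, h' z)"]
  by (auto intro!: continuous_on_Pair)

private lemma cont_param1: "continuous_on UNIV (\<lambda>z. integral {0..e} (\<lambda>y. g (fst z) (snd z + y)))"
  using integral_continuous_on_param[of UNIV 0 e "\<lambda>z y. g (fst z) (snd z + y)"]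
  by (simp add: split_beta continuous_lipschitz_compose continuous_on_add continuous_on_fst continuous_on_snd)

private lemma cont_param2: "continuous_on UNIV (\<lambda>z. integral {0..e} (\<lambda>\<tau>. g (fst z + \<tau>) (snd z)))"
  using integral_continuous_on_param[of UNIV 0 e "\<lambda>z \<tau>. g (fst z + \<tau>) (snd z)"]
  by (simp add: split_beta continuous_lipschitz_compose continuous_on_add continuous_on_fst continuous_on_snd)

private lemma cont_integral1:
  assumes "continuous_on S h" "continuous_on S h'"
  shows "continuous_on S (\<lambda>z. integral {0..e} (\<lambda>y. g (h z) (h' z + y)))"
  using continuous_on_compose2[OF cont_param1 continuous_on_Pair[OF assms] subset_UNIV] by simp

private lemma cont_integral2:
  assumes "continuous_on S h" "continuous_on S h'"
  shows "continuous_on S (\<lambda>z. integral {0..e} (\<lambda>\<tau>. g (h z + \<tau>) (h' z)))"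
  using continuous_on_compose2[OF cont_param2 continuous_on_Pair[OF assms] subset_UNIV] by simp

private lemma steklov_t_eq: "steklov_t e g (t, x) =
    (integral {0..e} (\<lambda>y. g (t + e) (x + y)) - integral {0..e} (\<lambda>y. g t (x + y))) / e\<^sup>2"
  unfolding steklov_t_def
  by (simp add: integral_diff integrable_continuous_real continuous_lipschitz_compose continuous_on_add)

private lemma steklov_x_eq: "steklov_x e g (t, x) =
    (integral {0..e} (\<lambda>\<tau>. g (t + \<tau>) (x + e)) - integral {0..e} (\<lambda>\<tau>. g (t + \<tau>) x)) / e\<^sup>2"
  unfolding steklov_x_def
  by (simp add: integral_diff integrable_continuous_real continuous_lipschitz_compose continuous_on_add)

lemma DERIV_steklov_t: "((\<lambda>t. steklov e g (t, x)) has_real_derivative steklov_t e g (t, x)) (at t)"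
proof -
  have "continuous_on UNIV (\<lambda>t. integral {0..e} (\<lambda>y. g t (x + y)))"
    by (intro cont_integral1 continuous_intros)
  then have "((\<lambda>t. integral {0..e} (\<lambda>\<tau>. integral {0..e} (\<lambda>y. g (t + \<tau>) (x + y)))) has_real_derivative
      integral {0..e} (\<lambda>y. g (t + e) (x + y)) - integral {0..e} (\<lambda>y. g t (x + y))) (at t)"
    using DERIV_moving_integral e by force
  then show ?thesis unfolding steklov_def steklov_t_eq fst_conv snd_conv
    by (rule DERIV_cdivide)
qed

lemma DERIV_steklov_x: "((\<lambda>x. steklov e g (t, x)) has_real_derivative steklov_x e g (t, x)) (at x)"
proof -
  have "continuous_on UNIV (\<lambda>x. integral {0..e} (\<lambda>\<tau>. g (t + \<tau>) x))"
    by (intro cont_integral2 continuous_intros)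
  then have "((\<lambda>x. integral {0..e} (\<lambda>y. integral {0..e} (\<lambda>\<tau>. g (t + \<tau>) (x + y)))) has_real_derivative
      integral {0..e} (\<lambda>\<tau>. g (t + \<tau>) (x + e)) - integral {0..e} (\<lambda>\<tau>. g (t + \<tau>) x)) (at x)"
    using DERIV_moving_integral e by force
  moreover have "integral {0..e} (\<lambda>y. integral {0..e} (\<lambda>\<tau>. g (t + \<tau>) (x + y)))
      = integral {0..e} (\<lambda>\<tau>. integral {0..e} (\<lambda>y. g (t + \<tau>) (x + y)))" for x
  proof -
    have "continuous_on (cbox (0, 0) (e, e)) (\<lambda>(y, \<tau>). g (t + \<tau>) (x + y))"
      by (simp add: split_beta continuous_lipschitz_compose continuous_on_add continuous_on_fst continuous_on_snd)
    then show ?thesis using integral_swap_continuous[of 0 0 e e "\<lambda>y \<tau>. g (t + \<tau>) (x + y)"]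
      by simp
  qed
  ultimately show ?thesis unfolding steklov_def steklov_x_eq fst_conv snd_conv
    by (intro DERIV_cdivide) simp
qed

lemma continuous_steklov_t: "continuous_on UNIV (steklov_t e g)"
proof -
  have "continuous_on UNIV (\<lambda>z. (integral {0..e} (\<lambda>y. g (fst z + e) (snd z + y))
      - integral {0..e} (\<lambda>y. g (fst z) (snd z + y))) / e\<^sup>2)"
    using e by (intro cont_integral1 continuous_intros) auto
  moreover have "steklov_t e g = (\<lambda>z. (integral {0..e} (\<lambda>y. g (fst z + e) (snd z + y))
      - integral {0..e} (\<lambda>y. g (fst z) (snd z + y))) / e\<^sup>2)"
    by (simp add: fun_eq_iff steklov_t_eq)
  ultimately show ?thesis by simp
qed

lemma continuous_steklov_x: "continuous_on UNIV (steklov_x e g)"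
proof -
  have "continuous_on UNIV (\<lambda>z. (integral {0..e} (\<lambda>\<tau>. g (fst z + \<tau>) (snd z + e))
      - integral {0..e} (\<lambda>\<tau>. g (fst z + \<tau>) (snd z))) / e\<^sup>2)"
    using e by (intro cont_integral2 continuous_intros) auto
  moreover have "steklov_x e g = (\<lambda>z. (integral {0..e} (\<lambda>\<tau>. g (fst z + \<tau>) (snd z + e))
      - integral {0..e} (\<lambda>\<tau>. g (fst z + \<tau>) (snd z))) / e\<^sup>2)"
    by (simp add: fun_eq_iff steklov_x_eq)
  ultimately show ?thesis by simp
qed

lemma continuous_steklov: "continuous_on UNIV (steklov e g)"
proof -
  have "(steklov e g has_derivative (\<lambda>h. steklov_t e g z * fst h + steklov_x e g z * snd h)) (at z)" for z
    by (rule has_derivative_of_partials[OF DERIV_steklov_t DERIV_steklov_x continuous_steklov_x])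
  then show ?thesis
    using has_derivative_continuous by (metis continuous_at_imp_continuous_on)
qed

text \<open>The Lipschitz constants of \<open>g\<close> survive averaging uniformly in
  \<open>e\<close>, which supplies the dominating function when \<open>e\<close> tends to 0.\<close>

lemma steklov_t_bound: "\<bar>steklov_t e g z\<bar> \<le> F"
proof -
  have "\<bar>integral {0..e} (\<lambda>y. g (fst z + e) (snd z + y) - g (fst z) (snd z + y)) - 0 * e\<bar> \<le> (F * e) * e"
  proof (rule integral_average_bound[OF _ e])
    show "\<bar>g (fst z + e) (snd z + y) - g (fst z) (snd z + y) - 0\<bar> \<le> F * e" for y
      using lip[of "fst z + e" "snd z + y" "fst z" "snd z + y"] e by simp
  qed (intro continuous_intros continuous_lipschitz_compose)
  then show ?thesis using e by (simp add: steklov_t_def power2_eq_square field_simps)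
qed

lemma steklov_x_bound: "\<bar>steklov_x e g z\<bar> \<le> B"
proof -
  have "\<bar>integral {0..e} (\<lambda>\<tau>. g (fst z + \<tau>) (snd z + e) - g (fst z + \<tau>) (snd z)) - 0 * e\<bar> \<le> (B * e) * e"
  proof (rule integral_average_bound[OF _ e])
    show "\<bar>g (fst z + \<tau>) (snd z + e) - g (fst z + \<tau>) (snd z) - 0\<bar> \<le> B * e" for \<tau>
      using lip[of "fst z + \<tau>" "snd z + e" "fst z + \<tau>" "snd z"] e by simp
  qed (intro continuous_intros continuous_lipschitz_compose)
  then show ?thesis using e by (simp add: steklov_x_def power2_eq_square field_simps)
qed

lemma steklov_approx: "\<bar>steklov e g z - g (fst z) (snd z)\<bar> \<le> (F + B) * e"
proof -
  have FB: "F \<ge> 0" "B \<ge> 0" using lip[of 0 0 1 0] lip[of 0 0 0 1] by auto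
  let ?c = "g (fst z) (snd z)"
  have 1: "\<bar>integral {0..e} (\<lambda>y. g (fst z + \<tau>) (snd z + y)) - ?c * e\<bar> \<le> ((F + B) * e) * e"
    if \<tau>: "\<tau> \<in> {0..e}" for \<tau>
  proof (rule integral_average_bound[OF _ e])
    show "\<bar>g (fst z + \<tau>) (snd z + y) - ?c\<bar> \<le> (F + B) * e" if y: "y \<in> {0..e}" for y
    proof -
      have "F * \<tau> \<le> F * e" "B * y \<le> B * e" using FB \<tau> y by (auto intro!: mult_left_mono)
      then show ?thesis
        using lip[of "fst z + \<tau>" "snd z + y" "fst z" "snd z"] \<tau> y by (simp add: distrib_right)
    qed
  qed (intro continuous_intros continuous_lipschitz_compose)
  have "\<bar>integral {0..e} (\<lambda>\<tau>. integral {0..e} (\<lambda>y. g (fst z + \<tau>) (snd z + y))) - (?c * e) * e\<bar>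
      \<le> (((F + B) * e) * e) * e"
  proof (rule integral_average_bound[OF _ e 1])
    show "continuous_on {0..e} (\<lambda>\<tau>. integral {0..e} (\<lambda>y. g (fst z + \<tau>) (snd z + y)))"
      by (intro cont_integral1 continuous_intros)
  qed
  then have "\<bar>integral {0..e} (\<lambda>\<tau>. integral {0..e} (\<lambda>y. g (fst z + \<tau>) (snd z + y))) - ?c * e\<^sup>2\<bar> / e\<^sup>2
      \<le> (F + B) * e"
    using e by (simp add: power2_eq_square field_simps)
  moreover have "steklov e g z - ?c
      = (integral {0..e} (\<lambda>\<tau>. integral {0..e} (\<lambda>y. g (fst z + \<tau>) (snd z + y))) - ?c * e\<^sup>2) / e\<^sup>2"
    using e by (simp add: steklov_def diff_divide_distrib)
  ultimately show ?thesis by simp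
qed

end

section \<open>Lebesgue differentiation and bounded integrands\<close>

lemma integrable_on_cbox_bounded_borel:
  fixes w :: "'a::euclidean_space \<Rightarrow> real"
  assumes "w \<in> borel_measurable borel" "\<And>z. \<bar>w z\<bar> \<le> B"
  shows "set_integrable lborel (cbox a b) w" "w integrable_on cbox a b"
proof -
  show *: "set_integrable lborel (cbox a b) w"
    unfolding set_integrable_def
  proof (rule integrableI_bounded_set_indicator[where B = B])
    show "emeasure lborel (cbox a b) < \<infinity>" by (simp add: emeasure_lborel_cbox_eq)
  qed (use assms in auto)
  then show "w integrable_on cbox a b" by (rule set_borel_integral_eq_integral)
qed

text \<open>Lebesgue differentiation along the squares to which \<open>steklov_t_box\<close> and
  \<open>steklov_x_box\<close> reduce the Steklov derivatives of the potential.\<close>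

lemma AE_box_average_tendsto:
  fixes w :: "real \<times> real \<Rightarrow> real"
  assumes "w \<in> borel_measurable borel" "\<And>z. \<bar>w z\<bar> \<le> B"
  shows "AE z in lborel. (\<lambda>n. integral (cbox z (z + (1 / Suc n, 1 / Suc n))) w / (1 / Suc n)\<^sup>2) \<longlonglongrightarrow> w z"
proof -
  obtain N where N: "negligible N" and
    lim: "\<And>z e. \<lbrakk>z \<notin> N; 0 < e\<rbrakk> \<Longrightarrow>
      \<exists>d>0. \<forall>h. 0 < h \<and> h < d \<longrightarrow>
        norm (integral (cbox z (z + h *\<^sub>R One)) w /\<^sub>R h ^ DIM(real \<times> real) - w z) < e"
    using integrable_ccontinuous_explicit[of w] integrable_on_cbox_bounded_borel[OF assms] by metis
  have "(\<lambda>n. integral (cbox z (z + (1 / Suc n, 1 / Suc n))) w / (1 / Suc n)\<^sup>2) \<longlonglongrightarrow> w z" if "z \<notin> N" for z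
  proof (rule LIMSEQ_I)
    fix e :: real assume "e > 0"
    then obtain d where d: "d > 0" "\<And>h. 0 < h \<Longrightarrow> h < d \<Longrightarrow>
        norm (integral (cbox z (z + h *\<^sub>R One)) w /\<^sub>R h ^ DIM(real \<times> real) - w z) < e"
      using lim \<open>z \<notin> N\<close> by meson
    obtain n0 where n0: "1 / real (Suc n0) < d" using d(1) nat_approx_posE by blast
    have One: "(One :: real \<times> real) = (1, 1)"
      by (simp add: Basis_prod_def sum.union_disjoint sum.reindex inj_on_def disjoint_iff)
    show "\<exists>n0. \<forall>n\<ge>n0. norm (integral (cbox z (z + (1 / Suc n, 1 / Suc n))) w / (1 / Suc n)\<^sup>2 - w z) < e"
    proof (intro exI allI impI)
      fix n assume "n \<ge> n0"
      then have "1 / real (Suc n) \<le> 1 / real (Suc n0)" by (simp add: field_simps)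
      then have "1 / real (Suc n) < d" using n0 by linarith
      then have *: "norm (integral (cbox z (z + (1 / real (Suc n)) *\<^sub>R One)) w
          /\<^sub>R (1 / real (Suc n)) ^ DIM(real \<times> real) - w z) < e"
        by (intro d(2)) auto
      show "norm (integral (cbox z (z + (1 / Suc n, 1 / Suc n))) w / (1 / Suc n)\<^sup>2 - w z) < e"
        using * unfolding One by (simp add: divide_inverse mult.commute power2_eq_square)
    qed
  qed
  then have "{z. \<not> (\<lambda>n. integral (cbox z (z + (1 / Suc n, 1 / Suc n))) w / (1 / Suc n)\<^sup>2) \<longlonglongrightarrow> w z} \<subseteq> N"
    by auto
  then have "AE z in lebesgue. (\<lambda>n. integral (cbox z (z + (1 / Suc n, 1 / Suc n))) w / (1 / Suc n)\<^sup>2) \<longlonglongrightarrow> w z"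
    using N AE_I'[of N lebesgue] by (simp add: negligible_iff_null_sets)
  then show ?thesis by (simp add: AE_completion_iff)
qed

lemma compact_continuous_abs_bound:
  fixes h :: "'a::topological_space \<Rightarrow> real"
  assumes "compact S" "continuous_on S h"
  obtains C where "0 \<le> C" "\<And>z. z \<in> S \<Longrightarrow> \<bar>h z\<bar> \<le> C"
proof -
  have "bounded (h ` S)"
    using assms compact_continuous_image compact_imp_bounded by blast
  then obtain C where "0 < C" "\<forall>y\<in>h ` S. norm y \<le> C" unfolding bounded_pos by blast
  then show ?thesis using that[of C] by auto
qed

lemma abs_mult_le:
  fixes a b :: real
  shows "\<bar>a\<bar> \<le> A \<Longrightarrow> \<bar>b\<bar> \<le> B \<Longrightarrow> \<bar>a * b\<bar> \<le> A * B"
  unfolding abs_mult by (rule mult_mono) auto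

lemma abs_add_le:
  fixes a b :: real
  shows "\<bar>a\<bar> \<le> A \<Longrightarrow> \<bar>b\<bar> \<le> B \<Longrightarrow> \<bar>a + b\<bar> \<le> A + B"
  by linarith

text \<open>The hyperbola smooths \<open>|x - X|\<close> and lies above it, and its slope stays
  within 1; cones built from it therefore keep their speed.\<close>

lemma DERIV_smooth_abs:
  fixes \<eta> X x :: real
  assumes "0 < \<eta>"
  shows "((\<lambda>x. sqrt (\<eta>\<^sup>2 + (x - X)\<^sup>2)) has_real_derivative (x - X) / sqrt (\<eta>\<^sup>2 + (x - X)\<^sup>2)) (at x)"
proof -
  have pos: "0 < \<eta>\<^sup>2 + (x - X)\<^sup>2" using assms by (simp add: add_pos_nonneg)
  have "((\<lambda>x. \<eta>\<^sup>2 + (x - X)\<^sup>2) has_real_derivative 2 * (x - X)) (at x)"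
    by (auto intro!: derivative_eq_intros)
  from DERIV_chain2[OF DERIV_real_sqrt[OF pos] this]
  show ?thesis by (rule DERIV_cong) (simp only: divide_inverse, simp)
qed

lemma Fubini_lborel:
  fixes g :: "real \<times> real \<Rightarrow> real"
  assumes "integrable lborel g"
  shows "(\<integral>z. g z \<partial>lborel) = (\<integral>t. (\<integral>x. g (t, x) \<partial>lborel) \<partial>lborel)"
  using lborel_pair.integral_fst'[of g] assms by (simp add: lborel_prod)

lemma integrable_bounded_support:
  fixes g :: "'a::euclidean_space \<Rightarrow> real"
  assumes "g \<in> borel_measurable borel" "\<And>z. \<bar>g z\<bar> \<le> C" "\<And>z. z \<notin> cbox a b \<Longrightarrow> g z = 0"
  shows "integrable lborel g"
proof (rule integrableI_bounded_set[where A = "cbox a b" and B = C])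
  show "emeasure lborel (cbox a b) < \<infinity>" by (simp add: emeasure_lborel_cbox_eq)
qed (use assms in auto)

lemma integral_deriv_compact_support:
  fixes g g' :: "real \<Rightarrow> real"
  assumes "\<And>x. (g has_real_derivative g' x) (at x)" "continuous_on UNIV g'"
    and "\<And>x. x \<notin> {p..q} \<Longrightarrow> g x = 0" "\<And>x. x \<notin> {p..q} \<Longrightarrow> g' x = 0"
  shows "(\<integral>x. g' x \<partial>lborel) = 0"
proof (cases "p \<le> q")
  case False
  then show ?thesis using assms(4) by simp
next
  case True
  obtain C where "0 \<le> C" "\<And>z. z \<in> {p..q} \<Longrightarrow> \<bar>g' z\<bar> \<le> C"
    using compact_continuous_abs_bound[OF compact_Icc continuous_on_subset[OF assms(2) subset_UNIV]] by blast
  then have "\<bar>g' z\<bar> \<le> C" for z using assms(4)[of z] by (cases "z \<in> {p..q}") auto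
  then have int: "integrable lborel g'"
    using assms(2,4) borel_measurable_continuous_onI
    by (intro integrable_bounded_support[of g' C p q]) auto
  have "(g' has_integral g (q + 1) - g (p - 1)) {p - 1..q + 1}"
    using assms(1) True
    by (intro fundamental_theorem_of_calculus)
      (auto simp: has_real_derivative_iff_has_vector_derivative[symmetric] intro: has_field_derivative_at_within)
  then have "(g' has_integral 0) {p - 1..q + 1}" using assms(3) by simp
  then have "(g' has_integral 0) UNIV"
    by (rule has_integral_on_superset) (use assms(4) in auto)
  then show ?thesis using integral_lborel[OF int] by (simp add: integral_unique)
qed

section \<open>Smooth steps and approximate identities\<close>

text \<open>On the unit interval this is 1 - (1 - x^2)^2: a C1 transition from 0 to 1 that is flat
  at both ends and whose derivative is a nonnegative kernel of mass 1.\<close>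

definition smoothstep :: "real \<Rightarrow> real" where
  "smoothstep x = 1 - sq_pos (1 - sq_pos x)"

definition smoothstep' :: "real \<Rightarrow> real" where
  "smoothstep' x = 4 * max 0 (1 - sq_pos x) * max 0 x"

lemma DERIV_smoothstep: "(smoothstep has_real_derivative smoothstep' x) (at x)"
  unfolding smoothstep_def[abs_def] smoothstep'_def by (auto intro!: derivative_eq_intros)

lemmas DERIV_smoothstep' [derivative_intros] = DERIV_smoothstep [THEN DERIV_chain2]

lemma smoothstep'_nonneg: "0 \<le> smoothstep' x"
  by (simp add: smoothstep'_def)

lemma smoothstep_mono: "x \<le> y \<Longrightarrow> smoothstep x \<le> smoothstep y"
  using DERIV_nonneg_imp_nondecreasing DERIV_smoothstep smoothstep'_nonneg by blast

lemma smoothstep_0: "x \<le> 0 \<Longrightarrow> smoothstep x = 0"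
  by (simp add: smoothstep_def sq_pos_def)

lemma smoothstep_1:
  assumes "1 \<le> x"
  shows "smoothstep x = 1"
proof -
  have "1 \<le> sq_pos x" using assms by (simp add: sq_pos_def)
  then show ?thesis by (simp add: smoothstep_def)
qed

lemma smoothstep_pos:
  assumes "0 < x"
  shows "0 < smoothstep x"
proof -
  have "sq_pos x > 0" using assms by (simp add: order.strict_iff_order)
  then have "max 0 (1 - sq_pos x) < 1" by simp
  then have "(max 0 (1 - sq_pos x))\<^sup>2 < 1"
    by (metis max.cobounded1 power_less_one_iff zero_less_numeral)
  then show ?thesis by (simp add: smoothstep_def sq_pos_def[of "1 - _"])
qed

lemma smoothstep_range: "smoothstep x \<in> {0..1}"
proof -
  have "smoothstep (min 0 x) \<le> smoothstep x" "smoothstep x \<le> smoothstep (max 1 x)"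
    by (auto intro!: smoothstep_mono)
  then show ?thesis using smoothstep_0[of "min 0 x"] smoothstep_1[of "max 1 x"] by simp
qed

lemma smoothstep'_outside: "x \<le> 0 \<Longrightarrow> smoothstep' x = 0" "1 \<le> x \<Longrightarrow> smoothstep' x = 0"
proof -
  assume "1 \<le> x"
  then have "1 \<le> sq_pos x" by (simp add: sq_pos_def)
  then show "smoothstep' x = 0" by (simp add: smoothstep'_def max_absorb1)
qed (simp add: smoothstep'_def max_absorb1)

lemma continuous_on_smoothstep': "continuous_on S smoothstep'"
  unfolding smoothstep'_def[abs_def] by (intro continuous_intros)

lemma continuous_on_smoothstep: "continuous_on S smoothstep"
  unfolding smoothstep_def[abs_def] by (intro continuous_intros)

lemma smoothstep'_le: "smoothstep' x \<le> 4"
proof (cases "x \<in> {0..1}")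
  case True
  then have "max 0 (1 - sq_pos x) * max 0 x \<le> 1 * 1" by (intro mult_mono) auto
  then show ?thesis by (simp add: smoothstep'_def)
next
  case False
  then show ?thesis using smoothstep'_outside[of x] by (cases "x < 0") auto
qed

lemma integrable_smoothstep': "integrable lborel smoothstep'"
proof (rule integrable_bounded_support[where a = 0 and b = 1 and C = 4])
  show "smoothstep' \<in> borel_measurable borel"
    using continuous_on_smoothstep' borel_measurable_continuous_onI by blast
  show "\<bar>smoothstep' z\<bar> \<le> 4" for z using smoothstep'_le smoothstep'_nonneg[of z] by simp
  show "smoothstep' z = 0" if "z \<notin> cbox 0 1" for z
    using that smoothstep'_outside[of z] by (cases "z < 0") auto
qed

lemma integral_smoothstep': "(\<integral>x. smoothstep' x \<partial>lborel) = 1"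
proof -
  have "(smoothstep' has_integral smoothstep 1 - smoothstep 0) {0..1}"
    by (intro fundamental_theorem_of_calculus)
      (auto simp: has_real_derivative_iff_has_vector_derivative[symmetric]
        intro: has_field_derivative_at_within DERIV_smoothstep)
  then have "(smoothstep' has_integral 1) {0..1}" by (simp add: smoothstep_0 smoothstep_1)
  then have "(smoothstep' has_integral 1) UNIV"
    by (rule has_integral_on_superset) (auto simp: not_le intro: smoothstep'_outside less_imp_le)
  then show ?thesis using integral_lborel[OF integrable_smoothstep'] by (simp add: integral_unique)
qed

text \<open>The rescaled kernel sits on \<open>{s..s + 1 / Suc j}\<close>, to the right of
  \<open>s\<close>, so a limit from the right is what enters.\<close>

lemma smoothstep'_approximate_identity:
  fixes m :: "real \<Rightarrow> real"
  assumes m: "m \<in> borel_measurable borel" "\<And>t. \<bar>m t\<bar> \<le> C" and lim: "(m \<longlongrightarrow> m s) (at_right s)"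
  shows "(\<lambda>j. \<integral>t. Suc j * smoothstep' (Suc j * (t - s)) * m t \<partial>lborel) \<longlonglongrightarrow> m s"
proof -
  note [measurable] = m(1)
  have sm [measurable]: "smoothstep' \<in> borel_measurable borel"
    using continuous_on_smoothstep' borel_measurable_continuous_onI by blast
  have "(\<integral>t. Suc j * smoothstep' (Suc j * (t - s)) * m t \<partial>lborel)
      = (\<integral>y. smoothstep' y * m (s + y / Suc j) \<partial>lborel)" for j
    by (subst lborel_integral_real_affine[where c = "1 / Suc j" and t = s])
      (simp_all add: mult.assoc del: of_nat_Suc)
  moreover have "(\<lambda>j. \<integral>y. smoothstep' y * m (s + y / Suc j) \<partial>lborel) \<longlonglongrightarrow> (\<integral>y. smoothstep' y * m s \<partial>lborel)"
  proof (rule integral_dominated_convergence[where w = "\<lambda>y. C * smoothstep' y"])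
    show "integrable lborel (\<lambda>y. C * smoothstep' y)"
      using integrable_smoothstep' by simp
    show "AE y in lborel. (\<lambda>j. smoothstep' y * m (s + y / Suc j)) \<longlonglongrightarrow> smoothstep' y * m s"
    proof (rule AE_I2)
      fix y :: real
      show "(\<lambda>j. smoothstep' y * m (s + y / Suc j)) \<longlonglongrightarrow> smoothstep' y * m s"
      proof (cases "y \<le> 0")
        case True
        then show ?thesis by (simp add: smoothstep'_outside)
      next
        case False
        have "(\<lambda>j. s + y / Suc j) \<longlonglongrightarrow> s + 0"
          by (intro tendsto_intros LIMSEQ_Suc[OF lim_const_over_n])
        then have "filterlim (\<lambda>j. s + y / Suc j) (at_right s) sequentially"
          using False by (auto simp: filterlim_at intro!: always_eventually)
        then have "(\<lambda>j. m (s + y / Suc j)) \<longlonglongrightarrow> m s"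
          using lim filterlim_compose by blast
        then show ?thesis by (intro tendsto_intros)
      qed
    qed
    show "AE y in lborel. norm (smoothstep' y * m (s + y / Suc j)) \<le> C * smoothstep' y" for j
      using m(2) smoothstep'_nonneg
      by (intro AE_I2) (simp add: abs_mult mult.commute[of C] mult_left_mono)
  qed measurable
  ultimately show ?thesis by (simp add: integral_smoothstep')
qed

lemma borel_measurable_projections [measurable]:
  "(fst :: real \<times> real \<Rightarrow> real) \<in> borel_measurable borel"
  "(snd :: real \<times> real \<Rightarrow> real) \<in> borel_measurable borel"
  by (intro borel_measurable_continuous_onI continuous_on_fst continuous_on_snd continuous_on_id)+

lemma borel_measurable_integral_slice:
  fixes g :: "real \<times> real \<Rightarrow> real"
  assumes "g \<in> borel_measurable borel"
  shows "(\<lambda>t. \<integral>x. g (t, x) \<partial>lborel) \<in> borel_measurable borel"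
proof -
  have "case_prod (\<lambda>t x. g (t, x)) \<in> borel_measurable (lborel \<Otimes>\<^sub>M lborel)"
    using assms by (simp add: lborel_prod)
  then show ?thesis using lborel.borel_measurable_lebesgue_integral[of "\<lambda>t x. g (t, x)" lborel] by simp
qed

text \<open>At \<open>\<tau> = s\<close> the ramp is 0, so the limit is the indicator of the open
  ray. Differences of two ramps then produce the half-open intervals \<open>{s<..t}\<close> that
  occur in all balances below and that add up without overlap.\<close>

lemma ramp_tendsto:
  fixes \<sigma> :: "real \<Rightarrow> real" and \<tau> s :: real
  assumes "\<And>x. x \<le> 0 \<Longrightarrow> \<sigma> x = 0" "\<And>x. 1 \<le> x \<Longrightarrow> \<sigma> x = 1"
  shows "(\<lambda>j. \<sigma> (Suc j * (\<tau> - s))) \<longlonglongrightarrow> indicator {s<..} \<tau>"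
proof (cases "\<tau> \<le> s")
  case True
  then have "\<sigma> (Suc j * (\<tau> - s)) = 0" for j
    by (intro assms(1)) (simp add: mult_nonneg_nonpos)
  then show ?thesis using True by simp
next
  case False
  obtain n where n: "1 / real (Suc n) < \<tau> - s" using False nat_approx_posE[of "\<tau> - s"] by auto
  have "\<sigma> (Suc j * (\<tau> - s)) = 1" if "j \<ge> n" for j
  proof (rule assms(2))
    have "1 / real (Suc j) \<le> 1 / real (Suc n)" using that by (simp add: field_simps)
    then have "1 / real (Suc j) \<le> \<tau> - s" using n by linarith
    then show "1 \<le> real (Suc j) * (\<tau> - s)" by (simp add: pos_divide_le_eq mult.commute)
  qed
  then have "\<forall>\<^sub>F j in sequentially. \<sigma> (Suc j * (\<tau> - s)) = 1"
    using eventually_sequentially by blast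
  then show ?thesis using False by (auto intro: tendsto_eventually)
qed

lemma Fubini_lborel_swap:
  fixes g :: "real \<times> real \<Rightarrow> real"
  assumes "integrable lborel g"
  shows "(\<integral>z. g z \<partial>lborel) = (\<integral>x. (\<integral>t. g (t, x) \<partial>lborel) \<partial>lborel)"
  using lborel_pair.integral_snd[of "\<lambda>t x. g (t, x)"] assms by (simp add: lborel_prod)

lemma integral_Ioc_continuous:
  fixes g :: "real \<Rightarrow> real"
  assumes "continuous_on {a..b} g"
  shows "integrable lborel (\<lambda>x. indicator {a<..b} x * g x)"
    and "(\<integral>x. indicator {a<..b} x * g x \<partial>lborel) = integral {a..b} g"
proof -
  have int: "set_integrable lborel {a..b} g"
    using assms by (rule borel_integrable_atLeastAtMost')
  then have h: "integrable lborel (\<lambda>x. indicator {a..b} x * g x)"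
    by (simp add: set_integrable_def)
  have eq: "indicator {a<..b} x * g x = indicator {a<..b} x * (indicator {a..b} x * g x)" for x
    by (auto simp: indicator_def)
  show "integrable lborel (\<lambda>x. indicator {a<..b} x * g x)"
    unfolding eq using integrable_real_mult_indicator[OF _ h, of "{a<..b}"] by (simp add: mult.commute)
  have "(\<integral>x. indicator {a<..b} x * g x \<partial>lborel) = (\<integral>x. indicator {a..b} x * g x \<partial>lborel)"
  proof (rule integral_cong_AE)
    show "AE x in lborel. indicator {a<..b} x * g x = indicator {a..b} x * g x"
      using AE_lborel_singleton[of a] by eventually_elim (auto simp: indicator_def)
  qed (use h \<open>integrable lborel (\<lambda>x. indicator {a<..b} x * g x)\<close> in auto)
  then show "(\<integral>x. indicator {a<..b} x * g x \<partial>lborel) = integral {a..b} g"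
    using set_borel_integral_eq_integral(2)[OF int] by (simp add: set_lebesgue_integral_def)
qed

lemma integral_Ioc_bounded:
  fixes g :: "real \<Rightarrow> real"
  assumes "g \<in> borel_measurable borel" "\<And>x. \<bar>g x\<bar> \<le> C"
  shows "(\<integral>x. g x * indicator {a<..b} x \<partial>lborel) = integral {a..b} g"
proof -
  note [measurable] = assms(1)
  have "(\<integral>x. g x * indicator {a<..b} x \<partial>lborel) = (\<integral>x. indicator {a..b} x *\<^sub>R g x \<partial>lborel)"
  proof (rule integral_cong_AE)
    show "AE x in lborel. g x * indicator {a<..b} x = indicator {a..b} x *\<^sub>R g x"
      using AE_lborel_singleton[of a] by eventually_elim (auto simp: indicator_def)
  qed measurable
  then show ?thesis
    using set_borel_integral_eq_integral(2)[OF integrable_on_cbox_bounded_borel(1)[OF assms, of a b]]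
    by (simp add: set_lebesgue_integral_def)
qed

lemma Ioc_Times_borel [measurable]: "{s<..t} \<times> {x<..y} \<in> sets (borel :: (real \<times> real) measure)"
  by (metis borel_prod greaterThanAtMost_borel pair_measureI)

lemma integral_box_bounded:
  fixes g :: "real \<times> real \<Rightarrow> real"
  assumes "g \<in> borel_measurable borel" "\<And>z. \<bar>g z\<bar> \<le> C"
  shows "integrable lborel (\<lambda>z. indicator ({s<..t} \<times> {x<..y}) z * g z)"
    and "(\<integral>z. indicator ({s<..t} \<times> {x<..y}) z * g z \<partial>lborel) = integral (cbox (s, x) (t, y)) g"
proof -
  note [measurable] = assms(1)
  show "integrable lborel (\<lambda>z. indicator ({s<..t} \<times> {x<..y}) z * g z)"
  proof (rule integrable_bounded_support[where C = "1 * C" and a = "(s, x)" and b = "(t, y)"])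
    show "\<bar>indicator ({s<..t} \<times> {x<..y}) z * g z\<bar> \<le> 1 * C" for z
      by (intro abs_mult_le assms(2)) (simp add: indicator_def)
    show "indicator ({s<..t} \<times> {x<..y}) z * g z = 0" if "z \<notin> cbox (s, x) (t, y)" for z
      using that by (cases z) (auto simp: cbox_Pair_eq indicator_def)
  qed measurable
  have "AE z in lborel. fst z \<noteq> s \<and> snd z \<noteq> x" for s x :: real
  proof -
    have 1: "negligible {z :: real \<times> real. z \<bullet> (1, 0) = s}" "negligible {z :: real \<times> real. z \<bullet> (0, 1) = x}"
      by (intro negligible_standard_hyperplane; simp add: Basis_prod_def)+
    have "AE z in lebesgue. z \<notin> {z :: real \<times> real. z \<bullet> (1, 0) = s} \<union> {z. z \<bullet> (0, 1) = x}"
      using 1 by (intro AE_not_in) (simp add: negligible_iff_null_sets null_sets.Un)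
    then have "AE z in lebesgue. fst z \<noteq> s \<and> snd z \<noteq> x"
      by (rule eventually_mono) (auto simp: inner_prod_def)
    then show ?thesis by (simp add: AE_completion_iff)
  qed
  note lines = this
  have "(\<integral>z. indicator ({s<..t} \<times> {x<..y}) z * g z \<partial>lborel) = (\<integral>z. indicator (cbox (s, x) (t, y)) z *\<^sub>R g z \<partial>lborel)"
  proof (rule integral_cong_AE)
    show "AE z in lborel. indicator ({s<..t} \<times> {x<..y}) z * g z = indicator (cbox (s, x) (t, y)) z *\<^sub>R g z"
      using lines[of s x]
    proof eventually_elim
      case (elim z)
      then show ?case by (cases z) (auto simp: indicator_def cbox_Pair_eq)
    qed
  qed measurable
  then show "(\<integral>z. indicator ({s<..t} \<times> {x<..y}) z * g z \<partial>lborel) = integral (cbox (s, x) (t, y)) g"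
    using set_borel_integral_eq_integral(2)[OF integrable_on_cbox_bounded_borel(1)[OF assms]]
    by (simp add: set_lebesgue_integral_def)
qed

text \<open>In \<open>J_shift\<close> the cutoff is the derivative of a test function. A continuous
  piecewise linear \<open>ramp\<close> is enough there, and its primitive \<open>ramp_int\<close> is
  C1.\<close>

definition ramp :: "real \<Rightarrow> real" where
  "ramp x = max 0 x - max 0 (x - 1)"

definition ramp_int :: "real \<Rightarrow> real" where
  "ramp_int x = (sq_pos x - sq_pos (x - 1)) / 2"

lemma DERIV_ramp_int: "(ramp_int has_real_derivative ramp x) (at x)"
  unfolding ramp_int_def[abs_def] ramp_def by (auto intro!: derivative_eq_intros)

lemma ramp_simps: "x \<le> 0 \<Longrightarrow> ramp x = 0" "1 \<le> x \<Longrightarrow> ramp x = 1"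
  "x \<le> 0 \<Longrightarrow> ramp_int x = 0" "1 \<le> x \<Longrightarrow> ramp_int x = x - 1 / 2"
  by (auto simp: ramp_def ramp_int_def sq_pos_def power2_eq_square field_simps)

lemma ramp_mono: "x \<le> y \<Longrightarrow> ramp x \<le> ramp y"
  by (auto simp: ramp_def max_def)

lemma ramp_range: "ramp x \<in> {0..1}"
  by (auto simp: ramp_def max_def)

section \<open>Comparison with affine functions\<close>

text \<open>\<open>w\<close> is a Borel representative of the solution on the plane, bounded
  everywhere. The entropy integral runs over the whole plane, since test functions vanish outside
  the half-plane.\<close>

locale kruzhkov_flux =
  fixes f :: "real \<Rightarrow> real" and w :: "real \<times> real \<Rightarrow> real" and B F :: real
  assumes cont_f: "continuous_on UNIV f"
    and w_meas: "w \<in> borel_measurable borel"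
    and w_bound: "\<And>z. \<bar>w z\<bar> \<le> B"
    and f_bound: "\<And>l. \<bar>l\<bar> \<le> B \<Longrightarrow> \<bar>f l\<bar> \<le> F"
    and entropy: "\<And>\<phi> \<phi>t \<phi>x k. test_function \<phi> \<phi>t \<phi>x \<Longrightarrow> (\<forall>z. 0 \<le> \<phi> z) \<Longrightarrow>
      0 \<le> (\<integral>z. \<bar>w z - k\<bar> * \<phi>t z + sgn (w z - k) * (f (w z) - f k) * \<phi>x z \<partial>lborel)"
begin

lemma FB_nonneg: "0 \<le> F" "0 \<le> B"
proof -
  show B: "0 \<le> B" using w_bound[of 0] by simp
  show "0 \<le> F" using f_bound[of 0] B by simp
qed

lemma fw_meas: "(\<lambda>z. f (w z)) \<in> borel_measurable borel"
  using measurable_compose[OF w_meas borel_measurable_continuous_onI[OF cont_f]] by simp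

lemma fw_bound: "\<bar>f (w z)\<bar> \<le> F"
  using f_bound w_bound by blast

end

text \<open>The relations \<open>U_x = w\<close> and \<open>U_t = - f(w)\<close> are stated after
  integration over boxes, so that no pointwise derivative of \<open>U\<close> has to exist. The
  widths \<open>1 / Suc n\<close> in \<open>box_t\<close> are those delivered by
  \<open>J_unit\<close>, and they are the sides of the Steklov squares.\<close>

locale entropy_potential = kruzhkov_flux +
  fixes U :: "real \<Rightarrow> real \<Rightarrow> real"
  assumes lip: "\<And>s t x y. 0 \<le> s \<Longrightarrow> 0 \<le> t \<Longrightarrow> \<bar>U t x - U s y\<bar> \<le> F * \<bar>t - s\<bar> + B * \<bar>x - y\<bar>"
    and box_x: "\<And>s t x y. 0 \<le> s \<Longrightarrow> s \<le> t \<Longrightarrow> x \<le> y \<Longrightarrow>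
      integral {s..t} (\<lambda>\<tau>. U \<tau> y - U \<tau> x) = integral (cbox (s, x) (t, y)) w"
    and box_t: "\<And>s t x n. 0 \<le> s \<Longrightarrow> s \<le> t \<Longrightarrow>
      integral {x..x + 1 / Suc n} (\<lambda>y. U t y - U s y)
        = - integral (cbox (s, x) (t, x + 1 / Suc n)) (\<lambda>z. f (w z))"
begin

text \<open>Extending \<open>U\<close> by its initial values to negative times keeps the Lipschitz
  bound, which the Steklov lemmas ask for on the whole plane.\<close>

definition V :: "real \<Rightarrow> real \<Rightarrow> real" where
  "V t x = U (max 0 t) x"

lemma V_lip: "\<bar>V t x - V s y\<bar> \<le> F * \<bar>t - s\<bar> + B * \<bar>x - y\<bar>"
proof -
  have "\<bar>V t x - V s y\<bar> \<le> F * \<bar>max 0 t - max 0 s\<bar> + B * \<bar>x - y\<bar>"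
    unfolding V_def by (rule lip) auto
  also have "F * \<bar>max 0 t - max 0 s\<bar> \<le> F * \<bar>t - s\<bar>"
    using FB_nonneg by (intro mult_left_mono) auto
  finally show ?thesis by simp
qed

lemma steklov_t_box:
  assumes "0 \<le> fst z"
  shows "steklov_t (1 / Suc n) V z
    = - (integral (cbox z (z + (1 / Suc n, 1 / Suc n))) (\<lambda>z. f (w z)) / (1 / Suc n)\<^sup>2)"
proof -
  obtain t x where z: "z = (t, x)" by (cases z)
  define e where "e = 1 / real (Suc n)"
  have e: "e > 0" by (simp add: e_def)
  have "integral {0..e} (\<lambda>y. V (t + e) (x + y) - V t (x + y))
      = integral {x..x + e} (\<lambda>y. V (t + e) y - V t y)"
    using integral_shift_Icc_real[of 0 e "\<lambda>y. V (t + e) y - V t y" x] by (simp add: comp_def add.commute)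
  also have "\<dots> = integral {x..x + e} (\<lambda>y. U (t + e) y - U t y)"
    using assms e by (simp add: V_def z)
  also have "\<dots> = - integral (cbox (t, x) (t + e, x + e)) (\<lambda>z. f (w z))"
    unfolding e_def using assms by (intro box_t) (auto simp: z)
  finally show ?thesis by (simp add: steklov_t_def z e_def)
qed

lemma steklov_x_box:
  assumes "0 \<le> fst z"
  shows "steklov_x (1 / Suc n) V z = integral (cbox z (z + (1 / Suc n, 1 / Suc n))) w / (1 / Suc n)\<^sup>2"
proof -
  obtain t x where z: "z = (t, x)" by (cases z)
  define e where "e = 1 / real (Suc n)"
  have e: "e > 0" by (simp add: e_def)
  have "integral {0..e} (\<lambda>\<tau>. V (t + \<tau>) (x + e) - V (t + \<tau>) x)
      = integral {t..t + e} (\<lambda>\<tau>. V \<tau> (x + e) - V \<tau> x)"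
    using integral_shift_Icc_real[of 0 e "\<lambda>\<tau>. V \<tau> (x + e) - V \<tau> x" t] by (simp add: comp_def add.commute)
  also have "\<dots> = integral {t..t + e} (\<lambda>\<tau>. U \<tau> (x + e) - U \<tau> x)"
    using assms by (intro integral_cong) (simp add: V_def z)
  also have "\<dots> = integral (cbox (t, x) (t + e, x + e)) w"
    using assms e by (intro box_x) (auto simp: z)
  finally show ?thesis by (simp add: steklov_x_def z e_def)
qed

definition D :: "real \<Rightarrow> real \<times> real \<Rightarrow> real" where
  "D k z = V (fst z) (snd z) - k * snd z + f k * fst z"

lemma D_lip: "\<bar>D k (t, x) - D k (s, y)\<bar> \<le> (F + \<bar>f k\<bar>) * \<bar>t - s\<bar> + (B + \<bar>k\<bar>) * \<bar>x - y\<bar>"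
proof -
  have "D k (t, x) - D k (s, y) = (V t x - V s y) - k * (x - y) + f k * (t - s)"
    by (simp add: D_def algebra_simps)
  moreover have "\<bar>k * (x - y)\<bar> = \<bar>k\<bar> * \<bar>x - y\<bar>" "\<bar>f k * (t - s)\<bar> = \<bar>f k\<bar> * \<bar>t - s\<bar>"
    by (simp_all add: abs_mult)
  ultimately show ?thesis using V_lip[of t x s y] unfolding distrib_right by linarith
qed

lemma continuous_on_D [continuous_intros]:
  "continuous_on S h \<Longrightarrow> continuous_on S (\<lambda>z. D k (h z))"
  unfolding D_def
  by (intro continuous_intros continuous_lipschitz_compose[OF V_lip zero_less_one])

text \<open>The test functions are \<open>\<theta>(t) \<phi>(D) \<chi>(\<xi>)\<close>, with \<open>D\<close> regularised by Steklov averages.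
  The derivatives that fall on \<open>\<phi>(D)\<close> contribute
  \<open>\<bar>w - k\<bar> D_t + sgn (w - k) (f(w) - f(k)) D_x\<close>, which vanishes in the limit because
  \<open>D_t = f(k) - f(w)\<close> and \<open>D_x = w - k\<close>.\<close>

lemma cone_constant_AE:
  fixes k \<Lambda> \<Lambda>f s \<delta> X l \<eta> :: real and \<phi> \<phi>' :: "real \<Rightarrow> real"
  assumes \<phi>: "\<And>d. (\<phi> has_real_derivative \<phi>' d) (at d)" "\<And>d. 0 \<le> \<phi> d" "continuous_on UNIV \<phi>'"
    and \<Lambda>f: "\<And>l. \<bar>l\<bar> \<le> B \<Longrightarrow> \<bar>f l - f k\<bar> \<le> \<Lambda>f * \<bar>l - k\<bar>" and \<Lambda>: "0 \<le> \<Lambda>f" "\<Lambda>f < \<Lambda>"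
    and s: "0 < s" and \<delta>: "0 < \<delta>" and \<eta>: "0 < \<eta>"
  defines "\<xi> \<equiv> \<lambda>z. l - \<Lambda> * fst z - sqrt (\<eta>\<^sup>2 + (snd z - X)\<^sup>2)"
  assumes base: "\<And>z. s \<le> fst z \<Longrightarrow> fst z \<le> s + \<delta> \<Longrightarrow> 0 < \<xi> z \<Longrightarrow> \<phi> (D k z) = 0"
  shows "AE z in lborel. s < fst z \<longrightarrow> 0 < \<xi> z \<longrightarrow> \<phi> (D k z) = 0 \<or> w z = k"
proof -
  note [measurable] = w_meas fw_meas
  \<comment> \<open>\<open>\<theta>\<close> rises from 0 to 1 on \<open>{s..s + \<delta>}\<close>.
    By \<open>base\<close>, \<open>\<phi> (D k z)\<close> is 0 there inside the cone, so the terms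
    with \<open>\<theta>'\<close> will drop out.\<close>
  define \<theta> where "\<theta> t = smoothstep ((t - s) / \<delta>)" for t
  define \<theta>' where "\<theta>' t = smoothstep' ((t - s) / \<delta>) / \<delta>" for t
  have \<theta>_deriv: "(\<theta> has_real_derivative \<theta>' t) (at t)" for t
    unfolding \<theta>_def[abs_def] \<theta>'_def using \<delta> by (auto intro!: derivative_eq_intros)
  have \<theta>_cont: "continuous_on UNIV \<theta>" "continuous_on UNIV \<theta>'"
    unfolding \<theta>_def[abs_def] \<theta>'_def[abs_def] using \<delta>
    by (intro continuous_intros continuous_on_compose2[OF continuous_on_smoothstep[of UNIV]]
        continuous_on_compose2[OF continuous_on_smoothstep'[of UNIV]]; simp)+
  have \<theta>_nonneg: "0 \<le> \<theta> t" for t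
    using smoothstep_range[of "(t - s) / \<delta>"] by (simp add: \<theta>_def)
  have \<theta>_0: "\<theta> t = 0" "\<theta>' t = 0" if "t \<le> s" for t
    using that \<delta> by (simp_all add: \<theta>_def \<theta>'_def smoothstep_0 smoothstep'_outside divide_nonpos_pos)
  have \<theta>_pos: "\<theta> t > 0" if "s < t" for t
    using that \<delta> by (simp add: \<theta>_def smoothstep_pos)
  have \<theta>'_1: "\<theta>' t = 0" if "s + \<delta> \<le> t" for t
    using that \<delta> by (simp add: \<theta>'_def smoothstep'_outside pos_le_divide_eq)
  define rx where "rx z = (snd z - X) / sqrt (\<eta>\<^sup>2 + (snd z - X)\<^sup>2)" for z :: "real \<times> real"
  have root_pos: "0 < \<eta>\<^sup>2 + y\<^sup>2" for y using \<eta> by (simp add: add_pos_nonneg)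
  have root_nz: "sqrt (\<eta>\<^sup>2 + y\<^sup>2) \<noteq> 0" for y
    using root_pos[of y] by (metis less_irrefl real_sqrt_gt_zero)
  have abs_le_root: "\<bar>y\<bar> \<le> sqrt (\<eta>\<^sup>2 + y\<^sup>2)" for y by (rule real_le_rsqrt) simp
  have rx_bound: "\<bar>rx z\<bar> \<le> 1" for z
    using abs_le_root[of "snd z - X"] root_pos[of "snd z - X"] by (simp add: rx_def)
  have \<xi>_cont: "continuous_on UNIV \<xi>"
    unfolding \<xi>_def by (intro continuous_intros)
  have rx_cont: "continuous_on UNIV rx"
    unfolding rx_def[abs_def] by (intro continuous_on_divide continuous_intros ballI root_nz)
  have \<xi>_t: "((\<lambda>t. \<xi> (t, x)) has_real_derivative - \<Lambda>) (at t)" for t x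
    unfolding \<xi>_def by (auto intro!: derivative_eq_intros)
  have \<xi>_x: "((\<lambda>x. \<xi> (t, x)) has_real_derivative - rx (t, x)) (at x)" for t x
    unfolding \<xi>_def rx_def fst_conv snd_conv
    by (rule derivative_eq_intros DERIV_smooth_abs[OF \<eta>] refl)+ simp

  \<comment> \<open>\<open>\<beta>\<close> is the factor of the test function that does not involve
    \<open>D\<close>; \<open>\<alpha>\<close> and \<open>\<gamma>\<close> are its derivatives in
    time and space.\<close>
  define \<alpha> where "\<alpha> z = \<theta>' (fst z) * sq_pos (\<xi> z) - \<Lambda> * (\<theta> (fst z) * (2 * max 0 (\<xi> z)))" for z
  define \<beta> where "\<beta> z = \<theta> (fst z) * sq_pos (\<xi> z)" for z
  define \<gamma> where "\<gamma> z = - (\<theta> (fst z) * (2 * max 0 (\<xi> z)) * rx z)" for z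
  have cont: "continuous_on UNIV \<alpha>" "continuous_on UNIV \<beta>" "continuous_on UNIV \<gamma>"
    unfolding \<alpha>_def[abs_def] \<beta>_def[abs_def] \<gamma>_def[abs_def]
    by (auto intro!: continuous_intros \<xi>_cont rx_cont
        continuous_on_compose2[OF \<theta>_cont(1)] continuous_on_compose2[OF \<theta>_cont(2)])
  \<comment> \<open>The set where \<open>\<xi>\<close> is positive ends at time
    \<open>l / \<Lambda>\<close>, and \<open>\<theta>\<close> cuts it off below time
    \<open>s > 0\<close>; this makes the support compact in the half-plane.\<close>
  define S where "S = cbox (s, X - l) (l / \<Lambda>, X + l)"
  have S: "compact S" by (simp add: S_def)
  have S_half: "S \<subseteq> half_plane" using s by (auto simp: S_def half_plane_def cbox_Pair_eq)
  have outside: "\<theta> (fst z) = 0 \<and> \<theta>' (fst z) = 0 \<or> \<xi> z \<le> 0" if "z \<notin> S" for z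
  proof (rule ccontr)
    assume "\<not> ?thesis"
    then have z: "s < fst z" "0 < \<xi> z" using \<theta>_0[of "fst z"] by fastforce+
    then have "\<Lambda> * fst z + \<bar>snd z - X\<bar> < l" using z(2) abs_le_root[of "snd z - X"] unfolding \<xi>_def by linarith
    moreover have "0 \<le> \<Lambda> * fst z" using z s \<Lambda> by (intro mult_nonneg_nonneg) auto
    moreover have "fst z \<le> l / \<Lambda>" using calculation \<Lambda> by (simp add: pos_le_divide_eq mult.commute)
    ultimately have "z \<in> S" using z(1) by (cases z) (auto simp: S_def cbox_Pair_eq)
    then show False using that by simp
  qed
  have outside': "\<alpha> z = 0 \<and> \<beta> z = 0 \<and> \<gamma> z = 0" if "z \<notin> S" for z
    using outside[OF that] by (elim disjE) (simp_all add: \<alpha>_def \<beta>_def \<gamma>_def max_absorb1)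

  define e where "e n = 1 / real (Suc n)" for n
  have e: "e n > 0" "e n \<le> 1" for n by (simp_all add: e_def)
  define Dn where "Dn n z = steklov (e n) V z - k * snd z + f k * fst z" for n z
  define St where "St n = steklov_t (e n) V" for n
  define Sx where "Sx n = steklov_x (e n) V" for n
  have Dn_t: "((\<lambda>t. Dn n (t, x)) has_real_derivative St n (t, x) + f k) (at t)" for n t x
    unfolding Dn_def St_def
    by (auto intro!: derivative_eq_intros DERIV_steklov_t[OF V_lip e(1)])
  have Dn_x: "((\<lambda>x. Dn n (t, x)) has_real_derivative Sx n (t, x) - k) (at x)" for n t x
    unfolding Dn_def Sx_def
    by (auto intro!: derivative_eq_intros DERIV_steklov_x[OF V_lip e(1)])
  have cont_n: "continuous_on UNIV (Dn n)" "continuous_on UNIV (St n)" "continuous_on UNIV (Sx n)" for n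
    unfolding Dn_def[abs_def] St_def Sx_def using continuous_steklov[OF V_lip e(1)]
      continuous_steklov_t[OF V_lip e(1)] continuous_steklov_x[OF V_lip e(1)]
    by (auto intro!: continuous_intros)
  have \<phi>_cont: "continuous_on UNIV \<phi>"
    using \<phi>(1) DERIV_isCont by (auto intro!: continuous_at_imp_continuous_on)
  have cont_\<phi>: "continuous_on UNIV (\<lambda>z. \<phi> (Dn n z))" "continuous_on UNIV (\<lambda>z. \<phi>' (Dn n z))" for n
    using continuous_on_compose2[OF \<phi>_cont cont_n(1)] continuous_on_compose2[OF \<phi>(3) cont_n(1)] by auto

  define \<psi> where "\<psi> n z = \<theta> (fst z) * \<phi> (Dn n z) * sq_pos (\<xi> z)" for n z
  define \<psi>t where "\<psi>t n z = \<phi> (Dn n z) * \<alpha> z + \<phi>' (Dn n z) * (St n z + f k) * \<beta> z" for n z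
  define \<psi>x where "\<psi>x n z = \<phi> (Dn n z) * \<gamma> z + \<phi>' (Dn n z) * (Sx n z - k) * \<beta> z" for n z
  have cont_\<psi>: "continuous_on UNIV (\<psi>t n)" "continuous_on UNIV (\<psi>x n)" for n
    unfolding \<psi>t_def[abs_def] \<psi>x_def[abs_def] using cont cont_n cont_\<phi> by (auto intro!: continuous_intros)
  have test: "test_function (\<psi> n) (\<psi>t n) (\<psi>x n)" for n
    unfolding test_function_def
  proof (intro conjI allI)
    show "continuous_on UNIV (\<psi>t n)" "continuous_on UNIV (\<psi>x n)" by (fact cont_\<psi>)+
    show "\<exists>S. compact S \<and> S \<subseteq> half_plane \<and> (\<forall>z. z \<notin> S \<longrightarrow> \<psi> n z = 0)"
    proof (intro exI[of _ S] conjI allI impI S S_half)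
      fix z assume "z \<notin> S"
      from outside[OF this] show "\<psi> n z = 0" by (elim disjE) (simp_all add: \<psi>_def)
    qed
    show "(\<psi> n has_derivative (\<lambda>h. \<psi>t n z * fst h + \<psi>x n z * snd h)) (at z)" for z
    proof (rule has_derivative_of_partials[OF _ _ cont_\<psi>(2)])
      show "((\<lambda>t. \<psi> n (t, x)) has_real_derivative \<psi>t n (t, x)) (at t)" for t x
        unfolding \<psi>_def \<psi>t_def \<alpha>_def \<beta>_def fst_conv
        by (rule derivative_eq_intros \<theta>_deriv DERIV_chain2[OF \<phi>(1) Dn_t] \<xi>_t refl)+
          (simp add: algebra_simps)
      show "((\<lambda>x. \<psi> n (t, x)) has_real_derivative \<psi>x n (t, x)) (at x)" for t x
        unfolding \<psi>_def \<psi>x_def \<gamma>_def \<beta>_def fst_conv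
        by (rule derivative_eq_intros DERIV_chain2[OF \<phi>(1) Dn_x] \<xi>_x refl)+
          (simp add: algebra_simps)
    qed
  qed
  have \<psi>_nonneg: "\<forall>z. 0 \<le> \<psi> n z" for n
    using \<theta>_nonneg \<phi>(2) by (simp add: \<psi>_def)

  define G where "G z = sgn (w z - k) * (f (w z) - f k)" for z
  define I where "I n z = \<bar>w z - k\<bar> * \<psi>t n z + G z * \<psi>x n z" for n z
  define J where "J z = \<phi> (D k z) * (\<bar>w z - k\<bar> * \<alpha> z + G z * \<gamma> z)" for z
  have I_nonneg: "0 \<le> integral\<^sup>L lborel (I n)" for n
    using entropy[OF test \<psi>_nonneg] by (simp add: I_def[abs_def] G_def)
  have G_meas [measurable]: "G \<in> borel_measurable borel" unfolding G_def[abs_def] by measurable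
  have I_meas: "I n \<in> borel_measurable lborel" for n
    unfolding I_def[abs_def] using cont_\<psi>[THEN borel_measurable_continuous_onI] by measurable
  have D_cont: "continuous_on UNIV (D k)"
    using continuous_on_D[OF continuous_on_id] by simp
  have [measurable]: "(\<lambda>z. \<phi> (D k z)) \<in> borel_measurable borel"
    using continuous_on_compose2[OF \<phi>_cont D_cont] by (auto intro: borel_measurable_continuous_onI)
  have [measurable]: "\<alpha> \<in> borel_measurable borel" "\<gamma> \<in> borel_measurable borel"
    using cont borel_measurable_continuous_onI by blast+
  have J_meas: "J \<in> borel_measurable lborel" unfolding J_def[abs_def] by measurable

  have wk: "\<bar>w z - k\<bar> \<le> B + \<bar>k\<bar>" for z using w_bound[of z] by linarith
  have G_bound: "\<bar>G z\<bar> \<le> F + \<bar>f k\<bar>" for z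
  proof -
    have "\<bar>G z\<bar> \<le> 1 * \<bar>f (w z) - f k\<bar>"
      unfolding G_def abs_mult by (rule mult_right_mono) (auto simp: sgn_if)
    also have "\<dots> \<le> \<bar>f (w z)\<bar> + \<bar>f k\<bar>" using abs_triangle_ineq4 by simp
    also have "\<dots> \<le> F + \<bar>f k\<bar>" using fw_bound by simp
    finally show ?thesis .
  qed
  have D_approx: "\<bar>Dn n z - D k z\<bar> \<le> (F + B) * e n" for n z
    using steklov_approx[OF V_lip e(1)] by (simp add: Dn_def D_def)
  obtain R where R: "\<And>z. z \<in> S \<Longrightarrow> \<bar>D k z\<bar> \<le> R"
    using compact_continuous_abs_bound[OF S continuous_on_subset[OF D_cont subset_UNIV]] by blast
  have Dn_R: "Dn n z \<in> {- (R + F + B)..R + F + B}" if "z \<in> S" for n z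
  proof -
    have "(F + B) * e n \<le> (F + B) * 1" using FB_nonneg e by (intro mult_left_mono) auto
    then show ?thesis using D_approx[of n z] R[OF that] by auto
  qed
  obtain C where C: "0 \<le> C" "\<And>d. d \<in> {- (R + F + B)..R + F + B} \<Longrightarrow> \<bar>\<phi> d\<bar> \<le> C"
    using compact_continuous_abs_bound[OF compact_Icc continuous_on_subset[OF \<phi>_cont subset_UNIV]] by blast
  obtain C' where C': "0 \<le> C'" "\<And>d. d \<in> {- (R + F + B)..R + F + B} \<Longrightarrow> \<bar>\<phi>' d\<bar> \<le> C'"
    using compact_continuous_abs_bound[OF compact_Icc continuous_on_subset[OF \<phi>(3) subset_UNIV]] by blast
  obtain A1 A2 A3 where A: "0 \<le> A1" "0 \<le> A2" "0 \<le> A3"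
    "\<And>z. z \<in> S \<Longrightarrow> \<bar>\<alpha> z\<bar> \<le> A1" "\<And>z. z \<in> S \<Longrightarrow> \<bar>\<beta> z\<bar> \<le> A2" "\<And>z. z \<in> S \<Longrightarrow> \<bar>\<gamma> z\<bar> \<le> A3"
    using compact_continuous_abs_bound[OF S continuous_on_subset[OF cont(1) subset_UNIV]]
      compact_continuous_abs_bound[OF S continuous_on_subset[OF cont(2) subset_UNIV]]
      compact_continuous_abs_bound[OF S continuous_on_subset[OF cont(3) subset_UNIV]] by metis
  define K where "K = (B + \<bar>k\<bar>) * (C * A1 + C' * (F + \<bar>f k\<bar>) * A2)
      + (F + \<bar>f k\<bar>) * (C * A3 + C' * (B + \<bar>k\<bar>) * A2)"
  have I_bound: "norm (I n z) \<le> K * indicator S z" for n z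
  proof (cases "z \<in> S")
    case False
    then show ?thesis using outside' by (simp add: I_def \<psi>t_def \<psi>x_def)
  next
    case True
    have "\<bar>St n z\<bar> \<le> F" "\<bar>Sx n z\<bar> \<le> B"
      unfolding St_def Sx_def using steklov_t_bound[OF V_lip e(1)] steklov_x_bound[OF V_lip e(1)] by auto
    then have "\<bar>St n z + f k\<bar> \<le> F + \<bar>f k\<bar>" "\<bar>Sx n z - k\<bar> \<le> B + \<bar>k\<bar>" by linarith+
    note b = this C(2)[OF Dn_R[OF True, of n]] C'(2)[OF Dn_R[OF True, of n]] A(4-6)[OF True]
    have t: "\<bar>\<psi>t n z\<bar> \<le> C * A1 + C' * (F + \<bar>f k\<bar>) * A2"
      unfolding \<psi>t_def by (intro abs_add_le abs_mult_le b)
    have x: "\<bar>\<psi>x n z\<bar> \<le> C * A3 + C' * (B + \<bar>k\<bar>) * A2"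
      unfolding \<psi>x_def by (intro abs_add_le abs_mult_le b)
    have "\<bar>I n z\<bar> \<le> K"
      unfolding I_def K_def using wk by (intro abs_add_le abs_mult_le t x G_bound) simp
    then show ?thesis using True by simp
  qed
  have K_int: "integrable lborel (\<lambda>z. K * indicator S z)"
    unfolding S_def by (intro integrable_mult_right integrable_real_indicator)
      (auto simp: emeasure_lborel_cbox_eq)
  have e_lim: "(\<lambda>n. C * e n) \<longlonglongrightarrow> 0" for C
    unfolding e_def using tendsto_mult_right_zero[OF LIMSEQ_Suc[OF lim_1_over_n]] by auto
  have I_lim: "AE z in lborel. (\<lambda>n. I n z) \<longlonglongrightarrow> J z"
    using AE_box_average_tendsto[OF w_meas w_bound] AE_box_average_tendsto[OF fw_meas fw_bound]
  proof eventually_elim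
    case (elim z)
    show ?case
    proof (cases "z \<in> S")
      case False
      then show ?thesis using outside' by (simp add: I_def J_def \<psi>t_def \<psi>x_def)
    next
      case True
      then have "0 \<le> fst z" using S_half by (auto simp: half_plane_def)
      then have lims: "(\<lambda>n. St n z) \<longlonglongrightarrow> - f (w z)" "(\<lambda>n. Sx n z) \<longlonglongrightarrow> w z"
        unfolding St_def Sx_def e_def using elim tendsto_minus
        by (simp_all only: steklov_t_box steklov_x_box) blast
      have "(\<lambda>n. Dn n z) \<longlonglongrightarrow> D k z"
        by (rule LIM_zero_cancel, rule Lim_null_comparison[OF _ e_lim[of "F + B"]])
          (simp add: always_eventually D_approx)
      then have "(\<lambda>n. \<phi> (Dn n z)) \<longlonglongrightarrow> \<phi> (D k z)" "(\<lambda>n. \<phi>' (Dn n z)) \<longlonglongrightarrow> \<phi>' (D k z)"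
        using \<phi>_cont \<phi>(3) by (auto simp: continuous_on_eq_continuous_at intro: isCont_tendsto_compose)
      then have "(\<lambda>n. I n z) \<longlonglongrightarrow>
          \<bar>w z - k\<bar> * (\<phi> (D k z) * \<alpha> z + \<phi>' (D k z) * (- f (w z) + f k) * \<beta> z)
          + G z * (\<phi> (D k z) * \<gamma> z + \<phi>' (D k z) * (w z - k) * \<beta> z)"
        unfolding I_def \<psi>t_def \<psi>x_def using lims by (intro tendsto_intros)
      moreover have "G z * (w z - k) = \<bar>w z - k\<bar> * (f (w z) - f k)"
        by (auto simp: G_def sgn_if abs_if)
      then have "G z * (\<phi>' (D k z) * (w z - k) * \<beta> z)
          = \<bar>w z - k\<bar> * (f (w z) - f k) * (\<phi>' (D k z) * \<beta> z)"
        by (metis mult.assoc mult.left_commute)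
      then have "\<bar>w z - k\<bar> * (\<phi> (D k z) * \<alpha> z + \<phi>' (D k z) * (- f (w z) + f k) * \<beta> z)
          + G z * (\<phi> (D k z) * \<gamma> z + \<phi>' (D k z) * (w z - k) * \<beta> z) = J z"
        by (simp add: J_def algebra_simps)
      ultimately show ?thesis by simp
    qed
  qed
  have lim: "(\<lambda>n. integral\<^sup>L lborel (I n)) \<longlonglongrightarrow> integral\<^sup>L lborel J"
    by (rule integral_dominated_convergence[OF J_meas I_meas K_int I_lim]) (use I_bound in simp)
  have J_int: "integrable lborel J"
    by (rule integrable_dominated_convergence[OF J_meas I_meas K_int I_lim]) (use I_bound in simp)
  have J_nonneg: "0 \<le> integral\<^sup>L lborel J"
    by (rule LIMSEQ_le_const[OF lim]) (use I_nonneg in auto)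
  \<comment> \<open>The flux through the lateral boundary of the cone is at most
    \<open>\<Lambda>f * |w - k|\<close>, the loss caused by its shrinking is
    \<open>\<Lambda> * |w - k|\<close>, and \<open>Q\<close> is the surplus. Since
    \<open>J <= - Q <= 0\<close> while the integral of \<open>J\<close> is nonnegative,
    \<open>Q\<close> vanishes almost everywhere. The strict inequality
    \<open>\<Lambda>f < \<Lambda>\<close> makes this informative.\<close>
  define Q where "Q z = (\<Lambda> - \<Lambda>f) * (\<phi> (D k z) * \<bar>w z - k\<bar> * (\<theta> (fst z) * (2 * max 0 (\<xi> z))))" for z
  have Q_nonneg: "0 \<le> Q z" for z
    using \<Lambda> \<phi>(2) \<theta>_nonneg by (simp add: Q_def)
  have JQ: "J z \<le> - Q z" for z
  proof -
    have 1: "\<phi> (D k z) * (\<theta>' (fst z) * sq_pos (\<xi> z)) = 0"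
      using base[of z] \<theta>_0(2)[of "fst z"] \<theta>'_1[of "fst z"] by (cases "0 < \<xi> z") fastforce+
    have "\<bar>G z * rx z\<bar> \<le> (\<Lambda>f * \<bar>w z - k\<bar>) * 1"
      unfolding abs_mult[of "G z"]
    proof (rule mult_mono)
      show "\<bar>G z\<bar> \<le> \<Lambda>f * \<bar>w z - k\<bar>"
        using \<Lambda>f[OF w_bound, of z] by (auto simp: G_def abs_mult sgn_if)
    qed (use rx_bound \<Lambda> in auto)
    then have "- (G z * rx z) \<le> \<Lambda>f * \<bar>w z - k\<bar>" by linarith
    then have "\<phi> (D k z) * (\<theta> (fst z) * (2 * max 0 (\<xi> z))) * (- (G z * rx z))
        \<le> \<phi> (D k z) * (\<theta> (fst z) * (2 * max 0 (\<xi> z))) * (\<Lambda>f * \<bar>w z - k\<bar>)"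
      using \<phi>(2) \<theta>_nonneg by (intro mult_left_mono) auto
    moreover have "J z = \<bar>w z - k\<bar> * (\<phi> (D k z) * (\<theta>' (fst z) * sq_pos (\<xi> z)))
        - \<Lambda> * (\<phi> (D k z) * \<bar>w z - k\<bar> * (\<theta> (fst z) * (2 * max 0 (\<xi> z))))
        + \<phi> (D k z) * (\<theta> (fst z) * (2 * max 0 (\<xi> z))) * (- (G z * rx z))"
      by (simp add: J_def \<alpha>_def \<gamma>_def algebra_simps)
    ultimately show ?thesis unfolding 1 by (simp add: Q_def algebra_simps)
  qed
  have mJ: "0 \<le> - J z" for z using JQ[of z] Q_nonneg[of z] by linarith
  have "(\<integral>z. - J z \<partial>lborel) = 0"
    using J_nonneg Bochner_Integration.integral_nonneg[of lborel "\<lambda>z. - J z"] mJ by simp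
  then have "AE z in lborel. - J z = 0"
    using integral_nonneg_eq_0_iff_AE[of lborel "\<lambda>z. - J z"] J_int mJ by simp
  then show ?thesis
  proof eventually_elim
    case (elim z)
    then have "Q z = 0" using JQ[of z] Q_nonneg[of z] by linarith
    then show ?case using \<Lambda> \<theta>_pos[of "fst z"] by (auto simp: Q_def)
  qed
qed

section \<open>From almost every point of a cone to its apex\<close>

text \<open>\<open>w\<close> has no meaning on a single vertical segment, so the balance
  \<open>box_t\<close> is taken over thin boxes to its right, where \<open>f(w) = f(k)\<close>. The
  Lipschitz bound in space carries the averaged identity over to the segment as the width tends to
  0.\<close>

lemma vertical_constant:
  assumes st: "0 \<le> s" "s \<le> t" and e: "0 < e"
    and wk: "AE z in lborel. z \<in> cbox (s, x) (t, x + e) \<longrightarrow> w z = k"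
  shows "D k (t, x) = D k (s, x)"
proof -
  define H where "H y = U t y - U s y" for y
  have H_lip: "\<bar>H y - H y'\<bar> \<le> 2 * B * \<bar>y - y'\<bar>" for y y'
    using lip[of t t y y'] lip[of s s y y'] st by (auto simp: H_def)
  have H_cont: "continuous_on S H" for S
  proof -
    have "(2 * B)-lipschitz_on S H"
      using H_lip FB_nonneg by (intro lipschitz_onI) (auto simp: dist_real_def)
    then show ?thesis by (rule lipschitz_on_continuous_on)
  qed
  have close: "\<bar>- f k * (t - s) - H x\<bar> \<le> 2 * B * (1 / Suc n)" if n: "1 / Suc n < e" for n
  proof -
    define h where "h = 1 / real (Suc n)"
    have h: "h > 0" "h < e" using n by (simp_all add: h_def)
    have "AE z in lebesgue. z \<in> cbox (s, x) (t, x + e) \<longrightarrow> w z = k"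
      using wk by (simp add: AE_completion_iff)
    then obtain N where "N \<in> null_sets lebesgue"
      and N: "\<And>z. z \<notin> N \<Longrightarrow> z \<in> cbox (s, x) (t, x + e) \<longrightarrow> w z = k"
      by (rule AE_E3) simp
    then have neg: "negligible N" by (simp add: negligible_iff_null_sets)
    have sub: "cbox (s, x) (t, x + h) \<subseteq> cbox (s, x) (t, x + e)"
      using h by (auto simp: cbox_Pair_eq)
    have "integral (cbox (s, x) (t, x + h)) (\<lambda>z. f (w z)) = integral (cbox (s, x) (t, x + h)) (\<lambda>z. f k)"
    proof (rule integral_spike[OF neg])
      fix z assume "z \<in> cbox (s, x) (t, x + h) - N"
      then have "w z = k" using N sub by blast
      then show "f k = f (w z)" by simp
    qed
    also have "\<dots> = f k * ((t - s) * h)"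
      using st h by (simp add: content_Pair mult.commute)
    finally have int: "integral {x..x + h} H = - f k * (t - s) * h"
      using box_t[OF st, of x n] by (simp add: H_def[abs_def] h_def)
    have "\<bar>integral {0..h} (\<lambda>y. H (x + y)) - H x * h\<bar> \<le> (2 * B * h) * h"
    proof (rule integral_average_bound)
      show "continuous_on {0..h} (\<lambda>y. H (x + y))"
        by (intro continuous_on_compose2[OF H_cont[of UNIV]] continuous_intros) auto
      fix y assume y: "y \<in> {0..h}"
      then have "2 * B * y \<le> 2 * B * h" using FB_nonneg by (intro mult_left_mono) auto
      then show "\<bar>H (x + y) - H x\<bar> \<le> 2 * B * h" using H_lip[of "x + y" x] y by simp
    qed (use h in simp)
    moreover have "integral {0..h} (\<lambda>y. H (x + y)) = integral {x..x + h} H"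
      using integral_shift_Icc_real[of 0 h H x] by (simp add: comp_def add.commute)
    ultimately have "\<bar>(- f k * (t - s) - H x) * h\<bar> \<le> (2 * B * h) * h"
      by (simp add: int left_diff_distrib)
    then show ?thesis using h(1) by (simp add: abs_mult h_def[symmetric] del: of_nat_Suc)
  qed
  have "\<bar>- f k * (t - s) - H x\<bar> \<le> 0"
  proof (rule LIMSEQ_le_const)
    show "(\<lambda>n. 2 * B * (1 / real (Suc n))) \<longlonglongrightarrow> 0"
      using tendsto_mult_right_zero[OF LIMSEQ_Suc[OF lim_1_over_n]] by auto
    obtain n0 where n0: "1 / real (Suc n0) < e" using e nat_approx_posE by blast
    show "\<exists>n0. \<forall>n\<ge>n0. \<bar>- f k * (t - s) - H x\<bar> \<le> 2 * B * (1 / real (Suc n))"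
    proof (intro exI allI impI)
      fix n assume "n \<ge> n0"
      then have "1 / real (Suc n) \<le> 1 / real (Suc n0)" by (simp add: field_simps)
      then show "\<bar>- f k * (t - s) - H x\<bar> \<le> 2 * B * (1 / real (Suc n))" using n0 by (intro close) linarith
    qed
  qed
  then show ?thesis using st by (simp add: D_def V_def H_def algebra_simps)
qed

text \<open>Let \<open>\<phi>\<close> vanish exactly on a slightly enlarged interval. Where
  \<open>D\<close> leaves this interval inside the cone, \<open>cone_constant_AE\<close> gives
  \<open>w = k\<close> almost everywhere nearby, and then \<open>vertical_constant\<close> says that
  \<open>D\<close> does not change in time. So \<open>\<phi> (D)\<close> has zero time derivative on
  the vertical line through \<open>x\<close>: by constancy where it is positive, by quadratic
  vanishing where it is 0. It is 0 at the base and therefore stays 0.\<close>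

lemma cone_bounds_pos:
  assumes \<Lambda>f: "\<And>l. \<bar>l\<bar> \<le> B \<Longrightarrow> \<bar>f l - f k\<bar> \<le> \<Lambda>f * \<bar>l - k\<bar>" and \<Lambda>: "0 \<le> \<Lambda>f" "\<Lambda>f < \<Lambda>"
    and s: "0 < s" "s < t"
    and base: "\<And>y. \<bar>y - x\<bar> \<le> \<Lambda> * (t - s) \<Longrightarrow> D k (s, y) \<in> {lo..hi}"
  shows "D k (t, x) \<in> {lo..hi}"
proof -
  \<comment> \<open>\<open>D\<close> has Lipschitz constants \<open>F + |f k|\<close> in time and
    \<open>B + |k|\<close> in space; the enlarged base reaches \<open>\<eta>\<close> further in time
    and \<open>2 * \<eta>\<close> further in space.\<close>
  define C where "C = F + \<bar>f k\<bar> + 2 * (B + \<bar>k\<bar>)"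
  have C: "0 \<le> C" using FB_nonneg by (simp add: C_def)
  have approx: "D k (t, x) \<in> {lo - C * \<eta>..hi + C * \<eta>}" if \<eta>: "\<eta> > 0" for \<eta>
  proof -
    define \<phi> where "\<phi> d = sq_pos (lo - C * \<eta> - d) + sq_pos (d - (hi + C * \<eta>))" for d
    define \<phi>' where "\<phi>' d = - 2 * max 0 (lo - C * \<eta> - d) + 2 * max 0 (d - (hi + C * \<eta>))" for d
    have \<phi>_deriv: "(\<phi> has_real_derivative \<phi>' d) (at d)" for d
      unfolding \<phi>_def \<phi>'_def by (auto intro!: derivative_eq_intros)
    have \<phi>_nonneg: "0 \<le> \<phi> d" for d by (simp add: \<phi>_def)
    have \<phi>'_cont: "continuous_on UNIV \<phi>'" unfolding \<phi>'_def by (intro continuous_intros)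
    have \<phi>_0: "\<phi> d = 0 \<longleftrightarrow> d \<in> {lo - C * \<eta>..hi + C * \<eta>}" for d
      by (auto simp: \<phi>_def add_nonneg_eq_0_iff)
    \<comment> \<open>Smoothing the distance takes up \<open>\<eta>\<close> on the axis. The extra
      radius \<open>2 * \<eta>\<close> compensates for it and leaves the points
      \<open>(\<tau>, x)\<close> with \<open>\<tau> <= t\<close> strictly inside.\<close>
    define \<xi> where "\<xi> z = \<Lambda> * t + 2 * \<eta> - \<Lambda> * fst z - sqrt (\<eta>\<^sup>2 + (snd z - x)\<^sup>2)" for z
    have base': "\<phi> (D k z) = 0" if z: "s \<le> fst z" "fst z \<le> s + \<eta>" "0 < \<xi> z" for z
    proof -
      obtain \<tau> y where zy: "z = (\<tau>, y)" by (cases z)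
      have "\<bar>y - x\<bar> \<le> sqrt (\<eta>\<^sup>2 + (y - x)\<^sup>2)" by (rule real_le_rsqrt) simp
      also have "\<dots> \<le> \<Lambda> * (t - \<tau>) + 2 * \<eta>" using z(3) by (simp add: \<xi>_def zy algebra_simps)
      also have "\<Lambda> * (t - \<tau>) \<le> \<Lambda> * (t - s)" using z(1) \<Lambda> by (intro mult_left_mono) (auto simp: zy)
      finally have y: "\<bar>y - x\<bar> \<le> \<Lambda> * (t - s) + 2 * \<eta>" by simp
      define r where "r = \<Lambda> * (t - s)"
      have r: "0 \<le> r" using \<Lambda> s by (simp add: r_def)
      \<comment> \<open>\<open>y'\<close> is the point of the original base nearest to
        \<open>y\<close>.\<close>
      define y' where "y' = max (x - r) (min (x + r) y)"
      have y': "\<bar>y' - x\<bar> \<le> r" "\<bar>y - y'\<bar> \<le> 2 * \<eta>"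
        using r y \<eta> by (auto simp: y'_def r_def[symmetric])
      have "(F + \<bar>f k\<bar>) * \<bar>\<tau> - s\<bar> \<le> (F + \<bar>f k\<bar>) * \<eta>"
        using z FB_nonneg by (intro mult_left_mono) (auto simp: zy)
      moreover have "(B + \<bar>k\<bar>) * \<bar>y - y'\<bar> \<le> (B + \<bar>k\<bar>) * (2 * \<eta>)"
        using y' FB_nonneg by (intro mult_left_mono) auto
      ultimately have "\<bar>D k (\<tau>, y) - D k (s, y')\<bar> \<le> C * \<eta>"
        using D_lip[of k \<tau> y s y'] by (simp add: C_def algebra_simps)
      then show ?thesis using base[of y'] y'(1) unfolding \<phi>_0 zy r_def by auto
    qed
    have AE: "AE z in lborel. s < fst z \<longrightarrow> 0 < \<xi> z \<longrightarrow> \<phi> (D k z) = 0 \<or> w z = k"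
      unfolding \<xi>_def
      by (rule cone_constant_AE[OF \<phi>_deriv \<phi>_nonneg \<phi>'_cont \<Lambda>f \<Lambda> s(1) \<eta> \<eta>])
        (use base' in \<open>auto simp: \<xi>_def\<close>)
    \<comment> \<open>\<open>E\<close> is the part of the cone where the bounds fail. It is open, so
      \<open>w = k\<close> holds almost everywhere on whole boxes around each of its points.\<close>
    define E where "E = {z. s < fst z \<and> 0 < \<xi> z \<and> 0 < \<phi> (D k z)}"
    have "open E"
    proof -
      have "continuous_on UNIV (\<lambda>z. \<phi> (D k z))"
        unfolding \<phi>_def by (intro continuous_intros)
      then show ?thesis unfolding E_def \<xi>_def
        by (intro open_Collect_conj open_Collect_less continuous_intros)
    qed
    have AE_E: "AE z in lborel. z \<in> E \<longrightarrow> w z = k"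
      using AE by eventually_elim (auto simp: E_def)
    define g where "g \<tau> = \<phi> (D k (\<tau>, x))" for \<tau>
    have "(g has_real_derivative 0) (at \<tau>)" if \<tau>: "s < \<tau>" "\<tau> < t" for \<tau>
    proof (cases "g \<tau> = 0")
      case True
      \<comment> \<open>In time \<open>h\<close> the value of \<open>D\<close> leaves the interval
        by at most \<open>C' * |h|\<close>, and \<open>\<phi>\<close> grows quadratically outside
        it; hence the difference quotients of \<open>g\<close> are O(h).\<close>
      define C' where "C' = F + \<bar>f k\<bar>"
      have "\<bar>g \<tau>'\<bar> \<le> 2 * C'\<^sup>2 * \<bar>\<tau>' - \<tau>\<bar>\<^sup>2" for \<tau>'
      proof -
        have "\<bar>D k (\<tau>', x) - D k (\<tau>, x)\<bar> \<le> C' * \<bar>\<tau>' - \<tau>\<bar>"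
          using D_lip[of k \<tau>' x \<tau> x] by (simp add: C'_def)
        moreover have "D k (\<tau>, x) \<in> {lo - C * \<eta>..hi + C * \<eta>}" using True by (simp add: g_def \<phi>_0)
        ultimately have "max 0 (lo - C * \<eta> - D k (\<tau>', x)) \<le> C' * \<bar>\<tau>' - \<tau>\<bar>"
          "max 0 (D k (\<tau>', x) - (hi + C * \<eta>)) \<le> C' * \<bar>\<tau>' - \<tau>\<bar>" by auto
        then have "sq_pos (lo - C * \<eta> - D k (\<tau>', x)) \<le> (C' * \<bar>\<tau>' - \<tau>\<bar>)\<^sup>2"
          "sq_pos (D k (\<tau>', x) - (hi + C * \<eta>)) \<le> (C' * \<bar>\<tau>' - \<tau>\<bar>)\<^sup>2"
          unfolding sq_pos_def by (auto intro!: power_mono)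
        then show ?thesis by (simp add: g_def \<phi>_def power_mult_distrib)
      qed
      note g_le = this
      have b: "\<bar>(g (\<tau> + h) - g \<tau>) / h\<bar> \<le> 2 * C'\<^sup>2 * \<bar>h\<bar>" if "h \<noteq> 0" for h
      proof -
        have "\<bar>g (\<tau> + h)\<bar> \<le> 2 * C'\<^sup>2 * \<bar>h\<bar> * \<bar>h\<bar>"
          using g_le[of "\<tau> + h"] by (simp add: power2_eq_square mult.assoc)
        then show ?thesis using that True by (simp add: abs_divide pos_divide_le_eq)
      qed
      show ?thesis unfolding DERIV_def
      proof (rule Lim_null_comparison)
        show "\<forall>\<^sub>F h in at 0. norm ((g (\<tau> + h) - g \<tau>) / h) \<le> 2 * C'\<^sup>2 * \<bar>h\<bar>"
          using b by (auto simp: eventually_at intro!: exI[of _ 1])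
        show "((\<lambda>h. 2 * C'\<^sup>2 * \<bar>h\<bar>) \<longlongrightarrow> 0) (at 0)"
          by (intro tendsto_eq_intros | simp)+
      qed
    next
      case False
      have "\<Lambda> * \<tau> \<le> \<Lambda> * t" using \<tau> \<Lambda> by (intro mult_left_mono) auto
      then have "0 < \<xi> (\<tau>, x)" using \<eta> by (simp add: \<xi>_def)
      then have "(\<tau>, x) \<in> E" using \<tau> False \<phi>_nonneg[of "D k (\<tau>, x)"]
        by (simp add: E_def g_def order.strict_iff_order)
      then obtain r where r: "r > 0" "cball (\<tau>, x) r \<subseteq> E"
        using \<open>open E\<close> open_contains_cball by blast
      define \<rho> where "\<rho> = min (r / 2) (\<tau> - s)"
      have \<rho>: "\<rho> > 0" "\<rho> \<le> r / 2" "\<rho> \<le> \<tau> - s" using r \<tau> unfolding \<rho>_def by linarith+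
      have box: "cbox (\<tau> - \<rho>, x) (\<tau> + \<rho>, x + \<rho>) \<subseteq> E"
      proof
        fix z assume z: "z \<in> cbox (\<tau> - \<rho>, x) (\<tau> + \<rho>, x + \<rho>)"
        have "dist (\<tau>, x) z \<le> \<bar>\<tau> - fst z\<bar> + \<bar>x - snd z\<bar>"
          using sqrt_sum_squares_le_sum_abs[of "\<tau> - fst z" "x - snd z"]
          by (cases z) (simp add: dist_Pair_Pair dist_real_def)
        also have "\<dots> \<le> r" using z \<rho> by (cases z) (auto simp: cbox_Pair_eq)
        finally show "z \<in> E" using r by auto
      qed
      have const: "D k (b, x) = D k (a, x)" if "\<tau> - \<rho> \<le> a" "a \<le> b" "b \<le> \<tau> + \<rho>" for a b
      proof (rule vertical_constant[OF _ that(2) \<rho>(1)])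
        show "0 \<le> a" using that \<rho> s by linarith
        show "AE z in lborel. z \<in> cbox (a, x) (b, x + \<rho>) \<longrightarrow> w z = k"
          using AE_E
        proof eventually_elim
          case (elim z)
          moreover have "cbox (a, x) (b, x + \<rho>) \<subseteq> cbox (\<tau> - \<rho>, x) (\<tau> + \<rho>, x + \<rho>)"
            using that by (auto simp: cbox_Pair_eq)
          ultimately show ?case using box by blast
        qed
      qed
      have g_const: "g \<tau>' = g \<tau>" if "\<tau>' \<in> {\<tau> - \<rho><..<\<tau> + \<rho>}" for \<tau>'
        using const[of \<tau> \<tau>'] const[of \<tau>' \<tau>] that \<rho> by (cases "\<tau> \<le> \<tau>'") (auto simp: g_def)
      show ?thesis
      proof (rule has_field_derivative_transform_within_open[OF DERIV_const])
        show "\<tau> \<in> {\<tau> - \<rho><..<\<tau> + \<rho>}" using \<rho> by simp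
        show "g \<tau> = g \<tau>'" if "\<tau>' \<in> {\<tau> - \<rho><..<\<tau> + \<rho>}" for \<tau>'
          using g_const[OF that] by (rule sym)
      qed simp
    qed
    moreover have "continuous_on {s..t} g"
    proof -
      have "continuous_on {s..t} (\<lambda>\<tau>. D k (\<tau>, x))"
        by (intro continuous_on_D continuous_on_Pair continuous_on_id continuous_on_const)
      then show ?thesis
        unfolding g_def[abs_def] \<phi>_def
        by (intro continuous_on_add continuous_on_sq_pos continuous_on_diff continuous_on_const)
    qed
    ultimately have "g t = g s" using DERIV_isconst_end[OF s(2)] by blast
    moreover have "g s = 0"
    proof -
      have "D k (s, x) \<in> {lo..hi}" using base[of x] \<Lambda> s by simp
      moreover have "0 \<le> C * \<eta>" using C \<eta> by simp
      ultimately show ?thesis unfolding g_def \<phi>_0 by auto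
    qed
    ultimately have "\<phi> (D k (t, x)) = 0" by (simp add: g_def)
    then show ?thesis unfolding \<phi>_0 .
  qed
  have "lo \<le> D k (t, x) + e \<and> D k (t, x) \<le> hi + e" if e: "e > 0" for e
  proof -
    have "C * (e / (C + 1)) \<le> e" using C e by (simp add: field_simps)
    moreover have "e / (C + 1) > 0" using C e by simp
    ultimately show ?thesis using approx[of "e / (C + 1)"] by fastforce
  qed
  then show ?thesis by (meson atLeastAtMost_iff field_le_epsilon)
qed

text \<open>Test functions stay away from time 0, so the cone lemma starts at \<open>s + h\<close>.
  Lipschitz continuity in time transfers the bounds from \<open>s\<close>, possibly 0, at a cost
  proportional to \<open>h\<close>.\<close>

lemma affine_comparison:
  assumes \<Lambda>f: "\<And>k l. \<bar>k\<bar> \<le> M \<Longrightarrow> \<bar>l\<bar> \<le> B \<Longrightarrow> \<bar>f l - f k\<bar> \<le> \<Lambda>f * \<bar>l - k\<bar>" and \<Lambda>: "0 \<le> \<Lambda>f" "\<Lambda>f < \<Lambda>"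
  shows "affine_comparison \<Lambda> f M U"
  unfolding affine_comparison_def
proof (intro allI impI)
  fix k s t x lo hi :: real
  assume k: "\<bar>k\<bar> \<le> M" and s: "0 \<le> s" "s \<le> t"
    and base: "\<forall>y. \<bar>y - x\<bar> \<le> \<Lambda> * (t - s) \<longrightarrow> U s y - k * y + f k * s \<in> {lo..hi}"
  have D: "D k (\<tau>, y) = U \<tau> y - k * y + f k * \<tau>" if "0 \<le> \<tau>" for \<tau> y
    using that by (simp add: D_def V_def)
  show "U t x - k * x + f k * t \<in> {lo..hi}"
  proof (cases "s = t")
    case True
    then show ?thesis using base by simp
  next
    case False
    define C where "C = F + \<bar>f k\<bar>"
    have C: "0 \<le> C" using FB_nonneg by (simp add: C_def)
    have *: "D k (t, x) \<in> {lo - C * h..hi + C * h}" if h: "0 < h" "h < t - s" for h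
    proof (rule cone_bounds_pos[OF \<Lambda>f[OF k] \<Lambda>])
      show "0 < s + h" "s + h < t" using h s by auto
      fix y assume y: "\<bar>y - x\<bar> \<le> \<Lambda> * (t - (s + h))"
      also have "\<dots> \<le> \<Lambda> * (t - s)" using \<Lambda> h by (intro mult_left_mono) auto
      finally have "D k (s, y) \<in> {lo..hi}" using base D[OF s(1)] by simp
      moreover have "\<bar>D k (s + h, y) - D k (s, y)\<bar> \<le> C * h"
        using D_lip[of k "s + h" y s y] h by (simp add: C_def)
      ultimately show "D k (s + h, y) \<in> {lo - C * h..hi + C * h}" by auto
    qed
    have "lo \<le> D k (t, x) + e \<and> D k (t, x) \<le> hi + e" if e: "e > 0" for e
    proof -
      define h where "h = min (e / (C + 1)) ((t - s) / 2)"
      have h: "0 < h" "h < t - s" "h \<le> e / (C + 1)" using e C s False by (auto simp: h_def min_less_iff_disj)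
      have "C * h \<le> C * (e / (C + 1))" using C h by (intro mult_left_mono) auto
      also have "\<dots> \<le> e" using C e by (simp add: field_simps)
      finally show ?thesis using *[OF h(1,2)] by auto
    qed
    then have "D k (t, x) \<in> {lo..hi}" by (meson atLeastAtMost_iff field_le_epsilon)
    then show ?thesis using D s by simp
  qed
qed

end

section \<open>The potential of an entropy solution\<close>

text \<open>\<open>w\<close> is determined up to null sets of the plane and has no values at a
  prescribed time. The slices \<open>v t\<close> provide them, the initial datum included; they
  agree with \<open>w\<close> for almost every positive time and are tied together by continuity in
  time.\<close>

locale entropy_slices = kruzhkov_flux +
  fixes v :: "real \<Rightarrow> real \<Rightarrow> real"
  assumes v_meas: "\<And>t. v t \<in> borel_measurable borel"
    and v_bound: "\<And>t x. \<bar>v t x\<bar> \<le> B"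
    and v_w: "AE t in lborel. 0 < t \<longrightarrow> (AE x in lborel. v t x = w (t, x))"
    and v_cont: "\<And>t r. 0 \<le> t \<Longrightarrow> 0 < r \<Longrightarrow>
      ((\<lambda>\<tau>. LINT x:{-r..r}|lborel. \<bar>v \<tau> x - v t x\<bar>) \<longlongrightarrow> 0) (at t within {0..})"
begin

section \<open>The weak equation and its balance between two times\<close>

text \<open>For constants \<open>k\<close> beyond the range of \<open>w\<close> the sign factor is
  constant, so \<open>- B - 1\<close> and \<open>B + 1\<close> yield the two opposite inequalities
  of the weak equation. The terms with \<open>k\<close> and \<open>f k\<close> integrate to 0, since
  they are derivatives of compactly supported functions.\<close>

lemma weak_product:
  assumes \<alpha>: "\<And>t. (\<alpha> has_real_derivative \<alpha>' t) (at t)" "continuous_on UNIV \<alpha>'" "\<And>t. 0 \<le> \<alpha> t"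
      "\<And>t. t \<notin> {p..q} \<Longrightarrow> \<alpha> t = 0" "\<And>t. t \<notin> {p..q} \<Longrightarrow> \<alpha>' t = 0" "0 < p"
    and \<beta>: "\<And>x. (\<beta> has_real_derivative \<beta>' x) (at x)" "continuous_on UNIV \<beta>'" "\<And>x. 0 \<le> \<beta> x"
      "\<And>x. x \<notin> {c..d} \<Longrightarrow> \<beta> x = 0" "\<And>x. x \<notin> {c..d} \<Longrightarrow> \<beta>' x = 0"
  shows "integrable lborel (\<lambda>z. w z * (\<alpha>' (fst z) * \<beta> (snd z)) + f (w z) * (\<alpha> (fst z) * \<beta>' (snd z)))"
    and "(\<integral>z. w z * (\<alpha>' (fst z) * \<beta> (snd z)) + f (w z) * (\<alpha> (fst z) * \<beta>' (snd z)) \<partial>lborel) = 0"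
proof -
  note [measurable] = w_meas fw_meas
  define a where "a z = \<alpha>' (fst z) * \<beta> (snd z)" for z :: "real \<times> real"
  define b where "b z = \<alpha> (fst z) * \<beta>' (snd z)" for z :: "real \<times> real"
  have cont: "continuous_on UNIV \<alpha>" "continuous_on UNIV \<beta>"
    by (intro continuous_at_imp_continuous_on ballI DERIV_isCont[OF \<alpha>(1)] DERIV_isCont[OF \<beta>(1)])+
  have cont_fs: "continuous_on UNIV (\<lambda>z :: real \<times> real. h (fst z))"
      "continuous_on UNIV (\<lambda>z :: real \<times> real. h (snd z))"
    if "continuous_on UNIV h" for h :: "real \<Rightarrow> real"
    using continuous_on_compose2[OF that] continuous_on_fst[OF continuous_on_id]
      continuous_on_snd[OF continuous_on_id] by blast+
  have cont_ab: "continuous_on UNIV a" "continuous_on UNIV b"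
    unfolding a_def[abs_def] b_def[abs_def]
    by (intro continuous_on_mult cont_fs cont \<alpha>(2) \<beta>(2))+
  have ab_meas [measurable]: "a \<in> borel_measurable borel" "b \<in> borel_measurable borel"
    using cont_ab borel_measurable_continuous_onI by blast+
  define S where "S = cbox (p, c) (q, d)"
  have out: "a z = 0" "b z = 0" "\<alpha> (fst z) * \<beta> (snd z) = 0" if "z \<notin> S" for z
    using that \<alpha>(4,5)[of "fst z"] \<beta>(4,5)[of "snd z"]
    by (cases z; auto simp: S_def cbox_Pair_eq a_def b_def)+
  have compS: "compact S" by (simp add: S_def)
  obtain C where C: "0 \<le> C" "\<And>z. z \<in> S \<Longrightarrow> \<bar>a z\<bar> \<le> C"
    using compact_continuous_abs_bound[OF compS continuous_on_subset[OF cont_ab(1) subset_UNIV]] by blast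
  obtain C' where C': "0 \<le> C'" "\<And>z. z \<in> S \<Longrightarrow> \<bar>b z\<bar> \<le> C'"
    using compact_continuous_abs_bound[OF compS continuous_on_subset[OF cont_ab(2) subset_UNIV]] by blast
  have aC: "\<bar>a z\<bar> \<le> C" and bC: "\<bar>b z\<bar> \<le> C'" for z
    using C C' out[of z] by (cases "z \<in> S"; simp)+
  note int_a = integrable_bounded_support[OF ab_meas(1) aC out(1)[unfolded S_def]]
  note int_b = integrable_bounded_support[OF ab_meas(2) bC out(2)[unfolded S_def]]
  have int_wa: "integrable lborel (\<lambda>z. w z * a z)"
  proof (rule integrable_bounded_support[where a = "(p, c)" and b = "(q, d)" and C = "B * C"])
    show "\<bar>w z * a z\<bar> \<le> B * C" for z by (intro abs_mult_le w_bound aC)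
    show "w z * a z = 0" if "z \<notin> cbox (p, c) (q, d)" for z using out(1)[of z] that by (simp add: S_def)
  qed measurable
  have int_fb: "integrable lborel (\<lambda>z. f (w z) * b z)"
  proof (rule integrable_bounded_support[where a = "(p, c)" and b = "(q, d)" and C = "F * C'"])
    show "\<bar>f (w z) * b z\<bar> \<le> F * C'" for z by (intro abs_mult_le fw_bound bC)
    show "f (w z) * b z = 0" if "z \<notin> cbox (p, c) (q, d)" for z using out(2)[of z] that by (simp add: S_def)
  qed measurable
  have "(\<integral>z. a z \<partial>lborel) = (\<integral>t. \<alpha>' t * (\<integral>x. \<beta> x \<partial>lborel) \<partial>lborel)"
    using Fubini_lborel[OF int_a] by (simp add: a_def)
  then have a0: "(\<integral>z. a z \<partial>lborel) = 0"
    using integral_deriv_compact_support[OF \<alpha>(1,2,4,5)] by simp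
  have "(\<integral>z. b z \<partial>lborel) = (\<integral>t. \<alpha> t * (\<integral>x. \<beta>' x \<partial>lborel) \<partial>lborel)"
    using Fubini_lborel[OF int_b] by (simp add: b_def)
  then have b0: "(\<integral>z. b z \<partial>lborel) = 0"
    using integral_deriv_compact_support[OF \<beta>(1,2,4,5)] by simp
  have test: "test_function (\<lambda>z. \<alpha> (fst z) * \<beta> (snd z)) a b"
    unfolding test_function_def
  proof (intro conjI allI cont_ab)
    show "((\<lambda>z. \<alpha> (fst z) * \<beta> (snd z)) has_derivative (\<lambda>h. a z * fst h + b z * snd h)) (at z)" for z
    proof (rule has_derivative_of_partials[OF _ _ cont_ab(2)])
      show "((\<lambda>t. \<alpha> (fst (t, x)) * \<beta> (snd (t, x))) has_real_derivative a (t, x)) (at t)" for t x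
        using DERIV_cmult_right[OF \<alpha>(1)] by (simp add: a_def)
      show "((\<lambda>x. \<alpha> (fst (t, x)) * \<beta> (snd (t, x))) has_real_derivative b (t, x)) (at x)" for t x
        using DERIV_cmult[OF \<beta>(1)] by (simp add: b_def)
    qed
    show "\<exists>S. compact S \<and> S \<subseteq> half_plane \<and> (\<forall>z. z \<notin> S \<longrightarrow> \<alpha> (fst z) * \<beta> (snd z) = 0)"
    proof (intro exI[of _ S] conjI allI impI compS out(3))
      show "S \<subseteq> half_plane" using \<alpha>(6) by (auto simp: S_def half_plane_def cbox_Pair_eq)
    qed
  qed
  have nonneg: "\<forall>z. 0 \<le> \<alpha> (fst z) * \<beta> (snd z)" using \<alpha>(3) \<beta>(3) by simp
  have split: "(\<integral>z. (w z - k) * a z + (f (w z) - f k) * b z \<partial>lborel)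
      = (\<integral>z. w z * a z \<partial>lborel) + (\<integral>z. f (w z) * b z \<partial>lborel)" for k
  proof -
    have "(\<integral>z. (w z - k) * a z + (f (w z) - f k) * b z \<partial>lborel)
        = (\<integral>z. (w z * a z + f (w z) * b z) - (k * a z + f k * b z) \<partial>lborel)"
      by (intro Bochner_Integration.integral_cong) (auto simp: algebra_simps)
    also have "\<dots> = (\<integral>z. w z * a z \<partial>lborel) + (\<integral>z. f (w z) * b z \<partial>lborel)
        - (k * (\<integral>z. a z \<partial>lborel) + f k * (\<integral>z. b z \<partial>lborel))"
      using int_wa int_fb int_a int_b by simp
    finally show ?thesis by (simp add: a0 b0)
  qed
  have "0 \<le> (\<integral>z. (w z - (- B - 1)) * a z + (f (w z) - f (- B - 1)) * b z \<partial>lborel)"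
  proof -
    have "w z - (- B - 1) > 0" for z using w_bound[of z] by linarith
    then have "\<bar>w z - (- B - 1)\<bar> * a z + sgn (w z - (- B - 1)) * (f (w z) - f (- B - 1)) * b z
        = (w z - (- B - 1)) * a z + (f (w z) - f (- B - 1)) * b z" for z
      by (metis abs_of_pos mult_1 sgn_pos)
    then show ?thesis using entropy[OF test nonneg, of "- B - 1"] by simp
  qed
  moreover have "0 \<le> (\<integral>z. - ((w z - (B + 1)) * a z + (f (w z) - f (B + 1)) * b z) \<partial>lborel)"
  proof -
    have "w z - (B + 1) < 0" for z using w_bound[of z] by linarith
    then have "\<bar>w z - (B + 1)\<bar> * a z + sgn (w z - (B + 1)) * (f (w z) - f (B + 1)) * b z
        = - ((w z - (B + 1)) * a z + (f (w z) - f (B + 1)) * b z)" for z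
      by (simp add: abs_of_neg sgn_neg algebra_simps)
    then show ?thesis using entropy[OF test nonneg, of "B + 1"] by simp
  qed
  ultimately have "(\<integral>z. w z * a z \<partial>lborel) + (\<integral>z. f (w z) * b z \<partial>lborel) = 0"
    unfolding split Bochner_Integration.integral_minus by linarith
  then show "(\<integral>z. w z * (\<alpha>' (fst z) * \<beta> (snd z)) + f (w z) * (\<alpha> (fst z) * \<beta>' (snd z)) \<partial>lborel) = 0"
    using int_wa int_fb by (simp add: a_def b_def)
  show "integrable lborel (\<lambda>z. w z * (\<alpha>' (fst z) * \<beta> (snd z)) + f (w z) * (\<alpha> (fst z) * \<beta>' (snd z)))"
    using Bochner_Integration.integrable_add[OF int_wa int_fb] by (simp add: a_def b_def)
qed

lemma integrable_slice_mult:
  fixes g :: "real \<Rightarrow> real"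
  assumes "g \<in> borel_measurable borel" "\<And>x. \<bar>g x\<bar> \<le> C" "\<And>x. x \<notin> {c..d} \<Longrightarrow> g x = 0"
  shows "integrable lborel (\<lambda>x. v t x * g x)"
proof (rule integrable_bounded_support[where C = "B * C" and a = c and b = d])
  show "(\<lambda>x. v t x * g x) \<in> borel_measurable borel"
    using v_meas[of t] assms(1) by measurable
  show "\<bar>v t z * g z\<bar> \<le> B * C" for z by (intro abs_mult_le v_bound assms(2))
qed (use assms(3) in auto)

lemma slice_moment_diff:
  fixes g :: "real \<Rightarrow> real"
  assumes g: "g \<in> borel_measurable borel" "\<And>x. \<bar>g x\<bar> \<le> C" "\<And>x. x \<notin> {-r..r} \<Longrightarrow> g x = 0"
  shows "\<bar>(\<integral>x. v \<tau> x * g x \<partial>lborel) - (\<integral>x. v t x * g x \<partial>lborel)\<bar>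
      \<le> C * (LINT x:{-r..r}|lborel. \<bar>v \<tau> x - v t x\<bar>)"
proof -
  have int: "integrable lborel (\<lambda>x. indicator {-r..r} x * \<bar>v \<tau> x - v t x\<bar>)"
  proof (rule integrable_bounded_support[where C = "1 * (2 * B)" and a = "-r" and b = r])
    show "(\<lambda>x. indicator {-r..r} x * \<bar>v \<tau> x - v t x\<bar>) \<in> borel_measurable borel"
      using v_meas[of \<tau>] v_meas[of t] by measurable
    show "\<bar>indicator {-r..r} z * \<bar>v \<tau> z - v t z\<bar>\<bar> \<le> 1 * (2 * B)" for z
      using v_bound[of \<tau> z] v_bound[of t z] by (intro abs_mult_le) (auto simp: indicator_def)
  qed auto
  have "(\<integral>x. v \<tau> x * g x \<partial>lborel) - (\<integral>x. v t x * g x \<partial>lborel) = (\<integral>x. (v \<tau> x - v t x) * g x \<partial>lborel)"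
    using integrable_slice_mult[OF g] by (simp add: left_diff_distrib)
  also have "norm \<dots> \<le> (\<integral>x. C * (indicator {-r..r} x * \<bar>v \<tau> x - v t x\<bar>) \<partial>lborel)"
  proof (rule Bochner_Integration.integral_norm_bound_integral)
    show "integrable lborel (\<lambda>x. (v \<tau> x - v t x) * g x)"
      using integrable_slice_mult[OF g] by (simp add: left_diff_distrib)
    show "norm ((v \<tau> x - v t x) * g x) \<le> C * (indicator {-r..r} x * \<bar>v \<tau> x - v t x\<bar>)" for x
    proof (cases "x \<in> {-r..r}")
      case True
      then show ?thesis using mult_right_mono[OF g(2)[of x], of "\<bar>v \<tau> x - v t x\<bar>"]
        by (simp add: abs_mult mult.commute)
    qed (use g(3)[of x] in simp)
  qed (use int in simp)
  finally show ?thesis by (simp add: set_lebesgue_integral_def)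
qed

lemma slice_moment_tendsto:
  fixes g :: "real \<Rightarrow> real"
  assumes g: "g \<in> borel_measurable borel" "\<And>x. \<bar>g x\<bar> \<le> C" "\<And>x. x \<notin> {c..d} \<Longrightarrow> g x = 0"
    and t: "0 \<le> t"
  shows "((\<lambda>\<tau>. \<integral>x. v \<tau> x * g x \<partial>lborel) \<longlongrightarrow> (\<integral>x. v t x * g x \<partial>lborel)) (at t within {0..})"
proof -
  define r where "r = max \<bar>c\<bar> \<bar>d\<bar> + 1"
  have r: "0 < r" "{c..d} \<subseteq> {-r..r}" by (auto simp: r_def)
  then have g0: "g x = 0" if "x \<notin> {-r..r}" for x using g(3) that by blast
  have "((\<lambda>\<tau>. (\<integral>x. v \<tau> x * g x \<partial>lborel) - (\<integral>x. v t x * g x \<partial>lborel)) \<longlongrightarrow> 0) (at t within {0..})"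
  proof (rule Lim_null_comparison)
    show "\<forall>\<^sub>F \<tau> in at t within {0..}. norm ((\<integral>x. v \<tau> x * g x \<partial>lborel) - (\<integral>x. v t x * g x \<partial>lborel))
      \<le> C * (LINT x:{-r..r}|lborel. \<bar>v \<tau> x - v t x\<bar>)"
      using slice_moment_diff[OF g(1,2) g0] by (intro always_eventually) simp
    show "((\<lambda>\<tau>. C * (LINT x:{-r..r}|lborel. \<bar>v \<tau> x - v t x\<bar>)) \<longlongrightarrow> 0) (at t within {0..})"
      using tendsto_mult_right_zero[OF v_cont[OF t r(1)]] .
  qed
  then show ?thesis by (rule LIM_zero_cancel)
qed

text \<open>The weak equation is tested with a time factor that tends to the indicator of
  \<open>{s<..t}\<close>. Its derivative concentrates at \<open>s\<close> and \<open>t\<close>, and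
  continuity in time turns the limits into moments of the slices at exactly these times.\<close>

lemma slices_balance:
  assumes \<beta>: "\<And>x. (\<beta> has_real_derivative \<beta>' x) (at x)" "continuous_on UNIV \<beta>'" "\<And>x. 0 \<le> \<beta> x"
      "\<And>x. x \<notin> {c..d} \<Longrightarrow> \<beta> x = 0" "\<And>x. x \<notin> {c..d} \<Longrightarrow> \<beta>' x = 0"
    and st: "0 < s" "s < t"
  shows "(\<integral>x. v t x * \<beta> x \<partial>lborel) - (\<integral>x. v s x * \<beta> x \<partial>lborel)
    = (\<integral>z. indicator {s<..t} (fst z) * (f (w z) * \<beta>' (snd z)) \<partial>lborel)"
proof -
  note [measurable] = w_meas fw_meas
  have cont: "continuous_on UNIV \<beta>"
    by (intro continuous_at_imp_continuous_on ballI DERIV_isCont[OF \<beta>(1)])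
  have \<beta>_meas [measurable]: "\<beta> \<in> borel_measurable borel" "\<beta>' \<in> borel_measurable borel"
    using cont \<beta>(2) borel_measurable_continuous_onI by blast+
  obtain C where C: "0 \<le> C" "\<And>z. z \<in> {c..d} \<Longrightarrow> \<bar>\<beta> z\<bar> \<le> C"
    using compact_continuous_abs_bound[OF compact_Icc continuous_on_subset[OF cont subset_UNIV]] by blast
  obtain C' where C': "0 \<le> C'" "\<And>z. z \<in> {c..d} \<Longrightarrow> \<bar>\<beta>' z\<bar> \<le> C'"
    using compact_continuous_abs_bound[OF compact_Icc continuous_on_subset[OF \<beta>(2) subset_UNIV]] by blast
  have bC: "\<bar>\<beta> x\<bar> \<le> C" and bC': "\<bar>\<beta>' x\<bar> \<le> C'" for x
    using C C' \<beta>(4,5)[of x] by (cases "x \<in> {c..d}"; simp)+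
  have \<beta>_int: "integrable lborel \<beta>" "integrable lborel \<beta>'"
    using integrable_bounded_support[OF \<beta>_meas(1) bC, of c d]
      integrable_bounded_support[OF \<beta>_meas(2) bC', of c d] \<beta>(4,5) by simp_all
  \<comment> \<open>Slices at negative times are unrelated to each other. With them cut off,
    \<open>m\<close> is Borel, being continuous on the open half-line.\<close>
  define m where "m \<tau> = indicator {0<..} \<tau> *\<^sub>R (\<integral>x. v \<tau> x * \<beta> x \<partial>lborel)" for \<tau>
  define n where "n \<tau> = (\<integral>x. f (w (\<tau>, x)) * \<beta>' x \<partial>lborel)" for \<tau>
  have moment_bound: "\<bar>\<integral>x. v \<tau> x * \<beta> x \<partial>lborel\<bar> \<le> (\<integral>x. B * \<bar>\<beta> x\<bar> \<partial>lborel)" for \<tau>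
    using Bochner_Integration.integral_norm_bound_integral[of lborel "\<lambda>x. v \<tau> x * \<beta> x" "\<lambda>x. B * \<bar>\<beta> x\<bar>"]
      integrable_slice_mult[OF \<beta>_meas(1) bC \<beta>(4)] \<beta>_int v_bound
    by (simp add: abs_mult mult_right_mono)
  have m_bound: "\<bar>m \<tau>\<bar> \<le> (\<integral>x. B * \<bar>\<beta> x\<bar> \<partial>lborel)" for \<tau>
  proof -
    have "0 \<le> (\<integral>x. B * \<bar>\<beta> x\<bar> \<partial>lborel)" using moment_bound[of 0] by linarith
    then show ?thesis using moment_bound[of \<tau>] by (simp add: m_def indicator_def)
  qed
  have moment_tendsto: "((\<lambda>\<tau>. \<integral>x. v \<tau> x * \<beta> x \<partial>lborel) \<longlongrightarrow> (\<integral>x. v \<tau>0 x * \<beta> x \<partial>lborel)) (at \<tau>0)"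
    if "0 < \<tau>0" for \<tau>0
  proof -
    have "at \<tau>0 within {0..} = at \<tau>0" using that by (intro at_within_interior) simp
    then show ?thesis using slice_moment_tendsto[OF \<beta>_meas(1) bC \<beta>(4), where t = \<tau>0] that by simp
  qed
  have m_meas [measurable]: "m \<in> borel_measurable borel"
    unfolding m_def[abs_def]
  proof (rule borel_measurable_continuous_on_indicator)
    show "continuous_on {0<..} (\<lambda>\<tau>. \<integral>x. v \<tau> x * \<beta> x \<partial>lborel)"
      using moment_tendsto by (auto simp: continuous_on_def intro: tendsto_within_subset)
  qed simp
  have m_right: "(m \<longlongrightarrow> m \<tau>0) (at_right \<tau>0)" if "0 < \<tau>0" for \<tau>0
  proof -
    have "((\<lambda>\<tau>. \<integral>x. v \<tau> x * \<beta> x \<partial>lborel) \<longlongrightarrow> m \<tau>0) (at_right \<tau>0)"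
      using tendsto_within_subset[OF moment_tendsto[OF that]] that by (simp add: m_def)
    moreover have "\<forall>\<^sub>F \<tau> in at_right \<tau>0. (\<integral>x. v \<tau> x * \<beta> x \<partial>lborel) = m \<tau>"
      using eventually_at_right_less[of \<tau>0] by eventually_elim (use that in \<open>simp add: m_def\<close>)
    ultimately show ?thesis by (rule Lim_transform_eventually)
  qed
  have n_meas [measurable]: "n \<in> borel_measurable borel"
  proof -
    have "(\<lambda>z. f (w z) * \<beta>' (snd z)) \<in> borel_measurable borel" by measurable
    from borel_measurable_integral_slice[OF this] show ?thesis by (simp add: n_def[abs_def])
  qed
  have n_bound: "\<bar>n \<tau>\<bar> \<le> (\<integral>x. F * \<bar>\<beta>' x\<bar> \<partial>lborel)" for \<tau>
  proof -
    have "norm (n \<tau>) \<le> (\<integral>x. F * \<bar>\<beta>' x\<bar> \<partial>lborel)"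
      unfolding n_def
    proof (rule Bochner_Integration.integral_norm_bound_integral)
      show "integrable lborel (\<lambda>x. f (w (\<tau>, x)) * \<beta>' x)"
      proof (rule integrable_bounded_support[where C = "F * C'" and a = c and b = d])
        show "(\<lambda>x. f (w (\<tau>, x)) * \<beta>' x) \<in> borel_measurable borel"
          using measurable_compose[of "\<lambda>x. (\<tau>, x)" borel borel, OF _ fw_meas] by measurable
        show "\<bar>f (w (\<tau>, z)) * \<beta>' z\<bar> \<le> F * C'" for z by (intro abs_mult_le fw_bound bC')
      qed (use \<beta>(5) in auto)
    qed (use \<beta>_int fw_bound in \<open>auto simp: abs_mult mult_right_mono\<close>)
    then show ?thesis by simp
  qed
  \<comment> \<open>The derivative of \<open>\<alpha> j\<close> consists of two kernels immediately
    to the right of \<open>s\<close> and of \<open>t\<close>, so right continuity of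
    \<open>m\<close> suffices for the limit.\<close>
  define \<alpha> where "\<alpha> j \<tau> = smoothstep (Suc j * (\<tau> - s)) - smoothstep (Suc j * (\<tau> - t))" for j :: nat and \<tau>
  define \<alpha>1 where "\<alpha>1 j r \<tau> = Suc j * smoothstep' (Suc j * (\<tau> - r))" for j :: nat and r \<tau> :: real
  have sm [measurable]: "smoothstep \<in> borel_measurable borel" "smoothstep' \<in> borel_measurable borel"
    using continuous_on_smoothstep continuous_on_smoothstep' borel_measurable_continuous_onI by blast+
  have [measurable]: "\<alpha> j \<in> borel_measurable borel" "\<alpha>1 j r \<in> borel_measurable borel" for j r
    unfolding \<alpha>_def[abs_def] \<alpha>1_def[abs_def] by measurable
  have \<alpha>1_out: "\<alpha>1 j r \<tau> = 0" if "\<tau> \<notin> {r..r + 1}" for j r \<tau>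
  proof (cases "\<tau> < r")
    case True
    then show ?thesis by (simp add: \<alpha>1_def smoothstep'_outside mult_nonneg_nonpos)
  next
    case False
    then have "1 * 1 \<le> real (Suc j) * (\<tau> - r)" using that by (intro mult_mono) auto
    then show ?thesis by (simp add: \<alpha>1_def smoothstep'_outside)
  qed
  have \<alpha>_out: "\<alpha> j \<tau> = 0" if "\<tau> \<notin> {s..t + 1}" for j \<tau>
  proof (cases "\<tau> < s")
    case True
    then show ?thesis using st by (simp add: \<alpha>_def smoothstep_0 mult_nonneg_nonpos)
  next
    case False
    then have "1 * 1 \<le> real (Suc j) * (\<tau> - s)" "1 * 1 \<le> real (Suc j) * (\<tau> - t)"
      using that st by (intro mult_mono; simp)+
    then show ?thesis by (simp add: \<alpha>_def smoothstep_1)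
  qed
  have \<alpha>_deriv: "(\<alpha> j has_real_derivative \<alpha>1 j s \<tau> - \<alpha>1 j t \<tau>) (at \<tau>)" for j \<tau>
    unfolding \<alpha>_def[abs_def] \<alpha>1_def by (auto intro!: derivative_eq_intros)
  have \<alpha>_range: "0 \<le> \<alpha> j \<tau>" "\<alpha> j \<tau> \<le> 1" for j \<tau>
  proof -
    have "real (Suc j) * (\<tau> - t) \<le> real (Suc j) * (\<tau> - s)" using st by (intro mult_left_mono) auto
    then show "0 \<le> \<alpha> j \<tau>" by (simp add: \<alpha>_def smoothstep_mono)
    show "\<alpha> j \<tau> \<le> 1"
      using smoothstep_range[of "real (Suc j) * (\<tau> - s)"] smoothstep_range[of "real (Suc j) * (\<tau> - t)"]
      by (simp add: \<alpha>_def)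
  qed
  have \<alpha>1_int: "integrable lborel (\<lambda>\<tau>. \<alpha>1 j r \<tau> * m \<tau>)" for j r
  proof (rule integrable_bounded_support[where a = r and b = "r + 1"])
    show "\<bar>\<alpha>1 j r \<tau> * m \<tau>\<bar> \<le> (real (Suc j) * 4) * (\<integral>x. B * \<bar>\<beta> x\<bar> \<partial>lborel)" for \<tau>
      using smoothstep'_le smoothstep'_nonneg unfolding \<alpha>1_def
      by (intro abs_mult_le m_bound) (auto simp: abs_mult)
  qed (use \<alpha>1_out in auto)
  have \<alpha>n_int: "integrable lborel (\<lambda>\<tau>. \<alpha> j \<tau> * n \<tau>)" for j
  proof (rule integrable_bounded_support[where a = s and b = "t + 1"])
    show "\<bar>\<alpha> j \<tau> * n \<tau>\<bar> \<le> 1 * (\<integral>x. F * \<bar>\<beta>' x\<bar> \<partial>lborel)" for \<tau>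
      using \<alpha>_range[of j \<tau>] by (intro abs_mult_le n_bound) auto
  qed (use \<alpha>_out in auto)
  have weak: "(\<integral>\<tau>. \<alpha>1 j s \<tau> * m \<tau> \<partial>lborel) - (\<integral>\<tau>. \<alpha>1 j t \<tau> * m \<tau> \<partial>lborel) + (\<integral>\<tau>. \<alpha> j \<tau> * n \<tau> \<partial>lborel) = 0" for j
  proof -
    have cont\<alpha>: "continuous_on UNIV (\<lambda>\<tau>. \<alpha>1 j s \<tau> - \<alpha>1 j t \<tau>)"
      unfolding \<alpha>1_def
      by (intro continuous_intros continuous_on_compose2[OF continuous_on_smoothstep'[of UNIV]] subset_UNIV)
    have out': "\<alpha>1 j s \<tau> - \<alpha>1 j t \<tau> = 0" if "\<tau> \<notin> {s..t + 1}" for \<tau>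
      using \<alpha>1_out[of \<tau> s j] \<alpha>1_out[of \<tau> t j] that st by auto
    define W where "W z = w z * ((\<alpha>1 j s (fst z) - \<alpha>1 j t (fst z)) * \<beta> (snd z))
        + f (w z) * (\<alpha> j (fst z) * \<beta>' (snd z))" for z
    have weak: "integrable lborel W" "integral\<^sup>L lborel W = 0"
      unfolding W_def[abs_def]
      by (rule weak_product[OF \<alpha>_deriv cont\<alpha> \<alpha>_range(1) _ _ st(1) \<beta>(1-3)];
          (rule \<alpha>_out out' \<beta>(4,5); assumption))+
    have "0 = (\<integral>\<tau>. (\<integral>x. w (\<tau>, x) * ((\<alpha>1 j s \<tau> - \<alpha>1 j t \<tau>) * \<beta> x) + f (w (\<tau>, x)) * (\<alpha> j \<tau> * \<beta>' x) \<partial>lborel) \<partial>lborel)"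
      using Fubini_lborel[OF weak(1), unfolded weak(2)] by (simp add: W_def)
    also have "\<dots> = (\<integral>\<tau>. (\<alpha>1 j s \<tau> * m \<tau> - \<alpha>1 j t \<tau> * m \<tau>) + \<alpha> j \<tau> * n \<tau> \<partial>lborel)"
    proof (rule integral_cong_AE)
      show "(\<lambda>\<tau>. \<integral>x. w (\<tau>, x) * ((\<alpha>1 j s \<tau> - \<alpha>1 j t \<tau>) * \<beta> x) + f (w (\<tau>, x)) * (\<alpha> j \<tau> * \<beta>' x) \<partial>lborel)
          \<in> borel_measurable lborel"
        using borel_measurable_integral_slice[of W] borel_measurable_integrable[OF weak(1)]
        by (simp add: W_def)
      show "AE \<tau> in lborel. (\<integral>x. w (\<tau>, x) * ((\<alpha>1 j s \<tau> - \<alpha>1 j t \<tau>) * \<beta> x) + f (w (\<tau>, x)) * (\<alpha> j \<tau> * \<beta>' x) \<partial>lborel)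
          = (\<alpha>1 j s \<tau> * m \<tau> - \<alpha>1 j t \<tau> * m \<tau>) + \<alpha> j \<tau> * n \<tau>"
        using v_w
      proof eventually_elim
        case (elim \<tau>)
        have wm [measurable]: "(\<lambda>x. w (\<tau>, x)) \<in> borel_measurable borel" "(\<lambda>x. f (w (\<tau>, x))) \<in> borel_measurable borel"
          using measurable_compose[of "\<lambda>x. (\<tau>, x)" borel borel, OF _ fw_meas]
            measurable_compose[of "\<lambda>x. (\<tau>, x)" borel borel, OF _ w_meas] by measurable
        have i1: "integrable lborel (\<lambda>x. w (\<tau>, x) * \<beta> x)"
        proof (rule integrable_bounded_support[where C = "B * C" and a = c and b = d])
          show "\<bar>w (\<tau>, z) * \<beta> z\<bar> \<le> B * C" for z by (intro abs_mult_le w_bound bC)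
        qed (use \<beta>(4) in auto)
        have i2: "integrable lborel (\<lambda>x. f (w (\<tau>, x)) * \<beta>' x)"
        proof (rule integrable_bounded_support[where C = "F * C'" and a = c and b = d])
          show "\<bar>f (w (\<tau>, z)) * \<beta>' z\<bar> \<le> F * C'" for z by (intro abs_mult_le fw_bound bC')
        qed (use \<beta>(5) in auto)
        have "(\<integral>x. w (\<tau>, x) * ((\<alpha>1 j s \<tau> - \<alpha>1 j t \<tau>) * \<beta> x) + f (w (\<tau>, x)) * (\<alpha> j \<tau> * \<beta>' x) \<partial>lborel)
            = (\<integral>x. (\<alpha>1 j s \<tau> - \<alpha>1 j t \<tau>) * (w (\<tau>, x) * \<beta> x) + \<alpha> j \<tau> * (f (w (\<tau>, x)) * \<beta>' x) \<partial>lborel)"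
          by (simp add: ac_simps)
        also have "\<dots> = (\<alpha>1 j s \<tau> - \<alpha>1 j t \<tau>) * (\<integral>x. w (\<tau>, x) * \<beta> x \<partial>lborel) + \<alpha> j \<tau> * n \<tau>"
          using i1 i2 by (simp add: n_def)
        also have "(\<alpha>1 j s \<tau> - \<alpha>1 j t \<tau>) * (\<integral>x. w (\<tau>, x) * \<beta> x \<partial>lborel) = (\<alpha>1 j s \<tau> - \<alpha>1 j t \<tau>) * m \<tau>"
        proof (cases "0 < \<tau>")
          case True
          then have ae: "AE x in lborel. v \<tau> x = w (\<tau>, x)" using elim by simp
          have "(\<integral>x. v \<tau> x * \<beta> x \<partial>lborel) = (\<integral>x. w (\<tau>, x) * \<beta> x \<partial>lborel)"
          proof (rule integral_cong_AE)
            show "(\<lambda>x. v \<tau> x * \<beta> x) \<in> borel_measurable lborel" using v_meas[of \<tau>] by measurable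
            show "AE x in lborel. v \<tau> x * \<beta> x = w (\<tau>, x) * \<beta> x" using ae by eventually_elim simp
          qed measurable
          then show ?thesis using True by (simp add: m_def)
        next
          case False
          then show ?thesis using out'[of \<tau>] st by simp
        qed
        finally show ?case by (simp add: left_diff_distrib)
      qed
    qed measurable
    also have "\<dots> = (\<integral>\<tau>. \<alpha>1 j s \<tau> * m \<tau> \<partial>lborel) - (\<integral>\<tau>. \<alpha>1 j t \<tau> * m \<tau> \<partial>lborel) + (\<integral>\<tau>. \<alpha> j \<tau> * n \<tau> \<partial>lborel)"
      using \<alpha>1_int \<alpha>n_int by simp
    finally show ?thesis by simp
  qed
  have lim1: "(\<lambda>j. \<integral>\<tau>. \<alpha>1 j r \<tau> * m \<tau> \<partial>lborel) \<longlonglongrightarrow> m r" if "0 < r" for r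
    unfolding \<alpha>1_def by (rule smoothstep'_approximate_identity[OF m_meas m_bound m_right[OF that]])
  have lim2: "(\<lambda>j. \<integral>\<tau>. \<alpha> j \<tau> * n \<tau> \<partial>lborel) \<longlonglongrightarrow> (\<integral>\<tau>. indicator {s<..t} \<tau> * n \<tau> \<partial>lborel)"
  proof (rule integral_dominated_convergence[where w = "\<lambda>\<tau>. (\<integral>x. F * \<bar>\<beta>' x\<bar> \<partial>lborel) * indicator {s..t + 1} \<tau>"])
    show "AE \<tau> in lborel. (\<lambda>j. \<alpha> j \<tau> * n \<tau>) \<longlonglongrightarrow> indicator {s<..t} \<tau> * n \<tau>"
    proof (rule AE_I2, intro tendsto_mult_right)
      fix \<tau>
      have "(\<lambda>j. \<alpha> j \<tau>) \<longlonglongrightarrow> indicator {s<..} \<tau> - indicator {t<..} \<tau>"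
        unfolding \<alpha>_def by (intro tendsto_diff ramp_tendsto smoothstep_0 smoothstep_1)
      moreover have "indicator {s<..} \<tau> - indicator {t<..} \<tau> = (indicator {s<..t} \<tau> :: real)"
        using st by (auto simp: indicator_def)
      ultimately show "(\<lambda>j. \<alpha> j \<tau>) \<longlonglongrightarrow> indicator {s<..t} \<tau>" by simp
    qed
    show "AE \<tau> in lborel. norm (\<alpha> j \<tau> * n \<tau>) \<le> (\<integral>x. F * \<bar>\<beta>' x\<bar> \<partial>lborel) * indicator {s..t + 1} \<tau>" for j
    proof (rule AE_I2)
      fix \<tau>
      show "norm (\<alpha> j \<tau> * n \<tau>) \<le> (\<integral>x. F * \<bar>\<beta>' x\<bar> \<partial>lborel) * indicator {s..t + 1} \<tau>"
      proof (cases "\<tau> \<in> {s..t + 1}")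
        case True
        have "\<bar>\<alpha> j \<tau> * n \<tau>\<bar> \<le> 1 * (\<integral>x. F * \<bar>\<beta>' x\<bar> \<partial>lborel)"
          using \<alpha>_range[of j \<tau>] by (intro abs_mult_le n_bound) auto
        then show ?thesis using True by simp
      qed (use \<alpha>_out in simp)
    qed
    show "integrable lborel (\<lambda>\<tau>. (\<integral>x. F * \<bar>\<beta>' x\<bar> \<partial>lborel) * indicator {s..t + 1} \<tau>)"
      using st by (intro integrable_mult_right integrable_real_indicator) simp_all
  qed simp_all
  have "m s - m t + (\<integral>\<tau>. indicator {s<..t} \<tau> * n \<tau> \<partial>lborel) = 0"
  proof -
    have "(\<lambda>j. (\<integral>\<tau>. \<alpha>1 j s \<tau> * m \<tau> \<partial>lborel) - (\<integral>\<tau>. \<alpha>1 j t \<tau> * m \<tau> \<partial>lborel) + (\<integral>\<tau>. \<alpha> j \<tau> * n \<tau> \<partial>lborel))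
        \<longlonglongrightarrow> m s - m t + (\<integral>\<tau>. indicator {s<..t} \<tau> * n \<tau> \<partial>lborel)"
      using st by (intro tendsto_intros lim1 lim2) auto
    then show ?thesis unfolding weak by (simp add: LIMSEQ_const_iff)
  qed
  moreover have "(\<integral>z. indicator {s<..t} (fst z) * (f (w z) * \<beta>' (snd z)) \<partial>lborel)
      = (\<integral>\<tau>. indicator {s<..t} \<tau> * n \<tau> \<partial>lborel)"
  proof -
    have "integrable lborel (\<lambda>z. indicator {s<..t} (fst z) * (f (w z) * \<beta>' (snd z)))"
    proof (rule integrable_bounded_support[where C = "1 * (F * C')" and a = "(s, c)" and b = "(t, d)"])
      show "\<bar>indicator {s<..t} (fst z) * (f (w z) * \<beta>' (snd z))\<bar> \<le> 1 * (F * C')" for z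
        by (intro abs_mult_le fw_bound bC') (simp add: indicator_def)
      show "indicator {s<..t} (fst z) * (f (w z) * \<beta>' (snd z)) = 0" if "z \<notin> cbox (s, c) (t, d)" for z
        using that \<beta>(5)[of "snd z"] by (cases z) (auto simp: cbox_Pair_eq indicator_def)
    qed measurable
    from Fubini_lborel[OF this] show ?thesis by (simp add: n_def)
  qed
  ultimately show ?thesis using st by (simp add: m_def)
qed

section \<open>Primitives of the slices\<close>

text \<open>The weight is the signed indicator of the oriented interval from 0 to \<open>x\<close>,
  which covers both signs of \<open>x\<close>. Written as a moment of \<open>v t\<close>, the
  primitive inherits continuity in time from \<open>slice_moment_tendsto\<close>.\<close>

definition N :: "real \<Rightarrow> real \<Rightarrow> real" where
  "N t x = (\<integral>y. v t y * (indicator {0<..x} y - indicator {x<..0} y) \<partial>lborel)"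

lemma N_weight:
  fixes x y :: real
  shows "(\<lambda>y. indicator {0<..x} y - indicator {x<..0} y :: real) \<in> borel_measurable borel"
    and "\<bar>indicator {0<..x} y - indicator {x<..0} y\<bar> \<le> (1 :: real)"
    and "y \<notin> {- \<bar>x\<bar>..\<bar>x\<bar>} \<Longrightarrow> indicator {0<..x} y - indicator {x<..0} y = (0 :: real)"
proof -
  show "(\<lambda>y. indicator {0<..x} y - indicator {x<..0} y :: real) \<in> borel_measurable borel"
    by measurable
  show "\<bar>indicator {0<..x} y - indicator {x<..0} y\<bar> \<le> (1 :: real)"
    by (auto simp: indicator_def)
  show "indicator {0<..x} y - indicator {x<..0} y = (0 :: real)" if "y \<notin> {- \<bar>x\<bar>..\<bar>x\<bar>}"
    using that by (cases "0 \<le> x") (auto simp: indicator_def)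
qed

lemma N_diff:
  assumes "x \<le> y"
  shows "N t y - N t x = integral {x..y} (v t)"
    and "N t y - N t x = (\<integral>z. v t z * indicator {x<..y} z \<partial>lborel)"
proof -
  have "N t y - N t x = (\<integral>z. v t z * (indicator {0<..y} z - indicator {y<..0} z)
      - v t z * (indicator {0<..x} z - indicator {x<..0} z) \<partial>lborel)"
    unfolding N_def using integrable_slice_mult[OF N_weight] by simp
  also have "\<dots> = (\<integral>z. v t z * indicator {x<..y} z \<partial>lborel)"
    using assms by (intro Bochner_Integration.integral_cong) (auto simp: indicator_def)
  finally show *: "N t y - N t x = (\<integral>z. v t z * indicator {x<..y} z \<partial>lborel)" .
  show "N t y - N t x = integral {x..y} (v t)"
    unfolding * by (rule integral_Ioc_bounded[OF v_meas v_bound])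
qed

lemma N_0: "N t 0 = 0"
  by (simp add: N_def)

lemma N_lip: "\<bar>N t y - N t x\<bar> \<le> B * \<bar>y - x\<bar>"
proof -
  have *: "\<bar>N t y - N t x\<bar> \<le> B * (y - x)" if "x \<le> y" for x y
  proof -
    have "norm (\<integral>z. v t z * indicator {x<..y} z \<partial>lborel) \<le> (\<integral>z. B * indicator {x<..y} z \<partial>lborel)"
    proof (rule Bochner_Integration.integral_norm_bound_integral)
      show "integrable lborel (\<lambda>z. v t z * indicator {x<..y} z)"
        by (rule integrable_slice_mult[of _ 1 x y]) (auto simp: indicator_def)
      show "integrable lborel (\<lambda>z. B * indicator {x<..y} z)"
        using that by (intro integrable_mult_right integrable_real_indicator) simp_all
      show "norm (v t z * indicator {x<..y} z) \<le> B * indicator {x<..y} z" for z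
        using v_bound[of t z] by (simp add: indicator_def)
    qed
    then show ?thesis using that by (simp add: N_diff(2))
  qed
  show ?thesis using *[of x y] *[of y x] by (cases "x \<le> y") (auto simp: abs_minus_commute)
qed

lemma continuous_N: "continuous_on S (N t)"
proof -
  have "B-lipschitz_on S (N t)"
    using N_lip FB_nonneg by (intro lipschitz_onI) (auto simp: dist_real_def)
  then show ?thesis by (rule lipschitz_on_continuous_on)
qed

lemma N_meas [measurable]: "N t \<in> borel_measurable borel"
  using continuous_N borel_measurable_continuous_onI by blast

lemma N_abs: "\<bar>N t x\<bar> \<le> B * \<bar>x\<bar>"
  using N_lip[of t x 0] by (simp add: N_0)

text \<open>\<open>N t\<close> is only Lipschitz, so the product rule is replaced by Fubini for
  \<open>\<beta>' y * v t x\<close> over the triangle \<open>p <= y <= x <= q\<close>. Integrating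
  over \<open>x\<close> first produces \<open>N t q - N t y\<close>, whose constant part is
  annihilated by \<open>\<beta>'\<close>; integrating over \<open>y\<close> first produces
  \<open>\<beta> x\<close>.\<close>

lemma slice_integration_by_parts:
  assumes \<beta>: "\<And>x. (\<beta> has_real_derivative \<beta>' x) (at x)" "continuous_on UNIV \<beta>'"
      "\<And>x. x \<notin> {c..d} \<Longrightarrow> \<beta> x = 0" "\<And>x. x \<notin> {c..d} \<Longrightarrow> \<beta>' x = 0"
  shows "(\<integral>x. v t x * \<beta> x \<partial>lborel) = - (\<integral>x. \<beta>' x * N t x \<partial>lborel)"
proof (cases "c \<le> d")
  case False
  then show ?thesis using \<beta>(3,4) by simp
next
  case True
  have \<beta>'_meas [measurable]: "\<beta>' \<in> borel_measurable borel"
    using \<beta>(2) borel_measurable_continuous_onI by blast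
  note [measurable] = v_meas
  obtain C' where C': "0 \<le> C'" "\<And>z. z \<in> {c..d} \<Longrightarrow> \<bar>\<beta>' z\<bar> \<le> C'"
    using compact_continuous_abs_bound[OF compact_Icc continuous_on_subset[OF \<beta>(2) subset_UNIV]] by blast
  have bC': "\<bar>\<beta>' x\<bar> \<le> C'" for x using C' \<beta>(4)[of x] by (cases "x \<in> {c..d}"; simp)
  define p q where "p = c - 1" and "q = d + 1"
  have pq: "p \<le> q" "\<beta> p = 0" using True \<beta>(3) by (auto simp: p_def q_def)
  define T where "T = {z :: real \<times> real. p \<le> fst z \<and> fst z \<le> snd z \<and> snd z \<le> q}"
  have T_meas [measurable]: "T \<in> sets borel"
    unfolding T_def
    by (intro borel_closed closed_Collect_conj closed_Collect_le continuous_intros)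
  define g where "g z = \<beta>' (fst z) * v t (snd z) * indicator T z" for z
  have g_int: "integrable lborel g"
    unfolding g_def[abs_def]
  proof (rule integrable_bounded_support[where C = "C' * B * 1" and a = "(p, p)" and b = "(q, q)"])
    show "\<bar>\<beta>' (fst z) * v t (snd z) * indicator T z\<bar> \<le> C' * B * 1" for z
      by (intro abs_mult_le bC' v_bound) (simp add: indicator_def)
    show "\<beta>' (fst z) * v t (snd z) * indicator T z = 0" if "z \<notin> cbox (p, p) (q, q)" for z
      using that by (cases z) (auto simp: cbox_Pair_eq indicator_def T_def)
  qed measurable
  have "(\<integral>z. g z \<partial>lborel) = (\<integral>y. (N t q * \<beta>' y - \<beta>' y * N t y) \<partial>lborel)"
  proof -
    have "(\<integral>x. g (y, x) \<partial>lborel) = N t q * \<beta>' y - \<beta>' y * N t y" for y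
    proof (cases "y \<in> {c..d}")
      case False
      then show ?thesis using \<beta>(4)[of y] by (simp add: g_def)
    next
      case y: True
      have "(\<integral>x. g (y, x) \<partial>lborel) = (\<integral>x. \<beta>' y * (v t x * indicator {y<..q} x) \<partial>lborel)"
      proof (rule integral_cong_AE)
        show "(\<lambda>x. g (y, x)) \<in> borel_measurable lborel"
          using measurable_compose[of "\<lambda>x. (y, x)" borel borel g borel] g_int
          by (simp add: borel_measurable_integrable[OF g_int, simplified])
        show "AE x in lborel. g (y, x) = \<beta>' y * (v t x * indicator {y<..q} x)"
          using AE_lborel_singleton[of y]
          by eventually_elim (use y in \<open>auto simp: g_def T_def indicator_def p_def\<close>)
      qed measurable
      also have "\<dots> = \<beta>' y * (N t q - N t y)"
        using N_diff(2)[of y q t] y by (simp add: q_def)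
      finally show ?thesis by (simp add: algebra_simps)
    qed
    then show ?thesis using Fubini_lborel[OF g_int] by simp
  qed
  also have "\<dots> = N t q * (\<integral>y. \<beta>' y \<partial>lborel) - (\<integral>y. \<beta>' y * N t y \<partial>lborel)"
  proof -
    have "integrable lborel \<beta>'"
      using integrable_bounded_support[OF \<beta>'_meas bC', of c d] \<beta>(4) by simp
    moreover have "integrable lborel (\<lambda>y. \<beta>' y * N t y)"
    proof (rule integrable_bounded_support[where C = "C' * (B * (\<bar>c\<bar> + \<bar>d\<bar>))" and a = c and b = d])
      show "\<bar>\<beta>' z * N t z\<bar> \<le> C' * (B * (\<bar>c\<bar> + \<bar>d\<bar>))" for z
      proof (cases "z \<in> {c..d}")
        case z: True
        have "B * \<bar>z\<bar> \<le> B * (\<bar>c\<bar> + \<bar>d\<bar>)" using z FB_nonneg by (intro mult_left_mono) auto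
        then show ?thesis using N_abs[of t z] by (intro abs_mult_le bC') simp
      next
        case False
        then show ?thesis using \<beta>(4)[of z] C' FB_nonneg by simp
      qed
    qed (use \<beta>(4) in auto)
    ultimately show ?thesis by simp
  qed
  also have "(\<integral>y. \<beta>' y \<partial>lborel) = 0"
    by (rule integral_deriv_compact_support[OF \<beta>(1,2)]) (use \<beta>(3,4) in auto)
  finally have 1: "(\<integral>z. g z \<partial>lborel) = - (\<integral>y. \<beta>' y * N t y \<partial>lborel)" by simp
  have "(\<integral>y. g (y, x) \<partial>lborel) = v t x * \<beta> x" for x
  proof (cases "x \<in> {p..q}")
    case True
    have "(\<integral>y. g (y, x) \<partial>lborel) = (\<integral>y. v t x * (\<beta>' y * indicator {p..x} y) \<partial>lborel)"
      using True by (intro Bochner_Integration.integral_cong) (auto simp: g_def T_def indicator_def)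
    also have "\<dots> = v t x * (\<beta> x - \<beta> p)"
      using True \<beta>(1,2) by (simp add: integral_FTC_Icc_real[of p x \<beta> \<beta>'] continuous_on_eq_continuous_at)
    finally show ?thesis using pq by simp
  next
    case False
    then have "\<beta> x = 0" using \<beta>(3) by (auto simp: p_def q_def)
    moreover have "g (y, x) = 0" for y using False by (auto simp: g_def T_def indicator_def)
    ultimately show ?thesis by simp
  qed
  then have "(\<integral>z. g z \<partial>lborel) = (\<integral>x. v t x * \<beta> x \<partial>lborel)"
    using Fubini_lborel_swap[OF g_int] by simp
  then show ?thesis using 1 by simp
qed

text \<open>The weak equation says that \<open>J s t a (a + h)\<close> does not depend on \<open>a\<close>.  Being additive in the
  interval, \<open>J s t a b\<close> is then proportional to \<open>b - a\<close>, at least for lengths \<open>1 / n\<close>; this is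
  what allows \<open>N\<close> to be corrected by a function of time to a potential.\<close>

definition J :: "real \<Rightarrow> real \<Rightarrow> real \<Rightarrow> real \<Rightarrow> real" where
  "J s t a b = (\<integral>y. indicator {a<..b} y * (N t y - N s y) \<partial>lborel)
     + (\<integral>z. indicator ({s<..t} \<times> {a<..b}) z * f (w z) \<partial>lborel)"

text \<open>The test function has a derivative close to the indicator of \<open>{a<..a + h}\<close>
  minus that of \<open>{b<..b + h}\<close>. Both parts have the same mass, so it has compact
  support, and \<open>a <= b\<close> makes it nonnegative.\<close>

lemma J_shift:
  assumes st: "0 < s" "s < t" and ab: "a \<le> b" and h: "0 < h"
  shows "J s t a (a + h) = J s t b (b + h)"
proof -
  note [measurable] = w_meas fw_meas
  \<comment> \<open>\<open>k j\<close> is a trapezoid that tends to the indicator of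
    \<open>{0<..h}\<close>. Its primitive \<open>K j\<close> levels off at exactly \<open>h\<close>
    for every \<open>j\<close>, so two translates cancel far to the right.\<close>
  define k where "k j x = ramp (Suc j * x) - ramp (Suc j * (x - h))" for j :: nat and x :: real
  define K where "K j x = (ramp_int (Suc j * x) - ramp_int (Suc j * (x - h))) / Suc j" for j :: nat and x :: real
  have K_deriv: "(K j has_real_derivative k j x) (at x)" for j x
  proof -
    have "((\<lambda>x. ramp_int (Suc j * x)) has_real_derivative ramp (Suc j * x) * Suc j) (at x)"
      by (rule DERIV_chain2[OF DERIV_ramp_int]) (auto intro!: derivative_eq_intros)
    moreover have "((\<lambda>x. ramp_int (Suc j * (x - h))) has_real_derivative ramp (Suc j * (x - h)) * Suc j) (at x)"
      by (rule DERIV_chain2[OF DERIV_ramp_int]) (auto intro!: derivative_eq_intros)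
    ultimately have "(K j has_real_derivative
        (ramp (Suc j * x) * Suc j - ramp (Suc j * (x - h)) * Suc j) / Suc j) (at x)"
      unfolding K_def[abs_def] by (intro DERIV_cdivide DERIV_diff)
    moreover have "(ramp (Suc j * x) * Suc j - ramp (Suc j * (x - h)) * Suc j) / Suc j = k j x"
      by (simp add: k_def field_simps del: of_nat_Suc)
    ultimately show ?thesis by simp
  qed
  have k_nonneg: "0 \<le> k j x" and k_le: "k j x \<le> 1" for j x
  proof -
    have "real (Suc j) * (x - h) \<le> real (Suc j) * x" using h by (intro mult_left_mono) auto
    then show "0 \<le> k j x" using ramp_mono by (simp add: k_def)
    show "k j x \<le> 1" using ramp_range[of "Suc j * x"] ramp_range[of "Suc j * (x - h)"] by (simp add: k_def)
  qed
  have K_mono: "K j x \<le> K j y" if "x \<le> y" for j x y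
    using DERIV_nonneg_imp_nondecreasing[OF that] K_deriv k_nonneg by blast
  have left: "K j x = 0" "k j x = 0" if "x \<le> 0" for j x
  proof -
    have "real (Suc j) * x \<le> 0" "real (Suc j) * (x - h) \<le> 0"
      using that h by (auto intro!: mult_nonneg_nonpos simp del: of_nat_Suc)
    then show "K j x = 0" "k j x = 0" by (simp_all add: K_def k_def ramp_simps del: of_nat_Suc)
  qed
  have right: "K j x = h" "k j x = 0" if "h + 1 \<le> x" for j x
  proof -
    have "1 * 1 \<le> real (Suc j) * x" "1 * 1 \<le> real (Suc j) * (x - h)"
      using that h by (intro mult_mono; simp)+
    then show "K j x = h" "k j x = 0"
      by (simp_all add: K_def k_def ramp_simps algebra_simps del: of_nat_Suc)
  qed
  have k_cont: "continuous_on UNIV (k j)" for j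
    unfolding k_def[abs_def] ramp_def by (intro continuous_intros)
  have k_meas [measurable]: "k j \<in> borel_measurable borel" for j
    using k_cont borel_measurable_continuous_onI by blast
  have k_lim: "(\<lambda>j. k j (x - r)) \<longlonglongrightarrow> indicator {r<..r + h} x" for x r
  proof -
    have "(\<lambda>j. ramp (Suc j * (x - r)) - ramp (Suc j * (x - (r + h)))) \<longlonglongrightarrow> indicator {r<..} x - indicator {r + h<..} x"
      by (intro tendsto_diff ramp_tendsto ramp_simps)
    moreover have "indicator {r<..} x - indicator {r + h<..} x = (indicator {r<..r + h} x :: real)"
      using h by (auto simp: indicator_def)
    ultimately show ?thesis by (simp add: k_def diff_diff_eq)
  qed
  define \<beta> where "\<beta> j x = K j (x - a) - K j (x - b)" for j x
  define \<beta>' where "\<beta>' j x = k j (x - a) - k j (x - b)" for j x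
  define d where "d = b + h + 1"
  have \<beta>_deriv: "(\<beta> j has_real_derivative \<beta>' j x) (at x)" for j x
    unfolding \<beta>_def[abs_def] \<beta>'_def
    by (intro DERIV_diff DERIV_chain2[OF K_deriv, THEN DERIV_cong]) (auto intro!: derivative_eq_intros)
  have \<beta>'_cont: "continuous_on UNIV (\<beta>' j)" for j
    unfolding \<beta>'_def[abs_def]
    by (intro continuous_on_diff continuous_on_compose2[OF k_cont] continuous_intros) auto
  have \<beta>'_meas [measurable]: "\<beta>' j \<in> borel_measurable borel" for j
    using \<beta>'_cont borel_measurable_continuous_onI by blast
  have \<beta>_nonneg: "0 \<le> \<beta> j x" for j x using ab K_mono by (simp add: \<beta>_def)
  have \<beta>_out: "\<beta> j x = 0" "\<beta>' j x = 0" if "x \<notin> {a..d}" for j x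
    using that ab h left[of "x - a"] left[of "x - b"] right[of "x - a"] right[of "x - b"]
    by (cases "x < a"; simp add: \<beta>_def \<beta>'_def d_def)+
  have \<beta>'_bound: "\<bar>\<beta>' j x\<bar> \<le> 1" for j x
    using k_nonneg[of j "x - a"] k_nonneg[of j "x - b"] k_le[of j "x - a"] k_le[of j "x - b"]
    unfolding \<beta>'_def by linarith
  define i where "i x = (indicator {a<..a + h} x - indicator {b<..b + h} x :: real)" for x
  have \<beta>'_lim: "(\<lambda>j. \<beta>' j x) \<longlonglongrightarrow> i x" for x
    unfolding \<beta>'_def i_def by (intro tendsto_diff k_lim)
  have [measurable]: "i \<in> borel_measurable borel" unfolding i_def[abs_def] by measurable
  define C where "C = 2 * (B * (\<bar>a\<bar> + \<bar>d\<bar>))"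
  have C: "0 \<le> C" using FB_nonneg by (simp add: C_def)
  have Nd: "\<bar>N t x - N s x\<bar> \<le> C" if "x \<in> {a..d}" for x
  proof -
    have "B * \<bar>x\<bar> \<le> B * (\<bar>a\<bar> + \<bar>d\<bar>)" using that FB_nonneg by (intro mult_left_mono) auto
    then show ?thesis using N_abs[of t x] N_abs[of s x] unfolding C_def by linarith
  qed
  have bound1: "\<bar>\<beta>' j x * (N t x - N s x)\<bar> \<le> 1 * C" for j x
  proof (cases "x \<in> {a..d}")
    case True
    then show ?thesis by (intro abs_mult_le \<beta>'_bound Nd)
  qed (use \<beta>_out(2)[of x j] C in simp)
  have int1: "integrable lborel (\<lambda>x. \<beta>' j x * N \<tau> x)" for j \<tau>
  proof (rule integrable_bounded_support[where C = "1 * C" and a = a and b = d])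
    show "\<bar>\<beta>' j x * N \<tau> x\<bar> \<le> 1 * C" for x
    proof (cases "x \<in> {a..d}")
      case True
      then have "B * \<bar>x\<bar> \<le> B * (\<bar>a\<bar> + \<bar>d\<bar>)" using FB_nonneg by (intro mult_left_mono) auto
      then have "\<bar>N \<tau> x\<bar> \<le> C" using N_abs[of \<tau> x] FB_nonneg by (simp add: C_def)
      then show ?thesis by (intro abs_mult_le \<beta>'_bound)
    qed (use \<beta>_out(2)[of x j] C in simp)
  qed (use \<beta>_out(2) in auto)
  have balance: "(\<integral>x. \<beta>' j x * (N t x - N s x) \<partial>lborel)
      + (\<integral>z. indicator {s<..t} (fst z) * (f (w z) * \<beta>' j (snd z)) \<partial>lborel) = 0" for j
  proof -
    have "(\<integral>x. v t x * \<beta> j x \<partial>lborel) - (\<integral>x. v s x * \<beta> j x \<partial>lborel)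
        = (\<integral>z. indicator {s<..t} (fst z) * (f (w z) * \<beta>' j (snd z)) \<partial>lborel)"
      by (rule slices_balance[OF \<beta>_deriv \<beta>'_cont \<beta>_nonneg _ _ st, of a d]) (rule \<beta>_out, assumption)+
    moreover have "(\<integral>x. v \<tau> x * \<beta> j x \<partial>lborel) = - (\<integral>x. \<beta>' j x * N \<tau> x \<partial>lborel)" for \<tau>
      by (rule slice_integration_by_parts[OF \<beta>_deriv \<beta>'_cont, of a d]) (rule \<beta>_out, assumption)+
    moreover have "(\<integral>x. \<beta>' j x * (N t x - N s x) \<partial>lborel)
        = (\<integral>x. \<beta>' j x * N t x \<partial>lborel) - (\<integral>x. \<beta>' j x * N s x \<partial>lborel)"
      using int1 by (simp add: right_diff_distrib)
    ultimately show ?thesis by simp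
  qed
  have lim1: "(\<lambda>j. \<integral>x. \<beta>' j x * (N t x - N s x) \<partial>lborel) \<longlonglongrightarrow> (\<integral>x. i x * (N t x - N s x) \<partial>lborel)"
  proof (rule integral_dominated_convergence[where w = "\<lambda>x. C * indicator {a..d} x"])
    show "integrable lborel (\<lambda>x. C * indicator {a..d} x)"
      using ab h by (intro integrable_mult_right integrable_real_indicator) (simp_all add: d_def)
    show "AE x in lborel. (\<lambda>j. \<beta>' j x * (N t x - N s x)) \<longlonglongrightarrow> i x * (N t x - N s x)"
      by (intro AE_I2 tendsto_mult_right \<beta>'_lim)
    show "AE x in lborel. norm (\<beta>' j x * (N t x - N s x)) \<le> C * indicator {a..d} x" for j
    proof (rule AE_I2)
      fix x show "norm (\<beta>' j x * (N t x - N s x)) \<le> C * indicator {a..d} x"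
        using bound1[of j x] \<beta>_out(2)[of x j] by (cases "x \<in> {a..d}") simp_all
    qed
  qed measurable
  have lim2: "(\<lambda>j. \<integral>z. indicator {s<..t} (fst z) * (f (w z) * \<beta>' j (snd z)) \<partial>lborel)
      \<longlonglongrightarrow> (\<integral>z. indicator {s<..t} (fst z) * (f (w z) * i (snd z)) \<partial>lborel)"
  proof (rule integral_dominated_convergence[where w = "\<lambda>z. F * indicator (cbox (s, a) (t, d)) z"])
    show "integrable lborel (\<lambda>z. F * indicator (cbox (s, a) (t, d)) z)"
      by (intro integrable_mult_right integrable_real_indicator) (auto simp: emeasure_lborel_cbox_eq)
    show "AE z in lborel. (\<lambda>j. indicator {s<..t} (fst z) * (f (w z) * \<beta>' j (snd z)))
        \<longlonglongrightarrow> indicator {s<..t} (fst z) * (f (w z) * i (snd z))"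
      by (intro AE_I2 tendsto_mult_left \<beta>'_lim)
    show "AE z in lborel. norm (indicator {s<..t} (fst z) * (f (w z) * \<beta>' j (snd z)))
        \<le> F * indicator (cbox (s, a) (t, d)) z" for j
    proof (rule AE_I2)
      fix z show "norm (indicator {s<..t} (fst z) * (f (w z) * \<beta>' j (snd z))) \<le> F * indicator (cbox (s, a) (t, d)) z"
      proof (cases "z \<in> cbox (s, a) (t, d)")
        case True
        have "\<bar>indicator {s<..t} (fst z) * (f (w z) * \<beta>' j (snd z))\<bar> \<le> 1 * (F * 1)"
          by (intro abs_mult_le fw_bound \<beta>'_bound) (simp add: indicator_def)
        then show ?thesis using True by simp
      next
        case False
        then have "indicator {s<..t} (fst z) = (0 :: real) \<or> \<beta>' j (snd z) = 0"
          using \<beta>_out(2)[of "snd z" j] by (cases z) (auto simp: cbox_Pair_eq indicator_def)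
        then show ?thesis using False by auto
      qed
    qed
  qed measurable
  have "(\<integral>x. i x * (N t x - N s x) \<partial>lborel) + (\<integral>z. indicator {s<..t} (fst z) * (f (w z) * i (snd z)) \<partial>lborel) = 0"
    using tendsto_add[OF lim1 lim2] unfolding balance by (simp add: LIMSEQ_const_iff)
  moreover have "(\<integral>x. i x * (N t x - N s x) \<partial>lborel)
      = (\<integral>y. indicator {a<..a + h} y * (N t y - N s y) \<partial>lborel) - (\<integral>y. indicator {b<..b + h} y * (N t y - N s y) \<partial>lborel)"
    using integral_Ioc_continuous(1)[of a "a + h" "\<lambda>y. N t y - N s y"]
      integral_Ioc_continuous(1)[of b "b + h" "\<lambda>y. N t y - N s y"]
    by (simp add: i_def left_diff_distrib continuous_on_diff continuous_N)
  moreover have "(\<integral>z. indicator {s<..t} (fst z) * (f (w z) * i (snd z)) \<partial>lborel)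
      = (\<integral>z. indicator ({s<..t} \<times> {a<..a + h}) z * f (w z) \<partial>lborel)
        - (\<integral>z. indicator ({s<..t} \<times> {b<..b + h}) z * f (w z) \<partial>lborel)"
  proof -
    have "(\<integral>z. indicator {s<..t} (fst z) * (f (w z) * i (snd z)) \<partial>lborel)
      = (\<integral>z. indicator ({s<..t} \<times> {a<..a + h}) z * f (w z)
          - indicator ({s<..t} \<times> {b<..b + h}) z * f (w z) \<partial>lborel)"
      by (intro Bochner_Integration.integral_cong) (auto simp: i_def indicator_times algebra_simps)
    then show ?thesis using integral_box_bounded(1)[OF fw_meas fw_bound] by simp
  qed
  ultimately show ?thesis by (simp add: J_def)
qed

lemma J_add:
  assumes "a \<le> b" "b \<le> c"
  shows "J s t a c = J s t a b + J s t b c"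
proof -
  have i1: "integrable lborel (\<lambda>y. indicator {a<..b} y * (N t y - N s y))" for a b
    by (intro integral_Ioc_continuous(1) continuous_on_diff continuous_N)
  have i2: "integrable lborel (\<lambda>z. indicator ({s<..t} \<times> {a<..b}) z * f (w z))" for a b
    by (rule integral_box_bounded(1)[OF fw_meas fw_bound])
  have "(\<integral>y. indicator {a<..c} y * (N t y - N s y) \<partial>lborel)
      = (\<integral>y. indicator {a<..b} y * (N t y - N s y) + indicator {b<..c} y * (N t y - N s y) \<partial>lborel)"
    using assms by (intro Bochner_Integration.integral_cong) (auto simp: indicator_def)
  moreover have "(\<integral>z. indicator ({s<..t} \<times> {a<..c}) z * f (w z) \<partial>lborel)
      = (\<integral>z. indicator ({s<..t} \<times> {a<..b}) z * f (w z) + indicator ({s<..t} \<times> {b<..c}) z * f (w z) \<partial>lborel)"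
    using assms by (intro Bochner_Integration.integral_cong) (auto simp: indicator_def)
  ultimately show ?thesis using i1 i2 by (simp add: J_def)
qed

lemma J_unit:
  assumes st: "0 < s" "s < t"
  shows "J s t 0 1 = Suc n * J s t x (x + 1 / Suc n)"
proof -
  define h where "h = 1 / real (Suc n)"
  have h: "0 < h" by (simp add: h_def)
  have shift: "J s t y (y + h) = J s t x (x + h)" for y
  proof (cases "x \<le> y")
    case True
    then show ?thesis using J_shift[OF st _ h] by metis
  next
    case False
    show ?thesis by (rule J_shift[OF st _ h]) (use False in simp)
  qed
  have "J s t 0 (real k * h) = real k * J s t x (x + h)" for k
  proof (induction k)
    case 0
    show ?case using J_add[of 0 0 0 s t] by simp
  next
    case (Suc k)
    have "J s t 0 (real (Suc k) * h) = J s t 0 (real k * h) + J s t (real k * h) (real (Suc k) * h)"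
      using h by (intro J_add mult_right_mono) auto
    moreover have "real (Suc k) * h = real k * h + h" by (simp add: algebra_simps)
    ultimately have "J s t 0 (real (Suc k) * h) = J s t 0 (real k * h) + J s t (real k * h) (real k * h + h)"
      by simp
    then show ?case unfolding Suc.IH shift[of "real k * h"] by (simp add: algebra_simps)
  qed
  from this[of "Suc n"] show ?thesis by (simp add: h_def del: of_nat_Suc)
qed

section \<open>Correction in time and the potential up to time 0\<close>

text \<open>The correction for which the integral of \<open>U t\<close> over \<open>{0<..1}\<close>
  equals minus the integral of \<open>f(w)\<close> over \<open>{0<..t} \<times> {0<..1}\<close>: the
  balance over boxes above the unit interval holds by construction.\<close>

definition offset :: "real \<Rightarrow> real" where
  "offset t = - ((\<integral>y. indicator {0<..1} y * N t y \<partial>lborel)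
     + (\<integral>z. indicator ({0<..t} \<times> {0<..1}) z * f (w z) \<partial>lborel))"

definition U :: "real \<Rightarrow> real \<Rightarrow> real" where
  "U t x = N t x + offset t"

lemma U_diff: "U t y - U t x = N t y - N t x"
  by (simp add: U_def)

lemma offset_diff:
  assumes "0 \<le> s" "s \<le> t"
  shows "offset t - offset s = - J s t 0 1"
proof -
  have i1: "integrable lborel (\<lambda>y. indicator {0<..1} y * N t y)" for t
    by (intro integral_Ioc_continuous(1) continuous_N)
  have i2: "integrable lborel (\<lambda>z. indicator ({s<..t} \<times> {a<..b}) z * f (w z))" for a b s t
    by (rule integral_box_bounded(1)[OF fw_meas fw_bound])
  have "(\<integral>z. indicator ({0<..t} \<times> {0<..1}) z * f (w z) \<partial>lborel)
      = (\<integral>z. indicator ({0<..s} \<times> {0<..1}) z * f (w z) + indicator ({s<..t} \<times> {0<..1}) z * f (w z) \<partial>lborel)"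
    using assms by (intro Bochner_Integration.integral_cong) (auto simp: indicator_def)
  then show ?thesis using i1 i2 by (simp add: offset_def J_def right_diff_distrib)
qed

text \<open>\<open>offset_diff\<close> makes the balance exact above the unit interval, and
  \<open>J_unit\<close> distributes it in equal shares to all intervals of length
  \<open>1 / Suc n\<close>.\<close>

lemma U_box_pos:
  assumes st: "0 < s" "s < t"
  shows "(\<integral>y. indicator {x<..x + 1 / Suc n} y * (U t y - U s y) \<partial>lborel)
    = - (\<integral>z. indicator ({s<..t} \<times> {x<..x + 1 / Suc n}) z * f (w z) \<partial>lborel)"
proof -
  define h where "h = 1 / real (Suc n)"
  have h: "0 < h" by (simp add: h_def)
  have i: "integrable lborel (\<lambda>y. indicator {x<..x + h} y * (N t y - N s y))"
    by (intro integral_Ioc_continuous(1) continuous_on_diff continuous_N)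
  have "(\<integral>y. indicator {x<..x + h} y * (U t y - U s y) \<partial>lborel)
      = (\<integral>y. indicator {x<..x + h} y * (N t y - N s y) + (offset t - offset s) * indicator {x<..x + h} y \<partial>lborel)"
    by (intro Bochner_Integration.integral_cong) (auto simp: U_def algebra_simps)
  also have "\<dots> = (\<integral>y. indicator {x<..x + h} y * (N t y - N s y) \<partial>lborel) + (offset t - offset s) * h"
    using i h by simp
  also have "(offset t - offset s) * h = - J s t x (x + h)"
    using offset_diff[of s t] st J_unit[OF st, of n x] by (simp add: h_def del: of_nat_Suc)
  finally show ?thesis by (simp add: J_def h_def)
qed

lemma box_integral_bound:
  assumes "s \<le> t" "x \<le> y"
  shows "\<bar>\<integral>z. indicator ({s<..t} \<times> {x<..y}) z * f (w z) \<partial>lborel\<bar> \<le> F * ((t - s) * (y - x))"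
proof -
  have "\<bar>integral (cbox (s, x) (t, y)) (\<lambda>z. f (w z))\<bar> \<le> F * measure lborel (cbox (s, x) (t, y))"
    using has_integral_bound[of F "\<lambda>z. f (w z)" _ "(s, x)" "(t, y)"]
      integrable_integral[OF integrable_on_cbox_bounded_borel(2)[OF fw_meas fw_bound]] fw_bound FB_nonneg
    by fastforce
  then show ?thesis using assms
    by (simp add: integral_box_bounded(2)[OF fw_meas fw_bound] content_Pair)
qed

text \<open>The average over width \<open>h\<close> changes by at most \<open>F * (t - s)\<close>,
  and replacing it by a point value costs \<open>2 * B * h\<close>, which vanishes along
  \<open>h = 1 / Suc n\<close>.\<close>

lemma U_lip_time_pos:
  assumes st: "0 < s" "s < t"
  shows "\<bar>U t x - U s x\<bar> \<le> F * (t - s)"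
proof -
  have *: "\<bar>U t x - U s x\<bar> \<le> F * (t - s) + 2 * B * (1 / Suc n)" for n
  proof -
    define h where "h = 1 / real (Suc n)"
    have h: "0 < h" by (simp add: h_def)
    have cont: "continuous_on S (\<lambda>y. U t y - U s y)" for S
      unfolding U_def by (intro continuous_intros continuous_N)
    have "\<bar>integral {0..h} (\<lambda>y. U t (x + y) - U s (x + y)) - (U t x - U s x) * h\<bar> \<le> (2 * B * h) * h"
    proof (rule integral_average_bound[OF _ h])
      show "continuous_on {0..h} (\<lambda>y. U t (x + y) - U s (x + y))"
        by (intro continuous_on_compose2[OF cont[of UNIV]] continuous_intros) auto
      fix y assume y: "y \<in> {0..h}"
      have "B * y \<le> B * h" using y FB_nonneg by (intro mult_left_mono) auto
      then show "\<bar>U t (x + y) - U s (x + y) - (U t x - U s x)\<bar> \<le> 2 * B * h"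
        using N_lip[of t "x + y" x] N_lip[of s "x + y" x] y by (simp add: U_def)
    qed
    moreover have "integral {0..h} (\<lambda>y. U t (x + y) - U s (x + y)) = integral {x..x + h} (\<lambda>y. U t y - U s y)"
      using integral_shift_Icc_real[of 0 h "\<lambda>y. U t y - U s y" x] by (simp add: comp_def add.commute)
    moreover have "integral {x..x + h} (\<lambda>y. U t y - U s y)
        = - (\<integral>z. indicator ({s<..t} \<times> {x<..x + h}) z * f (w z) \<partial>lborel)"
      using U_box_pos[OF st, of x n] integral_Ioc_continuous(2)[OF cont, of x "x + h"] by (simp add: h_def)
    moreover have "\<bar>\<integral>z. indicator ({s<..t} \<times> {x<..x + h}) z * f (w z) \<partial>lborel\<bar> \<le> F * ((t - s) * h)"
      using box_integral_bound[of s t x "x + h"] st h by simp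
    ultimately have "\<bar>(U t x - U s x) * h\<bar> \<le> (F * (t - s) + 2 * B * h) * h"
      by (simp add: algebra_simps)
    then show ?thesis using h by (simp add: abs_mult h_def[symmetric] del: of_nat_Suc)
  qed
  have "(\<lambda>n. F * (t - s) + 2 * B * (1 / real (Suc n))) \<longlonglongrightarrow> F * (t - s) + 2 * B * 0"
    by (intro tendsto_intros LIMSEQ_Suc[OF lim_1_over_n])
  then show ?thesis using LIMSEQ_le_const[of _ "F * (t - s) + 2 * B * 0" "\<bar>U t x - U s x\<bar>"] * by auto
qed

lemma eventually_small: "0 < t \<Longrightarrow> \<forall>\<^sub>F j in sequentially. 1 / real (Suc j) < t"
  using order_tendstoD(2)[OF LIMSEQ_Suc[OF lim_1_over_n]] by auto

lemma N_at_0: "(\<lambda>j. N (1 / Suc j) x) \<longlonglongrightarrow> N 0 x"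
proof -
  have "((\<lambda>\<tau>. N \<tau> x) \<longlongrightarrow> N 0 x) (at 0 within {0..})"
    unfolding N_def
    by (rule slice_moment_tendsto[OF N_weight(1,2), of "- \<bar>x\<bar>" "\<bar>x\<bar>"])
      (rule N_weight(3), assumption, rule order_refl)
  moreover have "filterlim (\<lambda>j. 1 / real (Suc j)) (at 0 within {0..}) sequentially"
    using LIMSEQ_Suc[OF lim_1_over_n] by (auto simp: filterlim_at)
  ultimately show ?thesis by (rule filterlim_compose)
qed

lemma box_integral_at_0:
  "(\<lambda>j. \<integral>z. indicator ({1 / Suc j<..t} \<times> {a<..b}) z * f (w z) \<partial>lborel)
     \<longlonglongrightarrow> (\<integral>z. indicator ({0<..t} \<times> {a<..b}) z * f (w z) \<partial>lborel)"
proof (rule integral_dominated_convergence[where w = "\<lambda>z. F * indicator (cbox (0, a) (t, b)) z"])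
  show "integrable lborel (\<lambda>z. F * indicator (cbox (0, a) (t, b)) z)"
    by (intro integrable_mult_right integrable_real_indicator) (auto simp: emeasure_lborel_cbox_eq)
  show "AE z in lborel. (\<lambda>j. indicator ({1 / real (Suc j)<..t} \<times> {a<..b}) z * f (w z))
      \<longlonglongrightarrow> indicator ({0<..t} \<times> {a<..b}) z * f (w z)"
  proof (rule AE_I2, rule tendsto_mult_right)
    fix z :: "real \<times> real"
    show "(\<lambda>j. indicator ({1 / real (Suc j)<..t} \<times> {a<..b}) z :: real) \<longlonglongrightarrow> indicator ({0<..t} \<times> {a<..b}) z"
    proof (cases "0 < fst z")
      case True
      from eventually_small[OF this] have "\<forall>\<^sub>F j in sequentially. indicator ({1 / real (Suc j)<..t} \<times> {a<..b}) z
          = (indicator ({0<..t} \<times> {a<..b}) z :: real)"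
        by eventually_elim (use True in \<open>auto simp: indicator_def\<close>)
      then show ?thesis by (rule tendsto_eventually)
    next
      case False
      then have "z \<notin> {1 / real (Suc j)<..t} \<times> {a<..b}" for j
        by (cases z) (auto dest: order_less_trans[rotated] simp: not_less intro: order.trans)
      then show ?thesis using False by (auto simp: indicator_def)
    qed
  qed
  show "AE z in lborel. norm (indicator ({1 / real (Suc j)<..t} \<times> {a<..b}) z * f (w z))
      \<le> F * indicator (cbox (0, a) (t, b)) z" for j
  proof (rule AE_I2)
    fix z show "norm (indicator ({1 / real (Suc j)<..t} \<times> {a<..b}) z * f (w z)) \<le> F * indicator (cbox (0, a) (t, b)) z"
    proof (cases "z \<in> {1 / real (Suc j)<..t} \<times> {a<..b}")
      case True
      then have "1 / real (Suc j) < fst z" by (cases z) simp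
      moreover have "0 \<le> 1 / real (Suc j)" by simp
      ultimately have "0 \<le> fst z" by linarith
      then have "z \<in> cbox (0, a) (t, b)" using True by (cases z) (simp add: cbox_Pair_eq)
      then show ?thesis using fw_bound[of z] True by simp
    qed (use FB_nonneg in simp)
  qed
qed (use borel_measurable_integrable[OF integral_box_bounded(1)[OF fw_meas fw_bound]] in auto)

text \<open>The weak equation says nothing at time 0 itself. The initial datum enters through
  continuity of the slices at 0, which passes to \<open>N\<close> and, by dominated convergence, to
  \<open>offset\<close>.\<close>

lemma U_at_0: "(\<lambda>j. U (1 / Suc j) x) \<longlonglongrightarrow> U 0 x"
proof -
  have "(\<lambda>j. \<integral>y. indicator {0<..1} y * N (1 / Suc j) y \<partial>lborel) \<longlonglongrightarrow> (\<integral>y. indicator {0<..1} y * N 0 y \<partial>lborel)"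
  proof (rule integral_dominated_convergence[where w = "\<lambda>y. B * indicator {0<..1} y"])
    show "AE y in lborel. (\<lambda>j. indicator {0<..1} y * N (1 / Suc j) y) \<longlonglongrightarrow> indicator {0<..1} y * N 0 y"
      by (intro AE_I2 tendsto_mult_left N_at_0)
    show "AE y in lborel. norm (indicator {0<..1} y * N (1 / Suc j) y) \<le> B * indicator {0<..1} y" for j
    proof (rule AE_I2)
      fix y :: real
      have "B * \<bar>y\<bar> \<le> B * 1" if "y \<in> {0<..1}" using that FB_nonneg by (intro mult_left_mono) auto
      then show "norm (indicator {0<..1} y * N (1 / Suc j) y) \<le> B * indicator {0<..1} y"
        using N_abs[of "1 / Suc j" y] by (cases "y \<in> {0<..1}") auto
    qed
  qed simp_all
  moreover have "(\<lambda>j. \<integral>z. indicator ({0<..1 / Suc j} \<times> {0<..1}) z * f (w z) \<partial>lborel) \<longlonglongrightarrow> 0"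
  proof (rule Lim_null_comparison)
    show "\<forall>\<^sub>F j in sequentially. norm (\<integral>z. indicator ({0<..1 / Suc j} \<times> {0<..1}) z * f (w z) \<partial>lborel)
        \<le> F * (1 / Suc j)"
    proof (intro always_eventually allI)
      fix j show "norm (\<integral>z. indicator ({0<..1 / Suc j} \<times> {0<..1}) z * f (w z) \<partial>lborel) \<le> F * (1 / Suc j)"
        using box_integral_bound[of 0 "1 / Suc j" 0 1] by simp
    qed
    show "(\<lambda>j. F * (1 / Suc j)) \<longlonglongrightarrow> 0"
      using tendsto_mult_right_zero[OF LIMSEQ_Suc[OF lim_1_over_n]] by auto
  qed
  ultimately have "(\<lambda>j. N (1 / Suc j) x + - ((\<integral>y. indicator {0<..1} y * N (1 / Suc j) y \<partial>lborel)
      + (\<integral>z. indicator ({0<..1 / Suc j} \<times> {0<..1}) z * f (w z) \<partial>lborel)))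
      \<longlonglongrightarrow> N 0 x + - ((\<integral>y. indicator {0<..1} y * N 0 y \<partial>lborel) + 0)"
    by (intro tendsto_intros N_at_0)
  then show ?thesis by (simp add: U_def offset_def)
qed

lemma U_lip_time:
  assumes "0 \<le> s" "s \<le> t"
  shows "\<bar>U t x - U s x\<bar> \<le> F * (t - s)"
proof (cases "s = t")
  case False
  show ?thesis
  proof (cases "s = 0")
    case True
    have "(\<lambda>j. \<bar>U t x - U (1 / Suc j) x\<bar>) \<longlonglongrightarrow> \<bar>U t x - U 0 x\<bar>"
      by (intro tendsto_intros U_at_0)
    moreover have "\<forall>\<^sub>F j in sequentially. \<bar>U t x - U (1 / Suc j) x\<bar> \<le> F * t"
    proof -
      have "0 < t" using True False assms by simp
      from eventually_small[OF this] show ?thesis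
      proof eventually_elim
        case (elim j)
        have "\<bar>U t x - U (1 / Suc j) x\<bar> \<le> F * (t - 1 / Suc j)"
          using elim by (intro U_lip_time_pos) auto
        also have "\<dots> \<le> F * t" using FB_nonneg by (intro mult_left_mono) auto
        finally show ?case .
      qed
    qed
    ultimately show ?thesis using True by (auto intro: tendsto_upperbound)
  qed (use U_lip_time_pos[of s t x] assms False in auto)
qed simp

lemma U_lip:
  assumes "0 \<le> s" "0 \<le> t"
  shows "\<bar>U t x - U s y\<bar> \<le> F * \<bar>t - s\<bar> + B * \<bar>x - y\<bar>"
proof -
  have "\<bar>U t x - U s x\<bar> \<le> F * \<bar>t - s\<bar>"
    using U_lip_time[of s t x] U_lip_time[of t s x] assms by (cases "s \<le> t") (auto simp: abs_minus_commute)
  moreover have "\<bar>U s x - U s y\<bar> \<le> B * \<bar>x - y\<bar>" using N_lip[of s x y] by (simp add: U_def)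
  ultimately show ?thesis by linarith
qed

lemma continuous_U_diff: "continuous_on S (\<lambda>y. U t y - U s y)"
  unfolding U_def by (intro continuous_intros continuous_N)

lemma U_box_t:
  assumes "0 \<le> s" "s \<le> t"
  shows "integral {x..x + 1 / Suc n} (\<lambda>y. U t y - U s y)
    = - integral (cbox (s, x) (t, x + 1 / Suc n)) (\<lambda>z. f (w z))"
proof -
  define h where "h = 1 / real (Suc n)"
  have h: "0 < h" by (simp add: h_def)
  have "(\<integral>y. indicator {x<..x + h} y * (U t y - U s y) \<partial>lborel)
    = - (\<integral>z. indicator ({s<..t} \<times> {x<..x + h}) z * f (w z) \<partial>lborel)"
  proof (cases "s = t \<or> 0 < s")
    case True
    then show ?thesis using U_box_pos[of s t x n] assms by (cases "s = t") (auto simp: h_def)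
  next
    case False
    \<comment> \<open>For \<open>s = 0\<close> the identity is taken at \<open>1 / Suc j\<close>,
      where the weak equation is available, and passed to the limit.\<close>
    then have s: "s = 0" "0 < t" using assms by auto
    have "(\<lambda>j. \<integral>y. indicator {x<..x + h} y * (U t y - U (1 / Suc j) y) \<partial>lborel)
        \<longlonglongrightarrow> (\<integral>y. indicator {x<..x + h} y * (U t y - U 0 y) \<partial>lborel)"
    proof (rule integral_dominated_convergence[where w = "\<lambda>y. F * (t + 1) * indicator {x<..x + h} y"])
      show "AE y in lborel. (\<lambda>j. indicator {x<..x + h} y * (U t y - U (1 / Suc j) y))
          \<longlonglongrightarrow> indicator {x<..x + h} y * (U t y - U 0 y)"
        by (intro AE_I2 tendsto_intros U_at_0)
      show "AE y in lborel. norm (indicator {x<..x + h} y * (U t y - U (1 / Suc j) y))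
          \<le> F * (t + 1) * indicator {x<..x + h} y" for j
      proof (rule AE_I2)
        fix y :: real
        have "\<bar>t - 1 / Suc j\<bar> \<le> t + 1" using s by (auto simp: abs_le_iff field_simps)
        then have "F * \<bar>t - 1 / Suc j\<bar> \<le> F * (t + 1)" using FB_nonneg by (intro mult_left_mono) auto
        then have "\<bar>U t y - U (1 / Suc j) y\<bar> \<le> F * (t + 1)"
          using U_lip[of "1 / Suc j" t y y] s by simp
        then show "norm (indicator {x<..x + h} y * (U t y - U (1 / Suc j) y)) \<le> F * (t + 1) * indicator {x<..x + h} y"
          by (simp add: indicator_def)
      qed
      show "integrable lborel (\<lambda>y. F * (t + 1) * indicator {x<..x + h} y)"
        using h by (intro integrable_mult_right integrable_real_indicator) simp_all
    qed (use borel_measurable_integrable[OF integral_Ioc_continuous(1)[OF continuous_U_diff]] in auto)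
    moreover have "\<forall>\<^sub>F j in sequentially. (\<integral>y. indicator {x<..x + h} y * (U t y - U (1 / Suc j) y) \<partial>lborel)
        = - (\<integral>z. indicator ({1 / Suc j<..t} \<times> {x<..x + h}) z * f (w z) \<partial>lborel)"
      using eventually_small[OF s(2)] by eventually_elim (unfold h_def, rule U_box_pos, auto)
    ultimately have "(\<lambda>j. - (\<integral>z. indicator ({1 / Suc j<..t} \<times> {x<..x + h}) z * f (w z) \<partial>lborel))
        \<longlonglongrightarrow> (\<integral>y. indicator {x<..x + h} y * (U t y - U 0 y) \<partial>lborel)"
      by (rule Lim_transform_eventually)
    then show ?thesis unfolding s
      using tendsto_minus[OF box_integral_at_0] LIMSEQ_unique by blast
  qed
  then show ?thesis
    by (simp add: integral_Ioc_continuous(2)[OF continuous_U_diff] integral_box_bounded(2)[OF fw_meas fw_bound] h_def)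
qed

text \<open>For almost every time the slice of \<open>w\<close> agrees with \<open>v\<close>, and in
  a spatial increment of \<open>U\<close> the correction in time cancels; the rest is
  Fubini.\<close>

lemma U_box_x:
  assumes st: "0 \<le> s" "s \<le> t" and xy: "x \<le> y"
  shows "integral {s..t} (\<lambda>\<tau>. U \<tau> y - U \<tau> x) = integral (cbox (s, x) (t, y)) w"
proof -
  note [measurable] = w_meas
  have cont: "continuous_on {s..t} (\<lambda>\<tau>. U \<tau> y - U \<tau> x)"
  proof -
    have "F-lipschitz_on {s..t} (\<lambda>\<tau>. U \<tau> z)" for z
      using U_lip[of _ _ z z] st FB_nonneg by (intro lipschitz_onI) (auto simp: dist_real_def)
    then show ?thesis by (intro continuous_on_diff lipschitz_on_continuous_on)
  qed
  define g where "g z = indicator ({s<..t} \<times> {x<..y}) z * w z" for z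
  have g_int: "integrable lborel g"
    unfolding g_def[abs_def] by (rule integral_box_bounded(1)[OF w_meas w_bound])
  have "integral (cbox (s, x) (t, y)) w = (\<integral>\<tau>. (\<integral>\<xi>. g (\<tau>, \<xi>) \<partial>lborel) \<partial>lborel)"
    using Fubini_lborel[OF g_int] integral_box_bounded(2)[OF w_meas w_bound, of s t x y]
    by (simp add: g_def)
  also have "\<dots> = (\<integral>\<tau>. indicator {s<..t} \<tau> * (U \<tau> y - U \<tau> x) \<partial>lborel)"
  proof (rule integral_cong_AE)
    show "(\<lambda>\<tau>. \<integral>\<xi>. g (\<tau>, \<xi>) \<partial>lborel) \<in> borel_measurable lborel"
      using borel_measurable_integral_slice[of g] borel_measurable_integrable[OF g_int] by simp
    show "(\<lambda>\<tau>. indicator {s<..t} \<tau> * (U \<tau> y - U \<tau> x)) \<in> borel_measurable lborel"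
      using borel_measurable_integrable[OF integral_Ioc_continuous(1)[OF cont]] .
    show "AE \<tau> in lborel. (\<integral>\<xi>. g (\<tau>, \<xi>) \<partial>lborel) = indicator {s<..t} \<tau> * (U \<tau> y - U \<tau> x)"
      using v_w
    proof eventually_elim
      case (elim \<tau>)
      show ?case
      proof (cases "\<tau> \<in> {s<..t}")
        case False
        then have "g (\<tau>, \<xi>) = 0" for \<xi> by (auto simp: g_def indicator_def)
        then show ?thesis using False by simp
      next
        case True
        then have ae: "AE \<xi> in lborel. v \<tau> \<xi> = w (\<tau>, \<xi>)" using elim st by simp
        have [measurable]: "(\<lambda>\<xi>. w (\<tau>, \<xi>)) \<in> borel_measurable borel"
          using measurable_compose[of "\<lambda>x. (\<tau>, x)" borel borel, OF _ w_meas] by measurable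
        have "(\<integral>\<xi>. g (\<tau>, \<xi>) \<partial>lborel) = (\<integral>\<xi>. w (\<tau>, \<xi>) * indicator {x<..y} \<xi> \<partial>lborel)"
          using True by (intro Bochner_Integration.integral_cong) (auto simp: g_def indicator_def)
        also have "\<dots> = (\<integral>\<xi>. v \<tau> \<xi> * indicator {x<..y} \<xi> \<partial>lborel)"
        proof (rule integral_cong_AE)
          show "(\<lambda>\<xi>. v \<tau> \<xi> * indicator {x<..y} \<xi>) \<in> borel_measurable lborel"
            using v_meas[of \<tau>] by measurable
          show "AE \<xi> in lborel. w (\<tau>, \<xi>) * indicator {x<..y} \<xi> = v \<tau> \<xi> * indicator {x<..y} \<xi>"
            using ae by eventually_elim simp
        qed measurable
        also have "\<dots> = U \<tau> y - U \<tau> x" using N_diff(2)[OF xy, of \<tau>] by (simp add: U_diff)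
        finally show ?thesis using True by simp
      qed
    qed
  qed
  finally show ?thesis by (simp add: integral_Ioc_continuous(2)[OF cont])
qed

lemma entropy_potential: "entropy_potential f w B F U"
  by unfold_locales
    (fact cont_f w_meas w_bound f_bound entropy U_lip U_box_x U_box_t)+

lemma U_increment: "x \<le> y \<Longrightarrow> U t y - U t x = integral {x..y} (v t)"
  by (simp add: U_diff N_diff(1))

end

section \<open>Borel versions of an entropy solution\<close>

definition clamp :: "real \<Rightarrow> real \<Rightarrow> real" where
  "clamp c y = max (- c) (min c y)"

lemma abs_clamp: "0 \<le> c \<Longrightarrow> \<bar>clamp c y\<bar> \<le> c"
  by (auto simp: clamp_def)

lemma clamp_eq: "\<bar>y\<bar> \<le> c \<Longrightarrow> clamp c y = y"
  by (auto simp: clamp_def abs_le_iff)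

text \<open>So \<open>|y - clamp c y|\<close> measures how far \<open>y\<close> exceeds the bound
  \<open>c\<close>, and any admissible \<open>z\<close> controls it by its distance to
  \<open>y\<close>.\<close>

lemma clamp_nearest: "\<bar>z\<bar> \<le> c \<Longrightarrow> \<bar>y - clamp c y\<bar> \<le> \<bar>y - z\<bar>"
  by (auto simp: clamp_def abs_le_iff max_def min_def)

lemma borel_measurable_clamp [measurable (raw)]:
  "g \<in> borel_measurable M \<Longrightarrow> (\<lambda>x. clamp c (g x)) \<in> borel_measurable M"
  unfolding clamp_def by (intro borel_measurable_max borel_measurable_min borel_measurable_const)

lemma ex_borel_version:
  fixes g :: "'a::euclidean_space \<Rightarrow> real"
  assumes "g \<in> borel_measurable lebesgue" "AE x in lebesgue. \<bar>g x\<bar> \<le> c" "0 \<le> c"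
  obtains h where "h \<in> borel_measurable borel" "\<And>x. \<bar>h x\<bar> \<le> c" "AE x in lebesgue. h x = g x"
proof -
  obtain g' where g': "g' \<in> borel_measurable lborel" "AE x in lborel. g x = g' x"
    using completion_ex_borel_measurable_real[OF assms(1)] by blast
  show ?thesis
  proof (rule that[of "\<lambda>x. clamp c (g' x)"])
    show "(\<lambda>x. clamp c (g' x)) \<in> borel_measurable borel"
      using borel_measurable_clamp[OF g'(1)] by simp
    show "\<bar>clamp c (g' x)\<bar> \<le> c" for x using assms(3) by (rule abs_clamp)
    have "AE x in lebesgue. g x = g' x" using g'(2) by (rule AE_completion)
    then show "AE x in lebesgue. clamp c (g' x) = g x"
      using assms(2) by eventually_elim (metis clamp_eq)
  qed
qed

lemma set_integrable_imp_borel_measurable: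
  fixes g :: "real \<Rightarrow> real"
  assumes "\<And>r. 0 < r \<Longrightarrow> set_integrable lebesgue {-r..r} g"
  shows "g \<in> borel_measurable lebesgue"
proof (rule borel_measurable_LIMSEQ_real)
  show "(\<lambda>x. indicator {- real (Suc n)..real (Suc n)} x *\<^sub>R g x) \<in> borel_measurable lebesgue" for n
    using assms[of "real (Suc n)"] unfolding set_integrable_def by (intro borel_measurable_integrable) auto
  show "(\<lambda>n. indicator {- real (Suc n)..real (Suc n)} x *\<^sub>R g x) \<longlonglongrightarrow> g x" for x
  proof (rule tendsto_eventually)
    obtain n0 :: nat where n0: "\<bar>x\<bar> \<le> real n0" using real_arch_simple by blast
    have "indicator {- real (Suc n)..real (Suc n)} x *\<^sub>R g x = g x" if "n0 \<le> n" for n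
    proof -
      have "\<bar>x\<bar> \<le> real (Suc n)" using n0 that by linarith
      then show ?thesis by (simp add: indicator_def abs_le_iff del: of_nat_Suc)
    qed
    then show "\<forall>\<^sub>F n in sequentially. indicator {- real (Suc n)..real (Suc n)} x *\<^sub>R g x = g x"
      using eventually_sequentially by blast
  qed
qed

text \<open>The complement of the compact support is an open neighbourhood of \<open>z\<close> on
  which \<open>\<phi>\<close> is 0. Thanks to this the entropy integral over the half-plane may be
  extended to the plane, whatever \<open>w\<close> is there.\<close>

lemma test_function_derivative_outside:
  assumes "test_function \<phi> \<phi>t \<phi>x" "z \<notin> half_plane"
  shows "\<phi>t z = 0" "\<phi>x z = 0"
proof -
  obtain S where S: "compact S" "S \<subseteq> half_plane" "\<forall>z. z \<notin> S \<longrightarrow> \<phi> z = 0"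
    and deriv: "(\<phi> has_derivative (\<lambda>h. \<phi>t z * fst h + \<phi>x z * snd h)) (at z)"
    using assms(1) unfolding test_function_def by blast
  have "(\<phi> has_derivative (\<lambda>h. 0)) (at z)"
  proof (rule has_derivative_transform_within_open)
    show "((\<lambda>_. 0) has_derivative (\<lambda>h. 0)) (at z)" by simp
    show "open (- S)" using S(1) compact_imp_closed by blast
    show "z \<in> - S" using S(2) assms(2) by blast
    show "0 = \<phi> y" if "y \<in> - S" for y using S(3) that by (metis ComplD)
  qed
  then have "(\<lambda>h. \<phi>t z * fst h + \<phi>x z * snd h) = (\<lambda>h. 0)"
    using deriv has_derivative_unique by blast
  from fun_cong[OF this, of "(1, 0)"] fun_cong[OF this, of "(0, 1)"]
  show "\<phi>t z = 0" "\<phi>x z = 0" by simp_all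
qed

lemma AE_ex_in_interval:
  fixes a b :: real
  assumes "AE t in lborel. P t" "a < b"
  obtains t where "a < t" "t < b" "P t"
proof -
  have "\<exists>t\<in>{a<..<b}. P t"
  proof (rule ccontr)
    assume "\<not> ?thesis"
    then have "AE t in lborel. t \<notin> {a<..<b}" using assms(1) by (auto elim: eventually_mono)
    then have "{a<..<b} \<in> null_sets lborel"
      by (subst AE_iff_null_sets) auto
    then show False using assms(2) by (simp add: null_sets_def)
  qed
  then show ?thesis using that by auto
qed

lemma ex_joint_borel_version:
  assumes "entropy_solution f u0 u"
  obtains B w where "0 \<le> B" "w \<in> borel_measurable borel" "\<And>z. \<bar>w z\<bar> \<le> B"
    "AE z in lebesgue. z \<in> half_plane \<longrightarrow> u (fst z) (snd z) = w z"
proof -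
  define uu where "uu z = indicator half_plane z *\<^sub>R u (fst z) (snd z)" for z
  have half: "half_plane \<in> sets lebesgue"
  proof -
    have "open half_plane" unfolding half_plane_def by (intro open_Times) auto
    then show ?thesis by (auto intro: borel_open)
  qed
  obtain B where B: "AE z in lebesgue_on half_plane. \<bar>u (fst z) (snd z)\<bar> \<le> B"
    and meas: "(\<lambda>z. u (fst z) (snd z)) \<in> borel_measurable (lebesgue_on half_plane)"
    using assms unfolding entropy_solution_def by blast
  have uu: "uu \<in> borel_measurable lebesgue"
    using meas half unfolding uu_def[abs_def] by (subst (asm) borel_measurable_restrict_space_iff) auto
  have "AE z in lebesgue. z \<in> half_plane \<longrightarrow> \<bar>u (fst z) (snd z)\<bar> \<le> B"
    using B half by (subst (asm) AE_restrict_space_iff) auto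
  then have "AE z in lebesgue. \<bar>uu z\<bar> \<le> \<bar>B\<bar>"
    by eventually_elim (auto simp: uu_def indicator_def)
  then obtain w where w: "w \<in> borel_measurable borel" "\<And>z. \<bar>w z\<bar> \<le> \<bar>B\<bar>" "AE z in lebesgue. w z = uu z"
    by (rule ex_borel_version[OF uu _ abs_ge_zero]) (rule that, assumption+)
  show ?thesis
  proof (rule that[of "\<bar>B\<bar>" w])
    show "AE z in lebesgue. z \<in> half_plane \<longrightarrow> u (fst z) (snd z) = w z"
      using w(3) by eventually_elim (auto simp: uu_def)
  qed (use w in auto)
qed

lemma kruzhkov_borel_version:
  assumes sol: "entropy_solution f u0 u" and f: "continuous_on UNIV f"
    and w: "w \<in> borel_measurable borel" "AE z in lebesgue. z \<in> half_plane \<longrightarrow> u (fst z) (snd z) = w z"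
    and \<phi>: "test_function \<phi> \<phi>t \<phi>x" "\<forall>z. 0 \<le> \<phi> z"
  shows "0 \<le> (\<integral>z. \<bar>w z - k\<bar> * \<phi>t z + sgn (w z - k) * (f (w z) - f k) * \<phi>x z \<partial>lborel)"
proof -
  define E where "E y z = \<bar>y - k\<bar> * \<phi>t z + sgn (y - k) * (f y - f k) * \<phi>x z" for y z
  have cont: "continuous_on UNIV \<phi>t" "continuous_on UNIV \<phi>x"
    using \<phi>(1) unfolding test_function_def by auto
  have \<phi>_meas [measurable]: "\<phi>t \<in> borel_measurable borel" "\<phi>x \<in> borel_measurable borel"
    using cont borel_measurable_continuous_onI by blast+
  have f_meas [measurable]: "f \<in> borel_measurable borel" using f borel_measurable_continuous_onI by blast
  have half_open: "open half_plane" unfolding half_plane_def by (intro open_Times) auto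
  then have half: "half_plane \<in> sets borel" by (rule borel_open)
  then have half': "half_plane \<in> sets lebesgue" by simp
  define uu where "uu z = indicator half_plane z *\<^sub>R u (fst z) (snd z)" for z
  have "(\<lambda>z. u (fst z) (snd z)) \<in> borel_measurable (lebesgue_on half_plane)"
    using sol unfolding entropy_solution_def by blast
  then have uu [measurable]: "uu \<in> borel_measurable lebesgue"
    using half' unfolding uu_def[abs_def] by (subst (asm) borel_measurable_restrict_space_iff) auto
  have Ew: "(\<lambda>z. E (w z) z) \<in> borel_measurable borel"
    unfolding E_def using w(1) by measurable
  have E_meas: "(\<lambda>z. E (g z) z) \<in> borel_measurable lebesgue" if [measurable]: "g \<in> borel_measurable lebesgue" for g
  proof -
    have [measurable]: "(\<lambda>z. f (g z)) \<in> borel_measurable lebesgue"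
      using measurable_compose[OF that f_meas] .
    have [measurable]: "\<phi>t \<in> borel_measurable lebesgue" "\<phi>x \<in> borel_measurable lebesgue"
      using \<phi>_meas by (auto intro: measurable_completion)
    show ?thesis unfolding E_def by measurable
  qed
  have "0 \<le> (LINT z:half_plane|lebesgue. E (u (fst z) (snd z)) z)"
    using sol \<phi> unfolding entropy_solution_def kruzhkov_inequalities_def E_def by blast
  also have "\<dots> = (\<integral>z. indicator half_plane z *\<^sub>R E (uu z) z \<partial>lebesgue)"
    unfolding set_lebesgue_integral_def
    by (intro Bochner_Integration.integral_cong) (auto simp: uu_def indicator_def)
  also have "\<dots> = (\<integral>z. E (w z) z \<partial>lebesgue)"
  proof (rule integral_cong_AE)
    show "(\<lambda>z. indicator half_plane z *\<^sub>R E (uu z) z) \<in> borel_measurable lebesgue"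
      using half' E_meas[OF uu] by (intro borel_measurable_scaleR borel_measurable_indicator)
    show "(\<lambda>z. E (w z) z) \<in> borel_measurable lebesgue" using Ew by (auto intro: measurable_completion)
    show "AE z in lebesgue. indicator half_plane z *\<^sub>R E (uu z) z = E (w z) z"
      using w(2)
    proof eventually_elim
      case (elim z)
      show ?case
      proof (cases "z \<in> half_plane")
        case False
        then show ?thesis using test_function_derivative_outside[OF \<phi>(1) False] by (simp add: E_def)
      qed (use elim in \<open>simp add: uu_def\<close>)
    qed
  qed
  also have "\<dots> = (\<integral>z. E (w z) z \<partial>lborel)" using Ew by (intro integral_completion) simp
  finally show ?thesis by (simp add: E_def)
qed

text \<open>The essential bound on the half-plane holds on almost every time slice by Fubini. It
  reaches every positive time through continuity in L1loc: the excess of \<open>u t\<close> over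
  \<open>{-B..B}\<close> is at most its distance to nearby good slices.\<close>

lemma ex_entropy_slices:
  assumes sol: "entropy_solution f u0 u" and f: "continuous_on UNIV f"
    and u0: "u0 \<in> borel_measurable lebesgue" "\<And>x. \<bar>u0 x\<bar> \<le> M" and M: "0 < M"
  obtains w B F v where "entropy_slices f w B F v" "M \<le> B"
    "\<And>x. \<bar>v 0 x\<bar> \<le> M" "AE x in lebesgue. v 0 x = u0 x"
    "\<And>t. 0 < t \<Longrightarrow> AE x in lebesgue. v t x = u t x"
proof -
  obtain B0 w where B0: "0 \<le> B0" and w: "w \<in> borel_measurable borel" "\<And>z. \<bar>w z\<bar> \<le> B0"
    "AE z in lebesgue. z \<in> half_plane \<longrightarrow> u (fst z) (snd z) = w z"
    by (rule ex_joint_borel_version[OF sol]) (rule that, assumption+)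
  define B where "B = max B0 M"
  have B: "0 \<le> B" "B0 \<le> B" "M \<le> B" using M by (auto simp: B_def)
  have wB: "\<bar>w z\<bar> \<le> B" for z using w(2)[of z] B by linarith
  have L1: "continuous_in_L1loc u" using sol unfolding entropy_solution_def by blast
  have u_int: "set_integrable lebesgue {-r..r} (u t)" if "0 < t" "0 < r" for t r
    using L1 that unfolding continuous_in_L1loc_def by blast
  have u_cont: "((\<lambda>\<tau>. LINT x:{-r..r}|lebesgue. \<bar>u \<tau> x - u t x\<bar>) \<longlongrightarrow> 0) (at t)" if "0 < t" "0 < r" for t r
    using L1 that unfolding continuous_in_L1loc_def by blast
  have u_meas: "u t \<in> borel_measurable lebesgue" if "0 < t" for t
    by (rule set_integrable_imp_borel_measurable) (rule u_int[OF that])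
  have slices: "AE t in lborel. 0 < t \<longrightarrow> (AE x in lborel. u t x = w (t, x))"
  proof -
    have "AE z in lborel \<Otimes>\<^sub>M lborel. z \<in> half_plane \<longrightarrow> u (fst z) (snd z) = w z"
      using w(3) by (simp only: AE_completion_iff lborel_prod)
    from lborel_pair.AE_pair[OF this]
    show ?thesis by (simp add: half_plane_def)
  qed
  have u_bound: "AE x in lebesgue. \<bar>u t x\<bar> \<le> B" if t: "0 < t" for t
  proof -
    have "AE x in lebesgue. x \<in> {- real (Suc n)..real (Suc n)} \<longrightarrow> u t x = clamp B (u t x)" for n
    proof -
      define r where "r = real (Suc n)"
      have r: "0 < r" by (simp add: r_def)
      have int: "integrable lebesgue (\<lambda>x. indicator {-r..r} x *\<^sub>R \<bar>u t x - clamp B (u t x)\<bar>)"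
      proof (rule Bochner_Integration.integrable_bound)
        show "integrable lebesgue (\<lambda>x. indicator {-r..r} x *\<^sub>R \<bar>u t x - 0\<bar>)"
          using set_integrable_abs[OF u_int[OF t r]] by (simp add: set_integrable_def)
        show "(\<lambda>x. indicator {-r..r} x *\<^sub>R \<bar>u t x - clamp B (u t x)\<bar>) \<in> borel_measurable lebesgue"
          using u_meas[OF t]
          by (intro borel_measurable_scaleR borel_measurable_indicator borel_measurable_abs
              borel_measurable_diff borel_measurable_clamp) auto
        show "AE x in lebesgue. norm (indicator {-r..r} x *\<^sub>R \<bar>u t x - clamp B (u t x)\<bar>)
            \<le> norm (indicator {-r..r} x *\<^sub>R \<bar>u t x - 0\<bar>)"
          using clamp_nearest[of 0 B] B(1) by (intro AE_I2) (simp add: indicator_def)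
      qed
      have "(\<integral>x. indicator {-r..r} x *\<^sub>R \<bar>u t x - clamp B (u t x)\<bar> \<partial>lebesgue) \<le> 0"
      proof (rule field_le_epsilon)
        fix e :: real assume "e > 0"
        then have "\<forall>\<^sub>F \<tau> in at t. (LINT x:{-r..r}|lebesgue. \<bar>u \<tau> x - u t x\<bar>) < e"
          using order_tendstoD(2)[OF u_cont[OF t r]] by blast
        then obtain d where d: "d > 0"
          "\<And>\<tau>. \<tau> \<noteq> t \<Longrightarrow> \<bar>\<tau> - t\<bar> < d \<Longrightarrow> (LINT x:{-r..r}|lebesgue. \<bar>u \<tau> x - u t x\<bar>) < e"
          unfolding eventually_at dist_real_def by auto
        \<comment> \<open>A good time close to \<open>t\<close>: there
          \<open>|u \<tau> x| <= B\<close> for almost every \<open>x\<close>, so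
          \<open>|u \<tau> x - u t x|\<close> dominates the excess of \<open>u t x\<close>, and its
          integral is below \<open>e\<close>.\<close>
        obtain \<tau> where \<tau>: "t < \<tau>" "\<tau> < t + d" "0 < \<tau> \<longrightarrow> (AE x in lborel. u \<tau> x = w (\<tau>, x))"
          using AE_ex_in_interval[OF slices, of t "t + d"] d(1) by auto
        have \<tau>0: "0 < \<tau>" using \<tau> t by linarith
        have "(\<integral>x. indicator {-r..r} x *\<^sub>R \<bar>u t x - clamp B (u t x)\<bar> \<partial>lebesgue)
            \<le> (\<integral>x. indicator {-r..r} x *\<^sub>R \<bar>u \<tau> x - u t x\<bar> \<partial>lebesgue)"
        proof (rule integral_mono_AE[OF int])
          show "integrable lebesgue (\<lambda>x. indicator {-r..r} x *\<^sub>R \<bar>u \<tau> x - u t x\<bar>)"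
            using set_integrable_abs[OF set_integral_diff(1)[OF u_int[OF \<tau>0 r] u_int[OF t r]]]
            by (simp add: set_integrable_def)
          have "AE x in lebesgue. u \<tau> x = w (\<tau>, x)" using \<tau>(3) \<tau>0 by (simp add: AE_completion)
          then show "AE x in lebesgue. indicator {-r..r} x *\<^sub>R \<bar>u t x - clamp B (u t x)\<bar>
              \<le> indicator {-r..r} x *\<^sub>R \<bar>u \<tau> x - u t x\<bar>"
          proof eventually_elim
            case (elim x)
            then have "\<bar>u t x - clamp B (u t x)\<bar> \<le> \<bar>u \<tau> x - u t x\<bar>"
              using clamp_nearest[of "u \<tau> x" B "u t x"] wB[of "(\<tau>, x)"] by (simp add: abs_minus_commute)
            then show ?case by (simp add: indicator_def)
          qed
        qed
        also have "\<dots> < e" using d(2)[of \<tau>] \<tau> by (simp add: set_lebesgue_integral_def)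
        finally show "(\<integral>x. indicator {-r..r} x *\<^sub>R \<bar>u t x - clamp B (u t x)\<bar> \<partial>lebesgue) \<le> 0 + e" by simp
      qed
      moreover have "0 \<le> (\<integral>x. indicator {-r..r} x *\<^sub>R \<bar>u t x - clamp B (u t x)\<bar> \<partial>lebesgue)"
        by (rule Bochner_Integration.integral_nonneg) simp
      ultimately have "(\<integral>x. indicator {-r..r} x *\<^sub>R \<bar>u t x - clamp B (u t x)\<bar> \<partial>lebesgue) = 0"
        by (rule antisym)
      then have "AE x in lebesgue. indicator {-r..r} x *\<^sub>R \<bar>u t x - clamp B (u t x)\<bar> = 0"
        by (subst (asm) integral_nonneg_eq_0_iff_AE[OF int]) auto
      then show ?thesis by eventually_elim (auto simp: r_def indicator_def split: if_splits)
    qed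
    then have "AE x in lebesgue. \<forall>n. x \<in> {- real (Suc n)..real (Suc n)} \<longrightarrow> u t x = clamp B (u t x)"
      unfolding AE_all_countable by blast
    then show ?thesis
    proof eventually_elim
      case (elim x)
      obtain n :: nat where "\<bar>x\<bar> \<le> real n" using real_arch_simple by blast
      then have "x \<in> {- real (Suc n)..real (Suc n)}" by (auto simp: abs_le_iff)
      then have "u t x = clamp B (u t x)" using elim by blast
      then show ?case using abs_clamp[OF B(1)] by metis
    qed
  qed
  \<comment> \<open>With \<open>u0\<close> placed at time 0, the initial condition becomes
    continuity of the slices at 0, and \<open>v 0\<close> keeps the sharper bound
    \<open>M\<close>.\<close>
  define U where "U t = (if t \<le> 0 then u0 else u t)" for t
  have U_meas: "U t \<in> borel_measurable lebesgue" for t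
    using u0(1) u_meas[of t] by (auto simp: U_def)
  have "\<exists>h. h \<in> borel_measurable borel \<and> (\<forall>x. \<bar>h x\<bar> \<le> (if t \<le> 0 then M else B)) \<and> (AE x in lebesgue. h x = U t x)" for t
  proof (cases "t \<le> 0")
    case True
    obtain h where "h \<in> borel_measurable borel" "\<And>x. \<bar>h x\<bar> \<le> M" "AE x in lebesgue. h x = u0 x"
      by (rule ex_borel_version[OF u0(1) AE_I2[OF u0(2)] less_imp_le[OF M]]) (rule that, assumption+)
    then show ?thesis using True by (intro exI[of _ h]) (simp add: U_def)
  next
    case False
    then have t: "0 < t" by simp
    obtain h where "h \<in> borel_measurable borel" "\<And>x. \<bar>h x\<bar> \<le> B" "AE x in lebesgue. h x = u t x"
      by (rule ex_borel_version[OF u_meas[OF t] u_bound[OF t] B(1)]) (rule that, assumption+)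
    then show ?thesis using t by (intro exI[of _ h]) (simp add: U_def)
  qed
  then obtain v where v: "\<And>t. v t \<in> borel_measurable borel" "\<And>t x. \<bar>v t x\<bar> \<le> (if t \<le> 0 then M else B)"
    "\<And>t. AE x in lebesgue. v t x = U t x"
    by metis
  have vB: "\<bar>v t x\<bar> \<le> B" for t x using v(2)[of t x] B by (auto split: if_splits)
  have v_L1: "(LINT x:{-r..r}|lborel. \<bar>v \<tau> x - v t x\<bar>) = (LINT x:{-r..r}|lebesgue. \<bar>U \<tau> x - U t x\<bar>)" for r \<tau> t
  proof -
    have m: "(\<lambda>x. indicator {-r..r} x *\<^sub>R \<bar>v \<tau> x - v t x\<bar>) \<in> borel_measurable borel"
      using v(1)[of \<tau>] v(1)[of t] by measurable
    have "(LINT x:{-r..r}|lborel. \<bar>v \<tau> x - v t x\<bar>) = (\<integral>x. indicator {-r..r} x *\<^sub>R \<bar>v \<tau> x - v t x\<bar> \<partial>lebesgue)"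
      unfolding set_lebesgue_integral_def using m by (intro integral_completion[symmetric]) simp
    also have "\<dots> = (\<integral>x. indicator {-r..r} x *\<^sub>R \<bar>U \<tau> x - U t x\<bar> \<partial>lebesgue)"
    proof (rule integral_cong_AE)
      show "(\<lambda>x. indicator {-r..r} x *\<^sub>R \<bar>v \<tau> x - v t x\<bar>) \<in> borel_measurable lebesgue"
        using m by (auto intro: measurable_completion)
      show "(\<lambda>x. indicator {-r..r} x *\<^sub>R \<bar>U \<tau> x - U t x\<bar>) \<in> borel_measurable lebesgue"
        using U_meas[of \<tau>] U_meas[of t]
        by (intro borel_measurable_scaleR borel_measurable_indicator borel_measurable_abs
            borel_measurable_diff) auto
      show "AE x in lebesgue. indicator {-r..r} x *\<^sub>R \<bar>v \<tau> x - v t x\<bar> = indicator {-r..r} x *\<^sub>R \<bar>U \<tau> x - U t x\<bar>"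
        using v(3)[of \<tau>] v(3)[of t] by eventually_elim simp
    qed
    finally show ?thesis by (simp add: set_lebesgue_integral_def)
  qed
  have v_cont: "((\<lambda>\<tau>. LINT x:{-r..r}|lborel. \<bar>v \<tau> x - v t x\<bar>) \<longlongrightarrow> 0) (at t within {0..})"
    if t: "0 \<le> t" and r: "0 < r" for t r
  proof (cases "t = 0")
    case True
    have "((\<lambda>\<tau>. LINT x:{-r..r}|lebesgue. \<bar>u \<tau> x - u0 x\<bar>) \<longlongrightarrow> 0) (at_right 0)"
      using sol r unfolding entropy_solution_def by blast
    moreover have "\<forall>\<^sub>F \<tau> in at_right 0. (LINT x:{-r..r}|lebesgue. \<bar>u \<tau> x - u0 x\<bar>)
        = (LINT x:{-r..r}|lborel. \<bar>v \<tau> x - v t x\<bar>)"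
      using eventually_at_right_less[of "0 :: real"]
      by eventually_elim (simp add: v_L1 U_def True)
    ultimately have "((\<lambda>\<tau>. LINT x:{-r..r}|lborel. \<bar>v \<tau> x - v t x\<bar>) \<longlongrightarrow> 0) (at_right 0)"
      by (rule Lim_transform_eventually)
    then show ?thesis using True by (simp add: at_within_Ici_at_right)
  next
    case False
    then have t0: "0 < t" using t by simp
    have "\<forall>\<^sub>F \<tau> in at t. 0 < \<tau>"
      using order_tendstoD(1)[OF tendsto_ident_at t0] by blast
    then have "\<forall>\<^sub>F \<tau> in at t. (LINT x:{-r..r}|lebesgue. \<bar>u \<tau> x - u t x\<bar>)
        = (LINT x:{-r..r}|lborel. \<bar>v \<tau> x - v t x\<bar>)"
      by eventually_elim (use t0 in \<open>simp add: v_L1 U_def\<close>)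
    then have "((\<lambda>\<tau>. LINT x:{-r..r}|lborel. \<bar>v \<tau> x - v t x\<bar>) \<longlongrightarrow> 0) (at t)"
      by (rule Lim_transform_eventually[OF u_cont[OF t0 r]])
    then show ?thesis by (rule tendsto_within_subset) simp
  qed
  have v_w: "AE t in lborel. 0 < t \<longrightarrow> (AE x in lborel. v t x = w (t, x))"
    using slices
  proof eventually_elim
    case (elim t)
    show ?case
    proof
      assume t: "0 < t"
      then have 1: "AE x in lborel. u t x = w (t, x)" using elim by simp
      have 2: "AE x in lborel. v t x = U t x" using v(3)[of t] by (simp add: AE_completion_iff)
      show "AE x in lborel. v t x = w (t, x)"
        using 1 2 by eventually_elim (use t in \<open>simp add: U_def\<close>)
    qed
  qed
  obtain F where F: "\<And>l. l \<in> {-B..B} \<Longrightarrow> \<bar>f l\<bar> \<le> F"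
    using compact_continuous_abs_bound[OF compact_Icc continuous_on_subset[OF f subset_UNIV]] by metis
  show ?thesis
  proof (rule that[of w B F v])
    show "entropy_slices f w B F v"
    proof
      show "\<bar>f l\<bar> \<le> F" if "\<bar>l\<bar> \<le> B" for l using F that by (simp add: abs_le_iff)
    qed (fact f w(1) wB v(1) vB v_w v_cont | rule kruzhkov_borel_version[OF sol f w(1,3)], assumption+)+
    show "\<bar>v 0 x\<bar> \<le> M" for x using v(2)[of 0 x] by simp
    show "AE x in lebesgue. v 0 x = u0 x" using v(3)[of 0] by (simp add: U_def)
    show "AE x in lebesgue. v t x = u t x" if "0 < t" for t using v(3)[of t] that by (simp add: U_def)
  qed (fact B(3))
qed

section \<open>Decay\<close>

text \<open>Two least exponents bound each other, which resolves the \<open>THE\<close>; any real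
  \<open>c\<close> strictly between 0 and the extended infimum then serves. On the diagonal the
  inequality holds because \<open>0 powr p = 0\<close> for every \<open>p\<close>.\<close>

lemma degeneracy_lower_bound:
  assumes "degeneracy f K = ereal p"
  obtains c where "0 < c" "\<And>u v. u \<in> K \<Longrightarrow> v \<in> K \<Longrightarrow> c * \<bar>u - v\<bar> powr p \<le> \<bar>deriv f u - deriv f v\<bar>"
proof -
  have ex: "\<exists>p. is_least_exponent f K p" and p: "p = (THE p. is_least_exponent f K p)"
    using assms unfolding degeneracy_def by (auto split: if_splits)
  then obtain p' where p': "is_least_exponent f K p'" by blast
  have "(THE p. is_least_exponent f K p) = p'"
    using p' by (intro the_equality) (auto simp: is_least_exponent_def intro: antisym)
  then have "nondegenerate_exponent f K p" using p' p by (simp add: is_least_exponent_def)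
  then obtain c where c: "0 < ereal c" "ereal c < (INF (u, v) \<in> {(u, v). u \<in> K \<and> v \<in> K \<and> u \<noteq> v}.
      ereal (\<bar>deriv f u - deriv f v\<bar> / \<bar>u - v\<bar> powr p))"
    unfolding nondegenerate_exponent_def using ereal_dense2 by blast
  show ?thesis
  proof (rule that)
    show "0 < c" using c(1) by simp
    fix u v assume uv: "u \<in> K" "v \<in> K"
    show "c * \<bar>u - v\<bar> powr p \<le> \<bar>deriv f u - deriv f v\<bar>"
    proof (cases "u = v")
      case False
      have "ereal c < (case (u, v) of (u, v) \<Rightarrow> ereal (\<bar>deriv f u - deriv f v\<bar> / \<bar>u - v\<bar> powr p))"
        by (rule less_INF_D[OF c(2)]) (use uv False in simp)
      then show ?thesis using False by (simp add: pos_less_divide_eq)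
    qed simp
  qed
qed

text \<open>For \<open>p <= 0\<close> the lower bound does not shrink as the two points approach
  each other, so \<open>a\<close> would be discontinuous at 0. Positivity is what permits taking the
  \<open>p\<close>-th root at the end.\<close>

lemma nondegenerate_exponent_pos:
  fixes a :: "real \<Rightarrow> real"
  assumes a: "isCont a 0" and M: "0 < M" and c: "0 < c"
    and bound: "\<And>u v. u \<in> {-M..M} \<Longrightarrow> v \<in> {-M..M} \<Longrightarrow> c * \<bar>u - v\<bar> powr p \<le> \<bar>a u - a v\<bar>"
  shows "0 < p"
proof (rule ccontr)
  assume "\<not> 0 < p"
  have lower: "c * M powr p \<le> \<bar>a v - a 0\<bar>" if "0 < v" "v < M" for v
  proof -
    have "M powr p \<le> v powr p" using that \<open>\<not> 0 < p\<close> by (intro powr_mono2') auto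
    then have "c * M powr p \<le> c * v powr p" using c by simp
    also have "\<dots> \<le> \<bar>a v - a 0\<bar>" using bound[of v 0] that by simp
    finally show ?thesis .
  qed
  have "((\<lambda>v. \<bar>a v - a 0\<bar>) \<longlongrightarrow> \<bar>a 0 - a 0\<bar>) (at_right 0)"
    using a by (intro tendsto_intros) (auto simp: isCont_def intro: tendsto_within_subset)
  moreover have "\<forall>\<^sub>F v in at_right 0. c * M powr p \<le> \<bar>a v - a 0\<bar>"
    using eventually_at_right_real[OF M] by eventually_elim (use lower in auto)
  ultimately have "c * M powr p \<le> \<bar>a 0 - a 0\<bar>"
    by (intro tendsto_lowerbound) auto
  then show False using c M by (simp add: mult_le_0_iff)
qed

lemma integral_period:
  fixes g :: "real \<Rightarrow> real"
  assumes P: "0 < P" and per: "\<And>x. g (x + P) = g x" and int: "\<And>a b. g integrable_on {a..b}"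
  shows "integral {x..x + P} g = integral {0..P} g"
proof -
  have nat_per: "g (y + real n * P) = g y" for n y
  proof (induction n)
    case (Suc n)
    have "g (y + real (Suc n) * P) = g ((y + real n * P) + P)" by (simp add: algebra_simps)
    then show ?case using Suc per by simp
  qed simp
  have int_per: "g (y + of_int k * P) = g y" for k y
  proof (cases "0 \<le> k")
    case True
    then show ?thesis using nat_per[of y "nat k"] by simp
  next
    case False
    then show ?thesis using nat_per[of "y + of_int k * P" "nat (- k)"] by (simp add: algebra_simps)
  qed
  define k where "k = \<lfloor>x / P\<rfloor>"
  define r where "r = x - of_int k * P"
  have "of_int k \<le> x / P" "x / P < of_int k + 1" by (simp_all add: k_def)
  then have r: "0 \<le> r" "r \<le> P" using P by (simp_all add: r_def field_simps)
  have "g \<circ> (+) (of_int k * P) = g" using int_per by (auto simp: fun_eq_iff add.commute)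
  then have "integral {x..x + P} g = integral {r..r + P} g"
    using integral_shift_Icc_real[of r "r + P" g "of_int k * P"] by (simp add: r_def)
  also have "\<dots> = integral {r..P} g + integral {P..P + r} g"
    using Henstock_Kurzweil_Integration.integral_combine[of r P "r + P" g] r int by (simp add: add.commute)
  also have "integral {P..P + r} g = integral {0..r} g"
  proof -
    have "g \<circ> (+) P = g" using per by (auto simp: fun_eq_iff add.commute)
    then show ?thesis using integral_shift_Icc_real[of 0 r g P] by (simp add: add.commute)
  qed
  also have "integral {r..P} g + integral {0..r} g = integral {0..P} g"
    using Henstock_Kurzweil_Integration.integral_combine[of 0 r P g] r int by simp
  finally show ?thesis .
qed

lemma AE_right_derivative_integral:
  fixes g :: "real \<Rightarrow> real"
  assumes "g \<in> borel_measurable borel" "\<And>x. \<bar>g x\<bar> \<le> B"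
  shows "AE x in lebesgue. ((\<lambda>h. integral {x..x + h} g / h) \<longlongrightarrow> g x) (at_right 0)"
proof -
  obtain N where N: "negligible N" and
    lim: "\<And>x e. \<lbrakk>x \<notin> N; 0 < e\<rbrakk> \<Longrightarrow>
      \<exists>d>0. \<forall>h. 0 < h \<and> h < d \<longrightarrow> norm (integral (cbox x (x + h *\<^sub>R One)) g /\<^sub>R h ^ DIM(real) - g x) < e"
    using integrable_ccontinuous_explicit[of g] integrable_on_cbox_bounded_borel(2)[OF assms] by metis
  have "((\<lambda>h. integral {x..x + h} g / h) \<longlongrightarrow> g x) (at_right 0)" if "x \<notin> N" for x
  proof (rule tendstoI)
    fix e :: real assume "e > 0"
    then obtain d where "d > 0" "\<And>h. 0 < h \<Longrightarrow> h < d \<Longrightarrow> norm (integral (cbox x (x + h *\<^sub>R One)) g /\<^sub>R h ^ DIM(real) - g x) < e"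
      using lim \<open>x \<notin> N\<close> by meson
    then show "\<forall>\<^sub>F h in at_right 0. dist (integral {x..x + h} g / h) (g x) < e"
      unfolding eventually_at_right_field
      by (intro exI[of _ d]) (auto simp: dist_real_def divide_inverse mult.commute)
  qed
  then have "AE x in lebesgue. x \<notin> N \<longrightarrow> ((\<lambda>h. integral {x..x + h} g / h) \<longlongrightarrow> g x) (at_right 0)"
    by simp
  moreover have "AE x in lebesgue. x \<notin> N"
    using N by (intro AE_not_in) (simp add: negligible_iff_null_sets)
  ultimately show ?thesis by eventually_elim simp
qed

lemma integral_cong_AE_lebesgue:
  fixes g h :: "real \<Rightarrow> real"
  assumes "AE x in lebesgue. g x = h x"
  shows "integral {a..b} g = integral {a..b} h"
proof -
  obtain N where N: "N \<in> null_sets lebesgue" "\<And>x. x \<notin> N \<Longrightarrow> g x = h x"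
    using assms by (rule AE_E3) simp
  then have "negligible N" by (simp add: negligible_iff_null_sets)
  then show ?thesis by (rule integral_spike) (use N(2) in auto)
qed

text \<open>The reflection \<open>u \<mapsto> - u\<close>, \<open>f \<mapsto> (\<lambda>k. - f (- k))\<close> preserves affine comparison and exchanges
  the concave with the convex case.\<close>

lemma monotone_periodic_slope_bound:
  fixes U :: "real \<Rightarrow> real \<Rightarrow> real" and f a :: "real \<Rightarrow> real"
  assumes M: "0 < M" and f: "\<And>k. (f has_real_derivative a k) (at k)"
    and a: "continuous_on UNIV a" "inj_on a {-M..M}"
    and U: "affine_comparison \<Lambda> f M U" and \<Lambda>: "0 \<le> \<Lambda>"
    and lipx: "\<And>x y. \<bar>U 0 x - U 0 y\<bar> \<le> M * \<bar>x - y\<bar>"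
    and lipt: "\<And>s t x. 0 \<le> s \<Longrightarrow> 0 \<le> t \<Longrightarrow> \<bar>U t x - U s x\<bar> \<le> F * \<bar>t - s\<bar>"
    and per: "\<And>x. U 0 (x + P) = U 0 x + m * P" and P: "P > 0" and m: "m \<in> {-M..M}"
    and T: "T > 0" and v: "((\<lambda>h. (U T (x + h) - U T x) / h) \<longlongrightarrow> v) (at_right 0)"
  shows "v \<in> {-M..M} \<and> \<bar>a v - a m\<bar> \<le> P / T"
proof -
  have cont: "continuous_on {-M..M} a" using a(1) continuous_on_subset by blast
  \<comment> \<open>Finite degeneracy supplies injectivity; a continuous injection on an interval is
    strictly monotone, in one of the two directions.\<close>
  then have "strict_mono_on {-M..M} a \<or> strict_antimono_on {-M..M} a"
    using injective_eq_monotone_map[of "{-M..M}" a] a(2) is_interval_cc by blast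
  then show ?thesis
  proof
    assume "strict_mono_on {-M..M} a"
    then interpret convex_flux f a M using M f cont by unfold_locales auto
    show ?thesis using periodic_slope_bound[OF U \<Lambda> lipx lipt per P m T v] by blast
  next
    assume anti: "strict_antimono_on {-M..M} a"
    define g where "g k = - f (- k)" for k
    define a' where "a' k = a (- k)" for k
    have g: "(g has_real_derivative a' k) (at k)" for k
    proof -
      have "((\<lambda>k. f (- k)) has_real_derivative a (- k) * (- 1)) (at k)"
        by (rule DERIV_chain2[OF f]) (auto intro!: derivative_eq_intros)
      then show ?thesis unfolding g_def[abs_def] a'_def by (auto intro!: derivative_eq_intros)
    qed
    have "strict_mono_on {-M..M} a'"
      using anti unfolding a'_def monotone_on_def by simp
    moreover have "continuous_on {-M..M} a'"
      unfolding a'_def[abs_def] by (intro continuous_on_compose2[OF a(1)] continuous_intros) auto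
    ultimately interpret convex_flux g a' M using M g by unfold_locales auto
    have U': "affine_comparison \<Lambda> g M (\<lambda>t x. - U t x)"
      using affine_comparison_uminus[OF U] by (simp add: g_def[abs_def])
    have lipx': "\<bar>- U 0 x - - U 0 y\<bar> \<le> M * \<bar>x - y\<bar>" for x y using lipx[of x y] by linarith
    have lipt': "\<bar>- U t x - - U s x\<bar> \<le> F * \<bar>t - s\<bar>" if "0 \<le> s" "0 \<le> t" for s t x
      using lipt[OF that, of x] by linarith
    have per': "- U 0 (x + P) = - U 0 x + (- m) * P" for x using per by simp
    have m': "- m \<in> {-M..M}" using m by simp
    have "(- U T (x + h) - - U T x) / h = - ((U T (x + h) - U T x) / h)" for h
      by (simp add: minus_divide_left)
    then have v': "((\<lambda>h. (- U T (x + h) - - U T x) / h) \<longlongrightarrow> - v) (at_right 0)"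
      using tendsto_minus[OF v] by simp
    note periodic_slope_bound[OF U' \<Lambda> lipx' lipt' per' P m' T v']
    then show ?thesis by (auto simp: a'_def)
  qed
qed

theorem theorem4p3:
  fixes P M m p :: real and u0 f :: "real \<Rightarrow> real" and u :: "real \<Rightarrow> real \<Rightarrow> real"
  assumes "P > 0"
    and "u0 \<in> borel_measurable lebesgue"
    and "\<And>x. u0 (x + P) = u0 x"
    and "m = 1 / P * (LINT x:{0..P}|lebesgue. u0 x)"
    and "M > 0"
    and "\<And>x. \<bar>u0 x\<bar> \<le> M"
    and "f C1_differentiable_on UNIV"
    and "entropy_solution f u0 u"
    and "degeneracy f {-M..M} = ereal p"
  shows "\<exists>C. \<forall>t>0. AE x in lebesgue. \<bar>u t x - m\<bar> \<le> C / t powr (1 / p)"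
proof -
  note P = assms(1) and M = assms(5)
  obtain a where a: "\<And>k. (f has_real_derivative a k) (at k)" "continuous_on UNIV a"
    using assms(7) unfolding C1_differentiable_on_def
    by (auto simp: has_real_derivative_iff_has_vector_derivative)
  have deriv_f: "deriv f k = a k" for k using DERIV_imp_deriv[OF a(1)] .
  have f_cont: "continuous_on UNIV f"
    by (intro continuous_at_imp_continuous_on ballI DERIV_isCont[OF a(1)])
  obtain c where c: "0 < c" "\<And>u v. u \<in> {-M..M} \<Longrightarrow> v \<in> {-M..M} \<Longrightarrow> c * \<bar>u - v\<bar> powr p \<le> \<bar>a u - a v\<bar>"
    using degeneracy_lower_bound[OF assms(9)] unfolding deriv_f by metis
  have p: "0 < p"
    using nondegenerate_exponent_pos[OF _ M c] a(2) by (simp add: continuous_on_eq_continuous_at)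
  have inj: "inj_on a {-M..M}"
  proof (rule inj_onI)
    fix k l assume kl: "k \<in> {-M..M}" "l \<in> {-M..M}" "a k = a l"
    then have "c * \<bar>k - l\<bar> powr p \<le> 0" using c(2)[of k l] by simp
    then show "k = l" using c(1) by (auto simp: mult_le_0_iff)
  qed
  obtain w B F v where slices: "entropy_slices f w B F v" and B: "M \<le> B"
    and v0: "\<And>x. \<bar>v 0 x\<bar> \<le> M" "AE x in lebesgue. v 0 x = u0 x"
    and vu: "\<And>t. 0 < t \<Longrightarrow> AE x in lebesgue. v t x = u t x"
    by (rule ex_entropy_slices[OF assms(8) f_cont assms(2,6) M]) (rule that, assumption+)
  interpret entropy_slices f w B F v by (fact slices)
  interpret pot: entropy_potential f w B F U by (fact entropy_potential)

  \<comment> \<open>The speed is taken over \<open>{-B..B}\<close>, where the values of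
    \<open>w\<close> are known to lie at this stage. Using \<open>\<Lambda> + 1\<close> below
    secures the strict inequality between Lipschitz constant and cone speed.\<close>
  obtain \<Lambda> where \<Lambda>: "0 \<le> \<Lambda>" "\<And>k. k \<in> {-B..B} \<Longrightarrow> \<bar>a k\<bar> \<le> \<Lambda>"
    using compact_continuous_abs_bound[OF compact_Icc continuous_on_subset[OF a(2) subset_UNIV]] by metis
  have "\<bar>f l - f k\<bar> \<le> \<Lambda> * \<bar>l - k\<bar>" if "\<bar>k\<bar> \<le> M" "\<bar>l\<bar> \<le> B" for k l
    using field_differentiable_bound[of "{-B..B}" f a \<Lambda> l k] that B a(1) \<Lambda>(2)
    by (auto simp: abs_le_iff has_field_derivative_at_within)
  then have comparison: "affine_comparison (\<Lambda> + 1) f M U"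
    by (rule pot.affine_comparison) (use \<Lambda>(1) in auto)

  have u0_int: "set_integrable lebesgue {x..y} u0" for x y
  proof -
    have "u0 absolutely_integrable_on cbox x y"
    proof (rule measurable_bounded_by_integrable_imp_absolutely_integrable)
      show "u0 \<in> borel_measurable (lebesgue_on (cbox x y))"
        using assms(2) by (rule measurable_restrict_space1)
      show "(\<lambda>_. M) integrable_on cbox x y" by (rule integrable_const)
    qed (use assms(6) in auto)
    then show ?thesis by simp
  qed
  have u0_HK: "u0 integrable_on {x..y}" for x y
    using set_lebesgue_integral_eq_integral(1)[OF u0_int] .
  have U0: "U 0 y - U 0 x = integral {x..y} u0" if "x \<le> y" for x y
    using U_increment[OF that] integral_cong_AE_lebesgue[OF v0(2)] by simp
  \<comment> \<open>The constant at time 0 is \<open>M\<close> and not \<open>B\<close>: it must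
    match the growth of a fan, whose slopes do not exceed \<open>M\<close>.\<close>
  have lip0: "\<bar>U 0 x - U 0 y\<bar> \<le> M * \<bar>x - y\<bar>" for x y
  proof -
    have *: "\<bar>U 0 y - U 0 x\<bar> \<le> M * (y - x)" if "x \<le> y" for x y
    proof -
      have "norm (integral {x..y} u0) \<le> M * measure lborel {x..y}"
        using has_integral_bound[of M u0 "integral {x..y} u0" x y] integrable_integral[OF u0_HK] assms(6) M
        by simp
      then show ?thesis using U0[OF that] that by simp
    qed
    show ?thesis using *[of x y] *[of y x] by (cases "x \<le> y") (auto simp: abs_minus_commute)
  qed
  have mP: "integral {0..P} u0 = m * P"
    using assms(4) P set_lebesgue_integral_eq_integral(2)[OF u0_int] by simp
  have per: "U 0 (x + P) = U 0 x + m * P" for x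
    using U0[of x "x + P"] P integral_period[OF P assms(3) u0_HK, of x] mP by simp
  have m: "m \<in> {-M..M}"
  proof -
    have "\<bar>m * P\<bar> \<le> M * P" using lip0[of P 0] per[of 0] P by simp
    then have "\<bar>m\<bar> \<le> M" using P by (simp add: abs_mult)
    then show ?thesis by (simp add: abs_le_iff)
  qed
  have lipt: "\<bar>U t x - U s x\<bar> \<le> F * \<bar>t - s\<bar>" if "0 \<le> s" "0 \<le> t" for s t x
    using U_lip[OF that, of x x] by simp

  show ?thesis
  proof (intro exI allI impI)
    fix t :: real assume t: "0 < t"
    \<comment> \<open>At almost every \<open>x\<close> the right difference quotients of
      \<open>U t\<close> converge to \<open>v t x\<close>, so the slope bound for the potential
      becomes a bound on \<open>u t x\<close> itself.\<close>
    have "AE x in lebesgue. ((\<lambda>h. integral {x..x + h} (v t) / h) \<longlongrightarrow> v t x) (at_right 0)"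
      by (rule AE_right_derivative_integral[OF v_meas v_bound])
    then show "AE x in lebesgue. \<bar>u t x - m\<bar> \<le> ((P / c) powr (1 / p)) / t powr (1 / p)"
      using vu[OF t]
    proof eventually_elim
      case (elim x)
      have "\<forall>\<^sub>F h in at_right 0. integral {x..x + h} (v t) / h = (U t (x + h) - U t x) / h"
        using eventually_at_right_less[of "0 :: real"] by eventually_elim (simp add: U_increment)
      then have lim: "((\<lambda>h. (U t (x + h) - U t x) / h) \<longlongrightarrow> u t x) (at_right 0)"
        using elim Lim_transform_eventually by fastforce
      have slope: "u t x \<in> {-M..M} \<and> \<bar>a (u t x) - a m\<bar> \<le> P / t"
        by (rule monotone_periodic_slope_bound[OF M a inj comparison _ lip0 lipt per P m t lim])
          (use \<Lambda>(1) in simp)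
      then have "c * \<bar>u t x - m\<bar> powr p \<le> P / t"
        using c(2)[of "u t x" m] m by linarith
      then have "\<bar>u t x - m\<bar> powr p \<le> P / c / t"
        using c(1) t by (simp add: field_simps)
      then have "(\<bar>u t x - m\<bar> powr p) powr (1 / p) \<le> (P / c / t) powr (1 / p)"
        using p by (intro powr_mono2) auto
      moreover have "(\<bar>u t x - m\<bar> powr p) powr (1 / p) = \<bar>u t x - m\<bar>"
        using p by (simp add: powr_powr)
      ultimately show ?case using P c(1) t by (simp add: powr_divide powr_mult)
    qed
  qed
qed

end
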